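(* Let $p$ be a prime number, let $F\subseteq K$ be fields such that $K$ is a $\mathbb{Z}_p$-extension of $F$, and let $n$ be a positive integer. Let $\sigma_1\in \mathrm{Gal}(K/F)$ be such that the fixed field $K^{\sigma_1}$ equals $F$, and let $\sigma_2,\ldots,\sigma_n\in \mathrm{Gal}(K/F)$ be such that $\sigma_1,\ldots,\sigma_n$ are $\mathbb{Z}$-linearly independent in the (torsion-free abelian) group $\mathrm{Gal}(K/F)$. Let $G=\langle \sigma_1,\ldots,\sigma_n\rangle\subseteq \mathrm{Gal}(K/F)$, so $G\cong\mathbb{Z}^n$, and let $\psi\colon G\hookrightarrow \mathrm{Gal}(K/F)\subseteq \mathrm{Aut}(K)$ be the inclusion map. Let $R=K\#G$ be the twisted group ring formed with respect to $\psi$, and let $D=q(R)$ be its quotient division ring. Then $Z(D)=Z(R)=F$. Moreover, $D$ is locally PI but not PI, and $D$ has Gelfand--Kirillov dimension $n$ as an $F$-algebra.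
   Context: $\mathbb{Z}_p$-extension: $K$ is a $\mathbb{Z}_p$-extension of $F$ if there is a chain of intermediate fields $F\subseteq L_1\subseteq L_2\subseteq\cdots\subseteq K$ such that $K=\bigcup_{m=1}^\infty L_m$ and each $L_m$ is Galois over $F$ with $[L_m:F]=p^m$ and cyclic Galois group $\mathrm{Gal}(L_m/F)\cong \mathbb{Z}/p^m\mathbb{Z}$. Then $\mathrm{Gal}(K/F)\cong\mathbb{Z}_p$, the additive group of $p$-adic integers. Twisted group ring: for a field $K$, an abelian group $G$, and a group homomorphism $\psi\colon G\to\mathrm{Aut}(K)$, the ring $K\#G$ is the set of formal sums $\sum_{g\in G}c_g\,g$ with each $c_g\in K$ and almost all $c_g=0$, with coefficientwise addition and multiplication determined by $(c\,g)(d\,h)=(c\,\psi(g)(d))\,gh$ for $c,d\in K$, $g,h\in G$. When $G$ is free abelian of finite rank, $K\#G$ is a left and right Noetherian (hence left and right Ore) domain, and $q(K\#G)$ denotes its division ring of quotients. $Z(\cdot)$ denotes the center. An $F$-algebra is PI if it satisfies a polynomial identity, i.e., some nonzero polynomial in finitely many noncommuting variables with coefficients in $F$ vanishes under all substitutions of elements of the algebra; it is locally PI if every finitely generated $F$-subalgebra is PI. The Gelfand--Kirillov dimension of an $F$-algebra $A$ is $\sup_V \limsup_{m\to\infty} \log(\dim_F(V^m))/\log m$, where $V$ ranges over the finite-dimensional $F$-subspaces of $A$ containing $1$, and $V^m$ is the $F$-span of all products of $m$ elements of $V$. *)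

theory Defs
  imports
    "HOL-Algebra.Bij"
    "HOL-Algebra.Embedded_Algebras"
    "HOL-Algebra.Generated_Rings"
    "HOL-Algebra.Elementary_Groups"
    "HOL-Computational_Algebra.Primes"
    "HOL-Library.Extended_Real"
    "HOL-Library.Liminf_Limsup"
begin

section \<open>Galois groups and \<open>\<int>\<^sub>p\<close>-extensions\<close>

text \<open>
  As for \<open>AutoGroup\<close> in the library, automorphisms are extensional functions on the carrier, so that
  equality of automorphisms is equality of HOL functions.
\<close>

definition Gal :: "('a, 'm) ring_scheme \<Rightarrow> 'a set \<Rightarrow> ('a \<Rightarrow> 'a) monoid"
  where "Gal L F = BijGroup (carrier L)
    \<lparr>carrier := {\<tau> \<in> ring_iso L L \<inter> extensional (carrier L). \<forall>x\<in>F. \<tau> x = x}\<rparr>"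

definition fixed_field :: "('a, 'm) ring_scheme \<Rightarrow> ('a \<Rightarrow> 'a) set \<Rightarrow> 'a set"
  where "fixed_field L H = {x \<in> carrier L. \<forall>\<tau>\<in>H. \<tau> x = x}"

definition finite_galois_extension :: "('a, 'm) ring_scheme \<Rightarrow> 'a set \<Rightarrow> bool"
  where "finite_galois_extension L F \<longleftrightarrow>
    field L \<and> subfield F L \<and> ring.finite_dimension L F (carrier L) \<and>
    fixed_field L (carrier (Gal L F)) = F"

definition Zp_extension :: "nat \<Rightarrow> ('a, 'm) ring_scheme \<Rightarrow> 'a set \<Rightarrow> bool"
  where "Zp_extension p K F \<longleftrightarrow>
    (\<exists>L :: nat \<Rightarrow> 'a set.
       (\<forall>m\<ge>1. subfield (L m) K \<and> F \<subseteq> L m \<and> L m \<subseteq> L (Suc m)) \<and>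
       carrier K = (\<Union>m\<in>{1..}. L m) \<and>
       (\<forall>m\<ge>1. finite_galois_extension (K\<lparr>carrier := L m\<rparr>) F \<and>
               ring.dimension K (p ^ m) F (L m) \<and>
               Gal (K\<lparr>carrier := L m\<rparr>) F \<cong> integer_mod_group (p ^ m)))"

definition Z_linearly_independent ::
    "('g, 'm) monoid_scheme \<Rightarrow> 'i set \<Rightarrow> ('i \<Rightarrow> 'g) \<Rightarrow> bool"
  where "Z_linearly_independent G I s \<longleftrightarrow>
    (\<forall>k :: 'i \<Rightarrow> int. finprod G (\<lambda>i. s i [^]\<^bsub>G\<^esub> k i) I = \<one>\<^bsub>G\<^esub> \<longrightarrow> (\<forall>i\<in>I. k i = 0))"

section \<open>Twisted group rings\<close>

text \<open>A formal sum \<open>\<Sum> c\<^sub>g g\<close> is represented by its coefficient function, extensional on \<open>G\<close>.\<close>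

definition twisted_group_ring ::
    "('a, 'm) ring_scheme \<Rightarrow> ('g, 'k) monoid_scheme \<Rightarrow> ('g \<Rightarrow> 'a \<Rightarrow> 'a) \<Rightarrow> ('g \<Rightarrow> 'a) ring"
  where "twisted_group_ring K G \<psi> =
    \<lparr>carrier = {c \<in> carrier G \<rightarrow>\<^sub>E carrier K. finite {g \<in> carrier G. c g \<noteq> \<zero>\<^bsub>K\<^esub>}},
     monoid.mult = \<lambda>c d. \<lambda>k\<in>carrier G.
       finsum K (\<lambda>(g, h). c g \<otimes>\<^bsub>K\<^esub> \<psi> g (d h))
         {(g, h). g \<in> carrier G \<and> h \<in> carrier G \<and>
            c g \<noteq> \<zero>\<^bsub>K\<^esub> \<and> d h \<noteq> \<zero>\<^bsub>K\<^esub> \<and> g \<otimes>\<^bsub>G\<^esub> h = k},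
     one = \<lambda>g\<in>carrier G. if g = \<one>\<^bsub>G\<^esub> then \<one>\<^bsub>K\<^esub> else \<zero>\<^bsub>K\<^esub>,
     zero = \<lambda>g\<in>carrier G. \<zero>\<^bsub>K\<^esub>,
     add = \<lambda>c d. \<lambda>g\<in>carrier G. c g \<oplus>\<^bsub>K\<^esub> d g\<rparr>"

definition tgr_scalar ::
    "('a, 'm) ring_scheme \<Rightarrow> ('g, 'k) monoid_scheme \<Rightarrow> 'a \<Rightarrow> ('g \<Rightarrow> 'a)"
  where "tgr_scalar K G a = (\<lambda>g\<in>carrier G. if g = \<one>\<^bsub>G\<^esub> then a else \<zero>\<^bsub>K\<^esub>)"

section \<open>Division rings of quotients and centers\<close>

locale division_ring = ring R for R (structure) +
  assumes division_ring_Units: "Units R = carrier R - {\<zero>}"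

text \<open>
  \<open>D\<close>, together with the embedding \<open>\<iota>\<close>, is the division ring of (right) quotients of \<open>R\<close>. It
  is determined up to a unique isomorphism over \<open>R\<close>, and if \<open>R\<close> is also left Ore then it is
  the division ring of left quotients as well.
\<close>

definition division_ring_of_quotients ::
    "('r, 'm) ring_scheme \<Rightarrow> ('d, 'k) ring_scheme \<Rightarrow> ('r \<Rightarrow> 'd) \<Rightarrow> bool"
  where "division_ring_of_quotients R D \<iota> \<longleftrightarrow>
    division_ring D \<and> \<iota> \<in> ring_hom R D \<and> inj_on \<iota> (carrier R) \<and>
    (\<forall>x\<in>carrier D. \<exists>a\<in>carrier R. \<exists>s\<in>carrier R - {\<zero>\<^bsub>R\<^esub>}. x = \<iota> a \<otimes>\<^bsub>D\<^esub> inv\<^bsub>D\<^esub> (\<iota> s))"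

definition ring_center :: "('r, 'm) ring_scheme \<Rightarrow> 'r set"
  where "ring_center R = {z \<in> carrier R. \<forall>x\<in>carrier R. z \<otimes>\<^bsub>R\<^esub> x = x \<otimes>\<^bsub>R\<^esub> z}"

section \<open>Algebras over a central subfield\<close>

text \<open>
  As in \<^theory>\<open>HOL-Algebra.Embedded_Algebras\<close>, an \<open>F\<close>-algebra is a ring \<open>A\<close> with a (central)
  subfield \<open>F\<close>. The library's predicate \<open>subalgebra F V A\<close> says that \<open>V\<close> is an \<open>F\<close>-subspace
  of \<open>A\<close>; it does not ask for closure under multiplication.
\<close>

definition word_value :: "('r, 'm) ring_scheme \<Rightarrow> 'r list \<Rightarrow> 'r"
  where "word_value A xs = foldr (\<otimes>\<^bsub>A\<^esub>) xs \<one>\<^bsub>A\<^esub>"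

text \<open>
  A noncommutative polynomial is a finitely supported function \<open>f\<close> from words (lists of indices of
  variables) to coefficients.
\<close>

definition nc_polynomial :: "('r, 'm) ring_scheme \<Rightarrow> 'r set \<Rightarrow> (nat list \<Rightarrow> 'r) \<Rightarrow> bool"
  where "nc_polynomial A F f \<longleftrightarrow> range f \<subseteq> F \<and> finite {w. f w \<noteq> \<zero>\<^bsub>A\<^esub>}"

definition nc_eval :: "('r, 'm) ring_scheme \<Rightarrow> (nat list \<Rightarrow> 'r) \<Rightarrow> (nat \<Rightarrow> 'r) \<Rightarrow> 'r"
  where "nc_eval A f a = (\<Oplus>\<^bsub>A\<^esub>w \<in> {w. f w \<noteq> \<zero>\<^bsub>A\<^esub>}. f w \<otimes>\<^bsub>A\<^esub> word_value A (map a w))"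

definition PI_algebra :: "('r, 'm) ring_scheme \<Rightarrow> 'r set \<Rightarrow> bool"
  where "PI_algebra A F \<longleftrightarrow>
    (\<exists>f. nc_polynomial A F f \<and> (\<exists>w. f w \<noteq> \<zero>\<^bsub>A\<^esub>) \<and>
         (\<forall>a :: nat \<Rightarrow> 'r. range a \<subseteq> carrier A \<longrightarrow> nc_eval A f a = \<zero>\<^bsub>A\<^esub>))"

definition locally_PI_algebra :: "('r, 'm) ring_scheme \<Rightarrow> 'r set \<Rightarrow> bool"
  where "locally_PI_algebra A F \<longleftrightarrow>
    (\<forall>U. finite U \<and> U \<subseteq> carrier A \<longrightarrow> PI_algebra (A\<lparr>carrier := generate_ring A (F \<union> U)\<rparr>) F)"

definition linear_span :: "('r, 'm) ring_scheme \<Rightarrow> 'r set \<Rightarrow> 'r set \<Rightarrow> 'r set"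
  where "linear_span A F S = (\<Union>us\<in>lists S. ring.Span A F us)"

definition subspace_power :: "('r, 'm) ring_scheme \<Rightarrow> 'r set \<Rightarrow> 'r set \<Rightarrow> nat \<Rightarrow> 'r set"
  where "subspace_power A F V m =
    linear_span A F {word_value A xs | xs. length xs = m \<and> set xs \<subseteq> V}"

definition GK_dimension :: "('r, 'm) ring_scheme \<Rightarrow> 'r set \<Rightarrow> ereal"
  where "GK_dimension A F =
    (SUP V \<in> {V. subalgebra F V A \<and> ring.finite_dimension A F V \<and> \<one>\<^bsub>A\<^esub> \<in> V}.
       limsup (\<lambda>m::nat. ereal (ln (real (ring.dim A F (subspace_power A F V m))) / ln (real m))))"

end

theory Submission
  imports Defs "HOL-Combinatorics.Permutations"
begin

text \<open>
  The division ring \<open>D\<close> contains \<open>K\<close> and units \<open>u\<^sub>g\<close> with \<open>u\<^sub>g x = g(x) u\<^sub>g\<close>.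
  Comparing denominators with the fewest terms shows that \<open>K\<close> is its own centralizer in \<open>D\<close>, so the
  centre consists of the fixed points of \<open>\<sigma>\<^sub>1\<close>, that is of \<open>F\<close>. By Galois theory \<open>G\<close>
  preserves every layer \<open>L\<^sub>m\<close> and acts on it with exponent \<open>p\<^sup>m\<close>, so \<open>L\<^sub>m#G\<close> is finitely
  generated over its centre; hence every element has a nonzero central multiple, \<open>D\<close> is the union of
  the central localizations of the \<open>L\<^sub>m#G\<close>, and each of these satisfies a standard identity. A finite
  dimensional subspace of \<open>D\<close> thus has a common central denominator, and its growth is that of
  \<open>G = \<int>\<^sup>n\<close>. Finally, an identity of \<open>D\<close> evaluated at \<open>\<Sum> c\<^sub>j u\<^sub>g\<close> would be a linear
  relation between distinct characters.
\<close>

section \<open>Additive spans, linear systems and characters\<close>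

text \<open>Everything happens inside the given \<open>D\<close>; elements of a division ring have
  no normal form, and localization can in general increase growth. Both difficulties disappear
  because denominators can be chosen central at each layer: a central denominator \<open>z\<close>
  passes through all factors of a product, so a product of \<open>k\<close> elements of a subspace
  acquires the single denominator \<open>z [^] k\<close>, and dividing by it does not change
  dimensions. The price is that the centres of the layers need not be nested, which is why
  membership of an element in a localization is stated for all sufficiently large layers. That
  \<open>D\<close> has no identity although each localization has one is no contradiction: the
  degree of the identity found depends on the number of generators of the layer over its centre. One
  automorphism of infinite order is enough to exclude a common identity, since its powers act
  differently on \<open>K\<close> and so reveal the position of a coefficient within a
  monomial.\<close>

definition (in ring) adspan :: "'a set \<Rightarrow> 'a set"
  where "adspan B = generate (add_monoid R) B"

definition (in ring) centralizer :: "'a set \<Rightarrow> 'a set"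
  where "centralizer X = {z \<in> carrier R. \<forall>x\<in>X. z \<otimes> x = x \<otimes> z}"

text \<open>For a subring \<open>X\<close>, the additive span of this set is the left
  \<open>X\<close>-module generated by the \<open>u g\<close>. The additive description fits all
  coefficient sets that occur, among them the centres \<open>Zl m\<close> and not only
  subfields.\<close>

definition (in ring) product_set :: "'a set \<Rightarrow> ('i \<Rightarrow> 'a) \<Rightarrow> 'i set \<Rightarrow> 'a set"
  where "product_set X u A = {c \<otimes> u g | c g. c \<in> X \<and> g \<in> A}"

context ring
begin

lemma adspan_subgroup:
  assumes "B \<subseteq> carrier R" shows "subgroup (adspan B) (add_monoid R)"
  unfolding adspan_def using add.generate_is_subgroup[of B] assms by simp

lemma adspan_closed [intro]:
  assumes "B \<subseteq> carrier R" shows "adspan B \<subseteq> carrier R"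
  using subgroup.subset[OF adspan_subgroup[OF assms]] by simp

lemma adspan_incl: "b \<in> B \<Longrightarrow> b \<in> adspan B"
  unfolding adspan_def by (rule generate.incl)

lemma adspan_zero: "\<zero> \<in> adspan B"
  unfolding adspan_def using generate.one[of "add_monoid R" B] by simp

lemma adspan_add: "x \<in> adspan B \<Longrightarrow> y \<in> adspan B \<Longrightarrow> x \<oplus> y \<in> adspan B"
  unfolding adspan_def using generate.eng[of x "add_monoid R" B y] by simp

lemma adspan_neg:
  assumes "B \<subseteq> carrier R" "x \<in> adspan B" shows "\<ominus> x \<in> adspan B"
  using subgroup.m_inv_closed[OF adspan_subgroup[OF assms(1)] assms(2)] by (simp add: a_inv_def)

lemma adspan_minus:
  assumes "B \<subseteq> carrier R" "x \<in> adspan B" "y \<in> adspan B" shows "x \<ominus> y \<in> adspan B"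
  using adspan_add[OF assms(2) adspan_neg[OF assms(1,3)]] by (simp add: a_minus_def)

lemma adspan_min:
  assumes "B \<subseteq> H" "subgroup H (add_monoid R)" shows "adspan B \<subseteq> H"
  unfolding adspan_def
  by (rule add.generate_subgroup_incl[OF assms])

lemma add_subgroupI:
  assumes "H \<subseteq> carrier R" "\<zero> \<in> H" "\<And>x y. x \<in> H \<Longrightarrow> y \<in> H \<Longrightarrow> x \<oplus> y \<in> H"
    and "\<And>x. x \<in> H \<Longrightarrow> \<ominus> x \<in> H"
  shows "subgroup H (add_monoid R)"
  using assms by unfold_locales (auto simp: a_inv_def)

lemma adspan_induct [consumes 2, case_names zero incl add neg]:
  assumes "x \<in> adspan B" "B \<subseteq> carrier R" "P \<zero>" "\<And>b. b \<in> B \<Longrightarrow> P b"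
    and "\<And>x y. x \<in> carrier R \<Longrightarrow> y \<in> carrier R \<Longrightarrow> P x \<Longrightarrow> P y \<Longrightarrow> P (x \<oplus> y)"
    and "\<And>x. x \<in> carrier R \<Longrightarrow> P x \<Longrightarrow> P (\<ominus> x)"
  shows "P x"
proof -
  have "subgroup {x \<in> carrier R. P x} (add_monoid R)"
    by (rule add_subgroupI) (use assms(3-) in auto)
  then have "adspan B \<subseteq> {x \<in> carrier R. P x}"
    by (intro adspan_min) (use assms(2,4) in auto)
  then show ?thesis using assms(1) by auto
qed

lemma adspan_mono: "B \<subseteq> B' \<Longrightarrow> adspan B \<subseteq> adspan B'"
  unfolding adspan_def by (rule add.mono_generate)

text \<open>Multiplication is biadditive, so products of generators decide: an inner induction
  treats the right factor for a fixed generator on the left, an outer one the left factor.\<close>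

lemma adspan_mult:
  assumes "A \<subseteq> carrier R" "B \<subseteq> carrier R" "C \<subseteq> carrier R"
    and ab: "\<And>a b. a \<in> A \<Longrightarrow> b \<in> B \<Longrightarrow> a \<otimes> b \<in> adspan C"
    and "x \<in> adspan A" "y \<in> adspan B"
  shows "x \<otimes> y \<in> adspan C"
proof -
  have y: "y \<in> carrier R" using adspan_closed[OF assms(2)] assms(6) by auto
  have 1: "a \<otimes> y \<in> adspan C" if a: "a \<in> A" for a
  proof -
    have ac: "a \<in> carrier R" using a assms(1) by blast
    show ?thesis using assms(6,2)
  proof (induction rule: adspan_induct)
    case zero then show ?case using ac by (auto simp: adspan_zero)
  next
    case (incl b) then show ?case using ab[OF a] by simp
  next
    case (add x y)
    then show ?case using ac by (auto simp: r_distr intro: adspan_add)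
  next
    case (neg x)
    then show ?case using ac by (auto simp: r_minus intro: adspan_neg[OF assms(3)])
  qed
  qed
  show ?thesis
    using assms(5,1)
  proof (induction rule: adspan_induct)
    case zero then show ?case using y by (simp add: adspan_zero)
  next
    case (incl b) then show ?case using 1 by simp
  next
    case (add x z)
    then show ?case using y by (auto simp: l_distr intro: adspan_add)
  next
    case (neg x)
    then show ?case using y by (auto simp: l_minus intro: adspan_neg[OF assms(3)])
  qed
qed

lemma add_subgroup_simps:
  assumes "subgroup H (add_monoid R)"
  shows "H \<subseteq> carrier R" "\<zero> \<in> H" "\<And>x y. x \<in> H \<Longrightarrow> y \<in> H \<Longrightarrow> x \<oplus> y \<in> H"
    "\<And>x. x \<in> H \<Longrightarrow> \<ominus> x \<in> H"
  using subgroup.subset[OF assms] subgroup.one_closed[OF assms] subgroup.m_closed[OF assms]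
    subgroup.m_inv_closed[OF assms] by (auto simp: a_inv_def)

lemma finsum_in_add_subgroup:
  assumes "subgroup H (add_monoid R)" "f \<in> A \<rightarrow> H"
  shows "finsum R f A \<in> H"
proof (cases "finite A")
  case True
  note H = add_subgroup_simps[OF assms(1)]
  from True assms(2) show ?thesis
  proof (induction A)
    case (insert a A)
    then have "finsum R f (insert a A) = f a \<oplus> finsum R f A"
      by (intro finsum_insert) (use H(1) in auto)
    then show ?case using insert H(3) by auto
  qed (use H in simp)
next
  case False
  then show ?thesis using add_subgroup_simps[OF assms(1)] by (simp add: finsum_infinite)
qed

lemma product_set_closed:
  assumes "X \<subseteq> carrier R" "u \<in> A \<rightarrow> carrier R"
  shows "product_set X u A \<subseteq> carrier R"
  unfolding product_set_def using assms by (auto simp: Pi_iff)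

lemma product_setI: "c \<in> X \<Longrightarrow> g \<in> A \<Longrightarrow> c \<otimes> u g \<in> product_set X u A"
  unfolding product_set_def by auto

lemma product_set_mono: "X \<subseteq> Y \<Longrightarrow> A \<subseteq> B \<Longrightarrow> product_set X u A \<subseteq> product_set Y u B"
  unfolding product_set_def by auto

lemma finsum_split_zero:
  assumes "finite B" "A \<subseteq> B" "f \<in> B \<rightarrow> carrier R" "\<And>b. b \<in> B - A \<Longrightarrow> f b = \<zero>"
  shows "finsum R f B = finsum R f A"
  by (rule add.finprod_mono_neutral_cong_left[symmetric, simplified])
    (use assms in \<open>auto simp: Pi_iff\<close>)

lemma adspan_product_set_repr:
  assumes X: "subgroup X (add_monoid R)" and A: "u \<in> A \<rightarrow> carrier R"
    and x: "x \<in> adspan (product_set X u A)"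
  obtains B c where "finite B" "B \<subseteq> A" "c \<in> UNIV \<rightarrow> X" "x = (\<Oplus>g\<in>B. c g \<otimes> u g)"
proof -
  note Xs = add_subgroup_simps[OF X]
  \<comment> \<open>The induction also demands that \<open>c\<close> vanish outside
    \<open>B\<close>, so that two representations can be padded to the union of their index sets and
    added there.\<close>
  have "\<exists>B c. finite B \<and> B \<subseteq> A \<and> c \<in> UNIV \<rightarrow> X \<and> (\<forall>g. g \<notin> B \<longrightarrow> c g = \<zero>) \<and> x = (\<Oplus>g\<in>B. c g \<otimes> u g)"
    using x product_set_closed[OF Xs(1) A]
  proof (induction rule: adspan_induct)
    case zero
    then show ?case by (intro exI[of _ "{}"] exI[of _ "\<lambda>_. \<zero>"]) (use Xs in auto)
  next
    case (incl b)
    then obtain c g where cg: "c \<in> X" "g \<in> A" "b = c \<otimes> u g" unfolding product_set_def by auto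
    have "c \<in> carrier R" "u g \<in> carrier R" using cg Xs(1) A by auto
    then have "b = (\<Oplus>h\<in>{g}. (if h = g then c else \<zero>) \<otimes> u h)"
      using cg(3) by (subst finsum_insert) (auto simp: finsum_empty)
    moreover have "(\<lambda>h. if h = g then c else \<zero>) \<in> UNIV \<rightarrow> X" using cg Xs by auto
    ultimately show ?case using cg(2)
      by (intro exI[of _ "{g}"] exI[of _ "\<lambda>h. if h = g then c else \<zero>"] conjI) simp_all
  next
    case (add x y)
    from add.IH(1) obtain B c where B1: "finite B" "B \<subseteq> A" "c \<in> UNIV \<rightarrow> X" "\<forall>g. g \<notin> B \<longrightarrow> c g = \<zero>"
       "x = (\<Oplus>g\<in>B. c g \<otimes> u g)" by (elim exE conjE)
    from add.IH(2) obtain B' c' where B2: "finite B'" "B' \<subseteq> A" "c' \<in> UNIV \<rightarrow> X"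
       "\<forall>g. g \<notin> B' \<longrightarrow> c' g = \<zero>" "y = (\<Oplus>g\<in>B'. c' g \<otimes> u g)" by (elim exE conjE)
    note B = B1 B2
    have uc: "u g \<in> carrier R" if "g \<in> B \<union> B'" for g using that A B(2,7) by auto
    have cc: "c g \<in> carrier R" "c' g \<in> carrier R" for g using B(3,8) Xs(1) by (auto simp: Pi_iff)
    have "x = (\<Oplus>g\<in>B \<union> B'. c g \<otimes> u g)" unfolding B(5)
      by (rule finsum_split_zero[symmetric]) (use B uc cc in auto)
    moreover have "y = (\<Oplus>g\<in>B \<union> B'. c' g \<otimes> u g)" unfolding B(10)
      by (rule finsum_split_zero[symmetric]) (use B uc cc in auto)
    ultimately have "x \<oplus> y = (\<Oplus>g\<in>B \<union> B'. c g \<otimes> u g \<oplus> c' g \<otimes> u g)"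
      using uc cc by (subst finsum_addf) auto
    also have "\<dots> = (\<Oplus>g\<in>B \<union> B'. (c g \<oplus> c' g) \<otimes> u g)"
      by (rule finsum_cong') (use uc cc in \<open>auto simp: l_distr\<close>)
    finally show ?case using B Xs(2,3)
      by (intro exI[of _ "B \<union> B'"] exI[of _ "\<lambda>g. c g \<oplus> c' g"]) (auto simp: Pi_iff)
  next
    case (neg x)
    from neg.IH obtain B c where B: "finite B" "B \<subseteq> A" "c \<in> UNIV \<rightarrow> X" "\<forall>g. g \<notin> B \<longrightarrow> c g = \<zero>"
       "x = (\<Oplus>g\<in>B. c g \<otimes> u g)" by (elim exE conjE)
    have uc: "u g \<in> carrier R" if "g \<in> B" for g using that A B(2) by auto
    have cc: "c g \<in> carrier R" for g using B(3) Xs(1) by (auto simp: Pi_iff)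
    have "(\<Oplus>g\<in>B. \<ominus> c g \<otimes> u g) \<oplus> x = (\<Oplus>g\<in>B. \<ominus> c g \<otimes> u g \<oplus> c g \<otimes> u g)"
      unfolding B(5) using uc cc by (subst finsum_addf) auto
    also have "\<dots> = (\<Oplus>g\<in>B. \<zero>)"
      by (rule finsum_cong') (use uc cc in \<open>auto simp: l_minus l_neg\<close>)
    also have "\<dots> = \<zero>" by (rule finsum_zero)
    finally have "\<ominus> x = (\<Oplus>g\<in>B. \<ominus> c g \<otimes> u g)"
      by (intro minus_equality) (use uc cc neg in auto)
    then show ?case using B Xs
      by (intro exI[of _ "B"] exI[of _ "\<lambda>g. \<ominus> c g"]) (auto simp: Pi_iff)
  qed
  then show ?thesis using that by blast
qed

text \<open>Padding with zero coefficients makes the whole finite set \<open>A\<close> the index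
  set, so that representations of different elements can be compared coefficient by
  coefficient.\<close>

lemma adspan_product_set_finite_repr:
  assumes X: "subgroup X (add_monoid R)" and A: "u \<in> A \<rightarrow> carrier R" "finite A"
    and x: "x \<in> adspan (product_set X u A)"
  obtains c where "c \<in> UNIV \<rightarrow> X" "x = (\<Oplus>g\<in>A. c g \<otimes> u g)"
proof -
  obtain B c where B: "finite B" "B \<subseteq> A" "c \<in> UNIV \<rightarrow> X" "x = (\<Oplus>g\<in>B. c g \<otimes> u g)"
    using adspan_product_set_repr[OF X A(1) x] by blast
  note Xs = add_subgroup_simps[OF X]
  have uc: "u g \<in> carrier R" if "g \<in> A" for g using that A by auto
  have cc: "c g \<in> carrier R" for g using B(3) Xs(1) by (auto simp: Pi_iff)
  let ?c = "\<lambda>g. if g \<in> B then c g else \<zero>"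
  have "x = (\<Oplus>g\<in>B. ?c g \<otimes> u g)" unfolding B(4)
    by (rule finsum_cong') (use B uc cc in auto)
  also have "\<dots> = (\<Oplus>g\<in>A. ?c g \<otimes> u g)"
    by (rule finsum_split_zero[symmetric]) (use B uc cc A in auto)
  finally show ?thesis by (intro that[of ?c]) (use B(3) Xs(2) in auto)
qed

lemma centralizer_subring:
  assumes "X \<subseteq> carrier R" shows "subring (centralizer X) R"
proof (rule subringI)
  fix a b assume ab: "a \<in> centralizer X" "b \<in> centralizer X"
  have "a \<otimes> b \<otimes> x = x \<otimes> (a \<otimes> b)" if "x \<in> X" for x
  proof -
    have c: "x \<in> carrier R" "a \<in> carrier R" "b \<in> carrier R" and e: "a \<otimes> x = x \<otimes> a" "b \<otimes> x = x \<otimes> b"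
      using ab that assms by (auto simp: centralizer_def)
    have "a \<otimes> b \<otimes> x = a \<otimes> (x \<otimes> b)" using c e by (simp add: m_assoc)
    also have "\<dots> = x \<otimes> a \<otimes> b" using c e by (simp add: m_assoc[symmetric])
    finally show ?thesis using c by (simp add: m_assoc)
  qed
  then show "a \<otimes> b \<in> centralizer X" using ab by (simp add: centralizer_def)
  show "a \<oplus> b \<in> centralizer X"
    using ab assms by (auto simp: centralizer_def l_distr r_distr subset_iff)
qed (use assms in \<open>auto simp: centralizer_def l_minus r_minus subset_iff\<close>)

lemma centralizer_adspan:
  assumes "X \<subseteq> carrier R" "z \<in> centralizer X" shows "z \<in> centralizer (adspan X)"
proof -
  have z: "z \<in> carrier R" using assms by (simp add: centralizer_def)
  have "z \<otimes> x = x \<otimes> z" if "x \<in> adspan X" for x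
    using that assms(1)
  proof (induction rule: adspan_induct)
    case (incl b) then show ?case using assms by (simp add: centralizer_def)
  qed (use z in \<open>auto simp: l_distr r_distr l_minus r_minus\<close>)
  then show ?thesis using z by (simp add: centralizer_def)
qed

text \<open>Results on domains get applied to commutative subrings of \<open>D\<close>; their sums
  have to be recognised as sums in \<open>D\<close>.\<close>

lemma finsum_consistent:
  assumes "subring K R" "f \<in> A \<rightarrow> K"
  shows "finsum (R\<lparr>carrier := K\<rparr>) f A = finsum R f A"
proof (cases "finite A")
  interpret K: ring "R\<lparr>carrier := K\<rparr>" using subring_is_ring[OF assms(1)] .
  case True
  from True assms(2) show ?thesis
  proof (induction A)
    case empty
    then show ?case using K.finsum_empty finsum_empty by simp
  next
    case (insert a A)
    have "finsum (R\<lparr>carrier := K\<rparr>) f (insert a A) = f a \<oplus> finsum (R\<lparr>carrier := K\<rparr>) f A"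
      using K.finsum_insert[of A a f] insert by auto
    also have "\<dots> = f a \<oplus> finsum R f A" using insert by simp
    also have "\<dots> = finsum R f (insert a A)"
      using insert subringE(1)[OF assms(1)] by (intro finsum_insert[symmetric]) auto
    finally show ?case .
  qed
next
  interpret K: ring "R\<lparr>carrier := K\<rparr>" using subring_is_ring[OF assms(1)] .
  case False
  then show ?thesis using K.finsum_infinite finsum_infinite by simp
qed

end

text \<open>Gaussian elimination, by induction on the equations. It is kept free of division because
  it serves over the centres \<open>Zl m\<close>, which need not be fields.\<close>

lemma (in domain) homogeneous_system:
  assumes "finite I" "finite J" "card I < card J"
    and "\<And>i j. i \<in> I \<Longrightarrow> j \<in> J \<Longrightarrow> a i j \<in> carrier R"
  obtains k where "k \<in> J \<rightarrow> carrier R" "\<exists>j\<in>J. k j \<noteq> \<zero>"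
    "\<And>i. i \<in> I \<Longrightarrow> (\<Oplus>j\<in>J. a i j \<otimes> k j) = \<zero>"
proof -
  have "\<exists>k. k \<in> J \<rightarrow> carrier R \<and> (\<exists>j\<in>J. k j \<noteq> \<zero>) \<and> (\<forall>i\<in>I. (\<Oplus>j\<in>J. a i j \<otimes> k j) = \<zero>)"
    using assms
  proof (induction I arbitrary: J a)
    case empty
    then show ?case by (intro exI[of _ "\<lambda>_. \<one>"]) (auto simp: card_gt_0_iff)
  next
    case (insert r I J a)
    note ac = insert.prems(3)
    show ?case
    proof (cases "\<forall>j\<in>J. a r j = \<zero>")
      case True
      have "card I < card J" using insert.prems(2) insert.hyps by simp
      then have "\<exists>k. k \<in> J \<rightarrow> carrier R \<and> (\<exists>j\<in>J. k j \<noteq> \<zero>)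
          \<and> (\<forall>i\<in>I. (\<Oplus>j\<in>J. a i j \<otimes> k j) = \<zero>)"
        by (rule insert.IH[OF insert.prems(1)]) (use ac in auto)
      then
      obtain k where k: "k \<in> J \<rightarrow> carrier R" "\<exists>j\<in>J. k j \<noteq> \<zero>"
         "\<forall>i\<in>I. (\<Oplus>j\<in>J. a i j \<otimes> k j) = \<zero>" by (elim exE conjE)
      have "(\<Oplus>j\<in>J. a r j \<otimes> k j) = (\<Oplus>j\<in>J. \<zero>)"
        by (rule finsum_cong') (use True k in \<open>auto simp: Pi_iff\<close>)
      then show ?thesis using k by (auto simp: finsum_zero)
    next
      case False
      then obtain l where l: "l \<in> J" "a r l \<noteq> \<zero>" by auto
      let ?J = "J - {l}"
      \<comment> \<open>Cross-multiplication with the pivot \<open>a r l\<close> eliminates the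
        unknown \<open>l\<close> from the other rows.\<close>
      let ?b = "\<lambda>i j. a r l \<otimes> a i j \<ominus> a i l \<otimes> a r j"
      have fJ: "finite ?J" "l \<notin> ?J" "J = insert l ?J" using insert.prems l by auto
      have "card I < card ?J" using insert l by auto
      moreover have "\<And>i j. i \<in> I \<Longrightarrow> j \<in> ?J \<Longrightarrow> ?b i j \<in> carrier R" using ac l by auto
      ultimately have "\<exists>k. k \<in> ?J \<rightarrow> carrier R \<and> (\<exists>j\<in>?J. k j \<noteq> \<zero>)
          \<and> (\<forall>i\<in>I. (\<Oplus>j\<in>?J. ?b i j \<otimes> k j) = \<zero>)"
        by (rule insert.IH[OF fJ(1)])
      then obtain k where k: "k \<in> ?J \<rightarrow> carrier R" "\<exists>j\<in>?J. k j \<noteq> \<zero>"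
         "\<forall>i\<in>I. (\<Oplus>j\<in>?J. ?b i j \<otimes> k j) = \<zero>"
        by (elim exE conjE)
      have kc: "k j \<in> carrier R" if "j \<in> ?J" for j using k(1) that by auto
      define t where "t = (\<Oplus>j\<in>?J. a r j \<otimes> k j)"
      have tc: "t \<in> carrier R" unfolding t_def by (rule finsum_closed) (use ac l kc in auto)
      \<comment> \<open>Scaling the other unknowns by the pivot makes row \<open>r\<close> solvable
        for the unknown \<open>l\<close> within the domain.\<close>
      define k' where "k' = (\<lambda>j. if j = l then \<ominus> t else a r l \<otimes> k j)"
      have k'c: "k' \<in> J \<rightarrow> carrier R" using tc kc ac l by (auto simp: k'_def)
      have sp: "(\<Oplus>j\<in>J. a i j \<otimes> k' j) = \<ominus> (a i l \<otimes> t) \<oplus> a r l \<otimes> (\<Oplus>j\<in>?J. a i j \<otimes> k j)"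
        if i: "i \<in> insert r I" for i
      proof -
        have "(\<Oplus>j\<in>J. a i j \<otimes> k' j) = (\<Oplus>j\<in>insert l ?J. a i j \<otimes> k' j)" using fJ(3) by simp
        also have "\<dots> = a i l \<otimes> k' l \<oplus> (\<Oplus>j\<in>?J. a i j \<otimes> k' j)"
          by (rule finsum_insert) (use fJ k'c ac i l in auto)
        also have "(\<Oplus>j\<in>?J. a i j \<otimes> k' j) = (\<Oplus>j\<in>?J. a r l \<otimes> (a i j \<otimes> k j))"
          by (rule finsum_cong') (use kc ac i l in \<open>auto simp: k'_def Pi_iff m_lcomm\<close>)
        also have "\<dots> = a r l \<otimes> (\<Oplus>j\<in>?J. a i j \<otimes> k j)"
          by (rule finsum_rdistr[symmetric]) (use fJ kc ac i l in auto)
        also have "a i l \<otimes> k' l = \<ominus> (a i l \<otimes> t)" using tc ac i l by (simp add: k'_def r_minus)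
        finally show ?thesis .
      qed
      have "(\<Oplus>j\<in>J. a r j \<otimes> k' j) = \<zero>"
        using sp[of r] l ac tc by (simp add: t_def[symmetric] l_neg)
      moreover have "(\<Oplus>j\<in>J. a i j \<otimes> k' j) = \<zero>" if i: "i \<in> I" for i
      proof -
        have "\<zero> = (\<Oplus>j\<in>?J. ?b i j \<otimes> k j)" using k i by simp
        also have "\<dots> = (\<Oplus>j\<in>?J. a r l \<otimes> (a i j \<otimes> k j) \<oplus> (\<ominus> a i l) \<otimes> (a r j \<otimes> k j))"
          by (rule finsum_cong')
            (use kc ac i l in \<open>auto simp: Pi_iff a_minus_def l_distr l_minus m_assoc\<close>)
        also have "\<dots> = (\<Oplus>j\<in>?J. a r l \<otimes> (a i j \<otimes> k j)) \<oplus> (\<Oplus>j\<in>?J. (\<ominus> a i l) \<otimes> (a r j \<otimes> k j))"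
          by (rule finsum_addf) (use kc ac i l in auto)
        also have "(\<Oplus>j\<in>?J. a r l \<otimes> (a i j \<otimes> k j)) = a r l \<otimes> (\<Oplus>j\<in>?J. a i j \<otimes> k j)"
          by (rule finsum_rdistr[symmetric]) (use fJ kc ac i l in auto)
        also have "(\<Oplus>j\<in>?J. (\<ominus> a i l) \<otimes> (a r j \<otimes> k j)) = (\<ominus> a i l) \<otimes> t" unfolding t_def
          by (rule finsum_rdistr[symmetric]) (use fJ kc ac i l in auto)
        finally have "\<zero> = a r l \<otimes> (\<Oplus>j\<in>?J. a i j \<otimes> k j) \<oplus> \<ominus> a i l \<otimes> t" .
        moreover have "(\<Oplus>j\<in>?J. a i j \<otimes> k j) \<in> carrier R"
          by (rule finsum_closed) (use kc ac i l in auto)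
        ultimately show ?thesis using sp[of i] i ac l tc by (simp add: l_minus a_comm)
      qed
      moreover have "\<exists>j\<in>J. k' j \<noteq> \<zero>"
      proof -
        obtain j where j: "j \<in> ?J" "k j \<noteq> \<zero>" using k by auto
        then have "k' j \<noteq> \<zero>" using l ac k integral[of "a r l" "k j"] by (auto simp: k'_def Pi_iff)
        then show ?thesis using j by auto
      qed
      ultimately show ?thesis using k'c by auto
    qed
  qed
  then show ?thesis using that by blast
qed

text \<open>Dedekind's argument in a form that isolates one index: \<open>\<chi> i\<close> must
  differ from each of the others, which may coincide among themselves. If \<open>y\<close> separates
  \<open>\<chi> l\<close> from \<open>\<chi> i\<close>, the relation at \<open>f y x\<close> minus
  \<open>\<chi> l y\<close> times the relation at \<open>x\<close> loses the term of
  \<open>l\<close> and multiplies the coefficient of \<open>i\<close> by a nonzero factor.\<close>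

lemma (in domain) independence_of_characters:
  assumes "finite J" "\<And>x y. x \<in> X \<Longrightarrow> y \<in> X \<Longrightarrow> f x y \<in> X"
    and hom: "\<And>x y j. j \<in> insert i J \<Longrightarrow> x \<in> X \<Longrightarrow> y \<in> X \<Longrightarrow> \<chi> j (f x y) = \<chi> j x \<otimes> \<chi> j y"
    and cl: "\<And>x j. j \<in> insert i J \<Longrightarrow> x \<in> X \<Longrightarrow> \<chi> j x \<in> carrier R"
    and ne: "\<exists>x\<in>X. \<chi> i x \<noteq> \<zero>" "\<And>j. j \<in> J \<Longrightarrow> \<exists>x\<in>X. \<chi> j x \<noteq> \<chi> i x"
    and k: "k i \<in> carrier R" "k \<in> J \<rightarrow> carrier R"
    and eq: "\<And>x. x \<in> X \<Longrightarrow> k i \<otimes> \<chi> i x \<oplus> (\<Oplus>j\<in>J. k j \<otimes> \<chi> j x) = \<zero>"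
  shows "k i = \<zero>"
proof -
  \<comment> \<open>On the right the two terms with \<open>kl\<close> cancel by commutativity;
    \<open>T\<close> and \<open>S\<close> stand for the remaining sums at \<open>f y x\<close> and
    at \<open>x\<close>.\<close>
  have shift: "c \<otimes> (yi \<ominus> yl) \<otimes> xi \<oplus> (T \<oplus> (\<ominus> yl) \<otimes> S)
      = (c \<otimes> (yi \<otimes> xi) \<oplus> (kl \<otimes> (yl \<otimes> xl) \<oplus> T)) \<ominus> yl \<otimes> (c \<otimes> xi \<oplus> (kl \<otimes> xl \<oplus> S))"
    if "c \<in> carrier R" "xi \<in> carrier R" "yi \<in> carrier R" "kl \<in> carrier R" "xl \<in> carrier R"
      "yl \<in> carrier R" "S \<in> carrier R" "T \<in> carrier R" for c xi yi kl xl yl S T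
    using that by algebra
  have "c = \<zero>" if "c \<in> carrier R" "k \<in> J \<rightarrow> carrier R"
     "\<And>x. x \<in> X \<Longrightarrow> c \<otimes> \<chi> i x \<oplus> (\<Oplus>j\<in>J. k j \<otimes> \<chi> j x) = \<zero>" for c k
    using assms(1) hom cl ne(2) that
  proof (induction J arbitrary: c k)
    case empty
    obtain x where "x \<in> X" "\<chi> i x \<noteq> \<zero>" using ne by auto
    then show ?case using empty(6)[of x] empty(4) empty(2)[of i x] integral[of c "\<chi> i x"] by (auto simp: finsum_empty)
  next
    case (insert l J)
    note cl = insert.prems(2) and hom = insert.prems(1)
    obtain y where y: "y \<in> X" "\<chi> l y \<noteq> \<chi> i y" using insert.prems(3)[of l] by auto
    let ?d = "\<lambda>j. \<chi> j y \<ominus> \<chi> l y"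
    have dc: "?d j \<in> carrier R" if "j \<in> insert i J" for j using cl y that by auto
    have "c \<otimes> ?d i = \<zero>"
    proof (rule insert.IH[of _ "\<lambda>j. k j \<otimes> ?d j"])
      fix x assume x: "x \<in> X"
      have kc: "k j \<in> carrier R" if "j \<in> insert l J" for j using insert.prems that by auto
      have xc: "\<chi> j x \<in> carrier R" if "j \<in> insert i (insert l J)" for j using cl x that by auto
      have yc: "\<chi> j y \<in> carrier R" if "j \<in> insert i (insert l J)" for j using cl y that by auto
      let ?S = "\<Oplus>j\<in>J. k j \<otimes> \<chi> j x" and ?T = "\<Oplus>j\<in>J. k j \<otimes> \<chi> j (f y x)"
      have S: "?S \<in> carrier R" using kc xc by (intro finsum_closed) auto
      have fc: "\<chi> j (f y x) = \<chi> j y \<otimes> \<chi> j x" if "j \<in> insert i (insert l J)" for j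
        using hom that x y by auto
      have T: "?T \<in> carrier R" using kc xc yc fc by (intro finsum_closed) auto
      have e1: "c \<otimes> \<chi> i x \<oplus> (k l \<otimes> \<chi> l x \<oplus> ?S) = \<zero>"
        using insert.prems(6)[OF x] insert.hyps kc xc by (subst (asm) finsum_insert) auto
      have e2: "c \<otimes> (\<chi> i y \<otimes> \<chi> i x) \<oplus> (k l \<otimes> (\<chi> l y \<otimes> \<chi> l x) \<oplus> ?T) = \<zero>"
        using insert.prems(6)[OF assms(2)[OF y(1) x]] insert.hyps kc xc yc fc
        by (subst (asm) finsum_insert) auto
      have "(\<Oplus>j\<in>J. k j \<otimes> ?d j \<otimes> \<chi> j x)
          = (\<Oplus>j\<in>J. k j \<otimes> \<chi> j (f y x) \<oplus> (\<ominus> \<chi> l y) \<otimes> (k j \<otimes> \<chi> j x))"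
        by (rule finsum_cong') (use kc xc yc fc in \<open>auto, algebra\<close>)
      also have "\<dots> = ?T \<oplus> (\<Oplus>j\<in>J. (\<ominus> \<chi> l y) \<otimes> (k j \<otimes> \<chi> j x))"
        by (rule finsum_addf) (use kc xc yc fc in auto)
      also have "(\<Oplus>j\<in>J. (\<ominus> \<chi> l y) \<otimes> (k j \<otimes> \<chi> j x)) = (\<ominus> \<chi> l y) \<otimes> ?S"
        by (rule finsum_rdistr[symmetric]) (use kc xc yc insert.hyps in auto)
      finally have e3: "(\<Oplus>j\<in>J. k j \<otimes> ?d j \<otimes> \<chi> j x) = ?T \<oplus> (\<ominus> \<chi> l y) \<otimes> ?S" .
      have cs: "c \<in> carrier R" "\<chi> i x \<in> carrier R" "\<chi> i y \<in> carrier R" "k l \<in> carrier R"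
         "\<chi> l x \<in> carrier R" "\<chi> l y \<in> carrier R"
        using insert.prems xc yc kc by auto
      have "c \<otimes> ?d i \<otimes> \<chi> i x \<oplus> (?T \<oplus> (\<ominus> \<chi> l y) \<otimes> ?S)
        = (c \<otimes> (\<chi> i y \<otimes> \<chi> i x) \<oplus> (k l \<otimes> (\<chi> l y \<otimes> \<chi> l x) \<oplus> ?T))
          \<ominus> \<chi> l y \<otimes> (c \<otimes> \<chi> i x \<oplus> (k l \<otimes> \<chi> l x \<oplus> ?S))"
        using cs S T by (intro shift)
      also have "\<dots> = \<zero>" unfolding e1 e2 using cs by simp
      finally show "c \<otimes> ?d i \<otimes> \<chi> i x \<oplus> (\<Oplus>j\<in>J. k j \<otimes> ?d j \<otimes> \<chi> j x) = \<zero>"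
        unfolding e3 .
    qed (use insert dc in auto)
    moreover have "?d i \<noteq> \<zero>" using y cl by auto
    ultimately show ?case using integral[of c "?d i"] insert.prems(4) dc by auto
  qed
  then show ?thesis using k eq by blast
qed

section \<open>The standard identity\<close>

definition (in ring) standard_poly :: "nat \<Rightarrow> (nat \<Rightarrow> 'a) \<Rightarrow> 'a"
  where "standard_poly M x = (\<Oplus>\<pi>\<in>{\<pi>. \<pi> permutes {..<M}}.
    (if evenperm \<pi> then \<one> else \<ominus> \<one>) \<otimes> word_value R (map x (map \<pi> [0..<M])))"

context ring
begin

lemma word_value_Nil [simp]: "word_value R [] = \<one>"
  and word_value_Cons [simp]: "word_value R (a # w) = a \<otimes> word_value R w"
  by (auto simp: word_value_def)

lemma word_value_closed [simp, intro]: "set w \<subseteq> carrier R \<Longrightarrow> word_value R w \<in> carrier R"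
  by (induction w) auto

lemma word_value_append:
  "set v \<subseteq> carrier R \<Longrightarrow> set w \<subseteq> carrier R \<Longrightarrow> word_value R (v @ w) = word_value R v \<otimes> word_value R w"
  by (induction v) (auto simp: m_assoc)

text \<open>A letter that occurs once cuts the word into a left and a right factor, so the word is
  linear in that slot. A scalar \<open>q\<close> only has to pass the left factor, hence has to
  commute with the other entries and not with \<open>y\<close>.\<close>

lemma word_value_slot:
  assumes x: "x \<in> UNIV \<rightarrow> carrier R" and w: "distinct w" "k \<in> set w"
  obtains l r where "l \<in> carrier R" "r \<in> carrier R"
    "\<And>y. y \<in> carrier R \<Longrightarrow> word_value R (map (x(k := y)) w) = l \<otimes> (y \<otimes> r)"
    "\<And>q. q \<in> carrier R \<Longrightarrow> (\<And>i. i \<in> set w - {k} \<Longrightarrow> q \<otimes> x i = x i \<otimes> q) \<Longrightarrow> l \<otimes> q = q \<otimes> l"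
proof -
  obtain v u where vu: "w = v @ k # u" using w(2) by (meson split_list)
  have xc: "x i \<in> carrier R" for i using x by auto
  have c: "set (map x v) \<subseteq> carrier R" "set (map x u) \<subseteq> carrier R" using x by auto
  have "word_value R (map (x(k := y)) w) = word_value R (map x v) \<otimes> (y \<otimes> word_value R (map x u))"
    if "y \<in> carrier R" for y
  proof -
    have "map (x(k := y)) w = map x v @ y # map x u" using w(1) by (auto simp: vu)
    then show ?thesis using word_value_append[OF c(1), of "y # map x u"] c that by simp
  qed
  moreover have "word_value R (map x v) \<otimes> q = q \<otimes> word_value R (map x v)"
    if q: "q \<in> carrier R" "\<And>i. i \<in> set w - {k} \<Longrightarrow> q \<otimes> x i = x i \<otimes> q" for q
  proof -
    have "\<And>i. i \<in> set v \<Longrightarrow> q \<otimes> x i = x i \<otimes> q" using q(2) w(1) by (auto simp: vu)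
    then show ?thesis
    proof (induction v)
      case Nil
      then show ?case using q by simp
    next
      case (Cons a v)
      have vc: "word_value R (map x v) \<in> carrier R" using xc by (intro word_value_closed) auto
      have "word_value R (map x (a # v)) \<otimes> q = x a \<otimes> (word_value R (map x v) \<otimes> q)"
        using vc xc q(1) by (simp add: m_assoc)
      also have "\<dots> = x a \<otimes> q \<otimes> word_value R (map x v)"
        using Cons vc xc q(1) by (simp add: m_assoc)
      also have "\<dots> = q \<otimes> word_value R (map x (a # v))"
        using Cons.prems[of a, symmetric] vc xc q(1) by (simp add: m_assoc)
      finally show ?case .
    qed
  qed
  ultimately show ?thesis using that[of "word_value R (map x v)" "word_value R (map x u)"] c by auto
qed

lemma finite_perms: "finite {\<pi>. \<pi> permutes {..<M::nat}}"
  by (simp add: finite_permutations)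

lemma perm_word_closed:
  assumes "x \<in> UNIV \<rightarrow> carrier R" shows "word_value R (map x w) \<in> carrier R"
  by (rule word_value_closed) (use assms in auto)

lemma perm_list:
  assumes "\<pi> permutes {..<M::nat}"
  shows "distinct (map \<pi> [0..<M])" "set (map \<pi> [0..<M]) = {..<M}"
  using assms permutes_inj[OF assms] permutes_image[OF assms]
  by (auto simp: distinct_map inj_on_def atLeast0LessThan inj_def)

lemma standard_poly_add:
  assumes x: "x \<in> UNIV \<rightarrow> carrier R" and k: "k < M" and yz: "y \<in> carrier R" "z \<in> carrier R"
  shows "standard_poly M (x(k := y \<oplus> z)) = standard_poly M (x(k := y)) \<oplus> standard_poly M (x(k := z))"
proof -
  let ?s = "\<lambda>\<pi>. if evenperm \<pi> then \<one> else \<ominus> \<one>"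
  let ?w = "\<lambda>y \<pi>. word_value R (map (x(k := y)) (map \<pi> [0..<M]))"
  have wc: "?w y \<pi> \<in> carrier R" if "y \<in> carrier R" for y \<pi>
    by (rule perm_word_closed) (use x that in auto)
  have "?s \<pi> \<otimes> ?w (y \<oplus> z) \<pi> = ?s \<pi> \<otimes> ?w y \<pi> \<oplus> ?s \<pi> \<otimes> ?w z \<pi>" if p: "\<pi> permutes {..<M}" for \<pi>
  proof -
    obtain l r where lr: "l \<in> carrier R" "r \<in> carrier R" "\<And>y. y \<in> carrier R \<Longrightarrow> ?w y \<pi> = l \<otimes> (y \<otimes> r)"
      by (rule word_value_slot[OF x perm_list(1)[OF p], of k]) (use perm_list(2)[OF p] k in auto)
    show ?thesis using lr yz by (simp add: r_distr l_distr)
  qed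
  then have "standard_poly M (x(k := y \<oplus> z))
     = (\<Oplus>\<pi>\<in>{\<pi>. \<pi> permutes {..<M}}. ?s \<pi> \<otimes> ?w y \<pi> \<oplus> ?s \<pi> \<otimes> ?w z \<pi>)"
    unfolding standard_poly_def by (intro finsum_cong') (use wc yz in auto)
  also have "\<dots> = standard_poly M (x(k := y)) \<oplus> standard_poly M (x(k := z))"
    unfolding standard_poly_def by (rule finsum_addf) (use wc yz in auto)
  finally show ?thesis .
qed

lemma standard_poly_scale:
  assumes x: "x \<in> UNIV \<rightarrow> carrier R" and k: "k < M" and y: "y \<in> carrier R" "q \<in> carrier R"
    and q: "\<And>i. i < M \<Longrightarrow> i \<noteq> k \<Longrightarrow> q \<otimes> x i = x i \<otimes> q"
  shows "standard_poly M (x(k := q \<otimes> y)) = q \<otimes> standard_poly M (x(k := y))"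
proof -
  let ?s = "\<lambda>\<pi>. if evenperm \<pi> then \<one> else \<ominus> \<one>"
  let ?w = "\<lambda>y \<pi>. word_value R (map (x(k := y)) (map \<pi> [0..<M]))"
  have wc: "?w y \<pi> \<in> carrier R" if "y \<in> carrier R" for y \<pi>
    by (rule perm_word_closed) (use x that in auto)
  have "?s \<pi> \<otimes> ?w (q \<otimes> y) \<pi> = q \<otimes> (?s \<pi> \<otimes> ?w y \<pi>)" if p: "\<pi> permutes {..<M}" for \<pi>
  proof -
    obtain l r where lr: "l \<in> carrier R" "r \<in> carrier R" "\<And>y. y \<in> carrier R \<Longrightarrow> ?w y \<pi> = l \<otimes> (y \<otimes> r)"
      "l \<otimes> q = q \<otimes> l"
      by (rule word_value_slot[OF x perm_list(1)[OF p], of k])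
        (use perm_list(2)[OF p] k q y in auto)
    have "l \<otimes> (q \<otimes> y \<otimes> r) = q \<otimes> (l \<otimes> (y \<otimes> r))"
      using lr y by (simp add: m_assoc[symmetric])
    then show ?thesis using lr(1,2) y unfolding lr(3)[OF y(1)] lr(3)[OF m_closed[OF y(2,1)]]
      by (simp add: l_minus r_minus)
  qed
  then have "standard_poly M (x(k := q \<otimes> y))
     = (\<Oplus>\<pi>\<in>{\<pi>. \<pi> permutes {..<M}}. q \<otimes> (?s \<pi> \<otimes> ?w y \<pi>))"
    unfolding standard_poly_def by (intro finsum_cong') (use wc y in auto)
  also have "\<dots> = q \<otimes> standard_poly M (x(k := y))"
    unfolding standard_poly_def by (rule finsum_rdistr[symmetric]) (use wc y finite_perms in auto)
  finally show ?thesis .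
qed

text \<open>Composition with the transposition of \<open>a\<close> and \<open>b\<close> pairs even
  with odd permutations, and paired words agree because \<open>x a = x b\<close>. Cancelling the
  pairs, instead of comparing the polynomial with its negative, is valid in characteristic 2 as
  well.\<close>

lemma standard_poly_alternating:
  assumes x: "x \<in> UNIV \<rightarrow> carrier R" and ab: "a < M" "b < M" "a \<noteq> b" "x a = x b"
  shows "standard_poly M x = \<zero>"
proof -
  let ?t = "transpose a b"
  let ?E = "{\<pi>. \<pi> permutes {..<M} \<and> evenperm \<pi>}" and ?O = "{\<pi>. \<pi> permutes {..<M} \<and> \<not> evenperm \<pi>}"
  let ?w = "\<lambda>\<pi>. word_value R (map x (map \<pi> [0..<M]))"
  let ?f = "\<lambda>\<pi>. (if evenperm \<pi> then \<one> else \<ominus> \<one>) \<otimes> ?w \<pi>"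
  have wc: "?w \<pi> \<in> carrier R" for \<pi> by (rule perm_word_closed[OF x])
  have t: "?t permutes {..<M}" using ab by (simp add: permutes_swap_id)
  have ev: "evenperm (?t \<circ> \<pi>) = (\<not> evenperm \<pi>)" if "\<pi> permutes {..<M}" for \<pi>
    using that t ab(3) by (subst evenperm_comp) (auto simp: evenperm_swap permutation_permutes)
  have O: "?O = (\<lambda>\<pi>. ?t \<circ> \<pi>) ` ?E"
  proof (intro equalityI subsetI)
    fix \<pi> assume p: "\<pi> \<in> ?O"
    have "\<pi> = ?t \<circ> (?t \<circ> \<pi>)" by (simp add: comp_assoc[symmetric])
    moreover have "?t \<circ> \<pi> \<in> ?E" using p ev permutes_compose[OF _ t] by auto
    ultimately show "\<pi> \<in> (\<lambda>\<pi>. ?t \<circ> \<pi>) ` ?E" by blast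
  qed (use ev permutes_compose[OF _ t] in auto)
  have inj: "inj_on (\<lambda>\<pi>. ?t \<circ> \<pi>) ?E"
    by (rule inj_onI) (metis comp_assoc id_comp transpose_comp_involutory)
  have wt: "?w (?t \<circ> \<pi>) = ?w \<pi>" for \<pi>
  proof -
    have "x (?t i) = x i" for i using ab(4) by (cases "i = a \<or> i = b") (auto simp: transpose_def)
    then show ?thesis by (simp add: comp_def)
  qed
  have fin: "finite ?E" "finite ?O" by (rule finite_subset[OF _ finite_perms[of M]]; auto)+
  have E: "finsum R ?f ?E = finsum R ?w ?E" by (rule finsum_cong') (use wc in auto)
  have "finsum R ?f ?O = finsum R (\<lambda>\<pi>. ?f (?t \<circ> \<pi>)) ?E"
    unfolding O by (rule finsum_reindex) (use wc inj in auto)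
  also have "\<dots> = finsum R (\<lambda>\<pi>. \<ominus> ?w \<pi>) ?E"
  proof (rule finsum_cong')
    fix \<pi> assume p: "\<pi> \<in> ?E"
    then have "\<not> evenperm (?t \<circ> \<pi>)" using ev by blast
    then show "?f (?t \<circ> \<pi>) = \<ominus> ?w \<pi>" unfolding wt using wc by (simp add: l_minus del: map_map)
  qed (use wc in auto)
  finally have O': "finsum R ?f ?O = finsum R (\<lambda>\<pi>. \<ominus> ?w \<pi>) ?E" .
  have "standard_poly M x = finsum R ?f (?E \<union> ?O)"
    unfolding standard_poly_def by (rule arg_cong[of _ _ "finsum R ?f"]) auto
  also have "\<dots> = finsum R ?f ?E \<oplus> finsum R ?f ?O"
    by (rule finsum_Un_disjoint) (use fin wc in auto)
  also have "\<dots> = finsum R (\<lambda>\<pi>. ?w \<pi> \<oplus> \<ominus> ?w \<pi>) ?E"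
    unfolding E O' by (rule finsum_addf[symmetric]) (use wc in auto)
  also have "\<dots> = (\<Oplus>\<pi>\<in>?E. \<zero>)" by (rule finsum_cong') (use wc in \<open>auto simp: r_neg\<close>)
  finally show ?thesis by (simp add: finsum_zero)
qed

text \<open>Linearity over coefficients that centralize \<open>X\<close> reduces every entry to an
  element of \<open>B\<close>; with more variables than elements of \<open>B\<close>, two entries
  coincide.\<close>

lemma standard_poly_vanishes:
  assumes B: "finite B" "B \<subseteq> X" "card B < M" and X: "X \<subseteq> carrier R"
    and Q: "Q \<subseteq> centralizer X"
    and rep: "\<And>x. x \<in> X \<Longrightarrow> \<exists>q\<in>B \<rightarrow> Q. x = (\<Oplus>b\<in>B. q b \<otimes> b)"
    and x: "x \<in> UNIV \<rightarrow> X"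
  shows "standard_poly M x = \<zero>"
proof -
  \<comment> \<open>Entries from \<open>k\<close> on already lie in \<open>B\<close>, the first
    \<open>k\<close> are arbitrary. The step expands the last arbitrary entry, and
    \<open>k = M\<close> is the claim.\<close>
  have "standard_poly M x = \<zero>" if "k \<le> M" "x \<in> UNIV \<rightarrow> X" "\<And>i. k \<le> i \<Longrightarrow> i < M \<Longrightarrow> x i \<in> B" for k x
    using that
  proof (induction k arbitrary: x)
    case 0
    have "\<not> inj_on x {..<M}"
    proof
      assume "inj_on x {..<M}"
      then have "card (x ` {..<M}) = M" by (simp add: card_image)
      moreover have "card (x ` {..<M}) \<le> card B" by (rule card_mono) (use B 0 in auto)
      ultimately show False using B by simp
    qed
    then obtain a b where "a < M" "b < M" "a \<noteq> b" "x a = x b" by (auto simp: inj_on_def)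
    then show ?case by (intro standard_poly_alternating[of x a M b]) (use 0 X in auto)
  next
    case (Suc k)
    have xc: "x \<in> UNIV \<rightarrow> carrier R" using Suc X by auto
    have "x k \<in> X" using Suc.prems by auto
    then obtain q where q: "q \<in> B \<rightarrow> Q" "x k = (\<Oplus>b\<in>B. q b \<otimes> b)" using rep by blast
    have qc: "q b \<in> carrier R" if "b \<in> B" for b using q Q that by (auto simp: centralizer_def)
    have bc: "b \<in> carrier R" if "b \<in> B" for b using B X that by auto
    \<comment> \<open>Scaling the slot by \<open>q = \<zero>\<close> settles the empty sum, the base
      of the induction over subsets of \<open>B\<close> below.\<close>
    have zero: "standard_poly M (x(k := \<zero>)) = \<zero>"
    proof -
      have "word_value R (map (x(k := \<zero>)) w) \<in> carrier R" for w
        by (rule perm_word_closed) (use xc in auto)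
      then have "standard_poly M (x(k := \<zero>)) \<in> carrier R" unfolding standard_poly_def
        by (intro finsum_closed) (auto simp del: map_map)
      moreover have "standard_poly M (x(k := \<zero> \<otimes> \<zero>)) = \<zero> \<otimes> standard_poly M (x(k := \<zero>))"
        by (rule standard_poly_scale[OF xc]) (use Suc.prems xc in \<open>auto simp: Pi_iff\<close>)
      ultimately show ?thesis by simp
    qed
    have "standard_poly M (x(k := \<Oplus>b\<in>A. q b \<otimes> b)) = \<zero>" if "A \<subseteq> B" for A
      using finite_subset[OF that B(1)] that
    proof (induction A)
      case empty
      show ?case by (simp only: finsum_empty zero)
    next
      case (insert b A)
      have bA: "b \<in> B" "A \<subseteq> B" using insert.prems by auto
      have "(\<Oplus>b\<in>insert b A. q b \<otimes> b) = q b \<otimes> b \<oplus> (\<Oplus>b\<in>A. q b \<otimes> b)"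
        by (rule finsum_insert) (use insert.hyps bA qc bc in auto)
      then have "standard_poly M (x(k := \<Oplus>b\<in>insert b A. q b \<otimes> b))
         = standard_poly M (x(k := q b \<otimes> b)) \<oplus> standard_poly M (x(k := \<Oplus>b\<in>A. q b \<otimes> b))"
        by (simp only:) (rule standard_poly_add[OF xc], use insert.hyps bA Suc.prems(1) qc bc in \<open>auto intro!: finsum_closed\<close>)
      also have "standard_poly M (x(k := q b \<otimes> b)) = q b \<otimes> standard_poly M (x(k := b))"
        by (rule standard_poly_scale[OF xc])
          (use \<open>b \<in> B\<close> Suc.prems(1,2) qc bc q Q in \<open>auto simp: centralizer_def Pi_iff subset_iff\<close>)
      also have "standard_poly M (x(k := b)) = \<zero>"
      proof (rule Suc.IH)
        show "(x(k := b)) i \<in> B" if "k \<le> i" "i < M" for i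
          using that Suc.prems(3)[of i] \<open>b \<in> B\<close> by (cases "i = k") auto
      qed (use \<open>b \<in> B\<close> Suc.prems(1,2) B(2) in \<open>auto simp: Pi_iff subset_iff\<close>)
      also have "standard_poly M (x(k := \<Oplus>b\<in>A. q b \<otimes> b)) = \<zero>" using insert.IH bA by blast
      finally show ?case using qc \<open>b \<in> B\<close> by simp
    qed
    from this[OF order_refl] show ?case unfolding q(2)[symmetric] by simp
  qed
  from this[of M x] x show ?thesis by auto
qed

text \<open>Different permutations give different words, so no coefficients are collected: each of
  these words carries \<open>\<one>\<close> or \<open>\<ominus> \<one>\<close>, both nonzero in
  every characteristic.\<close>

lemma standard_poly_is_nc_eval:
  assumes "\<one> \<noteq> \<zero>" "\<zero> \<in> F" "\<one> \<in> F" "\<ominus> \<one> \<in> F" "F \<subseteq> carrier R"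
  obtains f where "nc_polynomial R F f" "\<exists>w. f w \<noteq> \<zero>"
    "\<And>a. a \<in> UNIV \<rightarrow> carrier R \<Longrightarrow> nc_eval R f a = standard_poly M a"
proof -
  let ?P = "{\<pi>. \<pi> permutes {..<M}}" and ?l = "\<lambda>\<pi>. map \<pi> [0..<M]"
  let ?s = "\<lambda>\<pi>. if evenperm \<pi> then \<one> else \<ominus> \<one>"
  define f where "f = (\<lambda>w. if w \<in> ?l ` ?P then ?s (inv_into ?P ?l w) else \<zero>)"
  have inj: "inj_on ?l ?P"
  proof (rule inj_onI)
    fix \<pi> \<rho> assume a: "\<pi> \<in> ?P" "\<rho> \<in> ?P" "?l \<pi> = ?l \<rho>"
    have "\<pi> i = \<rho> i" for i
      using a by (cases "i < M") (auto simp: permutes_def)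
    then show "\<pi> = \<rho>" by auto
  qed
  have m1: "\<ominus> \<one> \<noteq> \<zero>" using assms(1) by (metis add.inv_eq_1_iff one_closed)
  have fl: "f (?l \<pi>) = ?s \<pi>" if "\<pi> \<in> ?P" for \<pi>
    using imageI[OF that, of ?l] by (simp only: f_def inv_into_f_f[OF inj that] if_True)
  have supp: "{w. f w \<noteq> \<zero>} = ?l ` ?P"
    using assms(1) m1 by (auto simp: f_def)
  have "nc_polynomial R F f"
    unfolding nc_polynomial_def supp using assms finite_perms by (auto simp: f_def)
  moreover have "\<exists>w. f w \<noteq> \<zero>"
  proof -
    have "id \<in> ?P" by (simp add: permutes_id)
    then have "f (?l id) \<noteq> \<zero>" using supp by blast
    then show ?thesis by blast
  qed
  moreover have "nc_eval R f a = standard_poly M a" if a: "a \<in> UNIV \<rightarrow> carrier R" for a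
  proof -
    have "nc_eval R f a = (\<Oplus>\<pi>\<in>?P. f (?l \<pi>) \<otimes> word_value R (map a (?l \<pi>)))"
      unfolding nc_eval_def supp
      by (rule finsum_reindex[OF _ inj]) (use fl perm_word_closed[OF a] in \<open>auto simp del: map_map\<close>)
    also have "\<dots> = standard_poly M a" unfolding standard_poly_def
      by (rule finsum_cong') (use fl perm_word_closed[OF a] in \<open>auto simp del: map_map\<close>)
    finally show ?thesis .
  qed
  ultimately show ?thesis using that by blast
qed

lemma nc_eval_consistent:
  assumes E: "subring E R" "F \<subseteq> E" and f: "nc_polynomial R F f" and a: "range a \<subseteq> E"
  shows "nc_eval (R\<lparr>carrier := E\<rparr>) f a = nc_eval R f a"
proof -
  have w: "word_value (R\<lparr>carrier := E\<rparr>) xs = word_value R xs" for xs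
    by (simp add: word_value_def)
  have wc: "word_value R (map a w) \<in> E" for w
    using a by (induction w) (auto intro: subringE[OF E(1)])
  have "f w \<in> E" for w using f E(2) by (auto simp: nc_polynomial_def)
  then show ?thesis unfolding nc_eval_def w
    by (simp, intro finsum_consistent[OF E(1)]) (use wc subringE(6)[OF E(1)] in auto)
qed

text \<open>Identities pass to subrings, so finiteness is only asked of a set \<open>X\<close>
  around \<open>E\<close>; generators and coefficients may lie outside \<open>E\<close>. The
  standard polynomial in one variable more than there are generators vanishes.\<close>

lemma PI_algebra_of_finite_over_centre:
  assumes E: "subring E R" "F \<subseteq> E" "E \<subseteq> X" and F: "\<one> \<noteq> \<zero>" "\<zero> \<in> F" "\<one> \<in> F" "\<ominus> \<one> \<in> F"
    and B: "finite B" "B \<subseteq> X" and X: "X \<subseteq> carrier R" and Q: "Q \<subseteq> centralizer X"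
    and rep: "\<And>x. x \<in> X \<Longrightarrow> \<exists>q\<in>B \<rightarrow> Q. x = (\<Oplus>b\<in>B. q b \<otimes> b)"
  shows "PI_algebra (R\<lparr>carrier := E\<rparr>) F"
proof -
  obtain f where f: "nc_polynomial R F f" "\<exists>w. f w \<noteq> \<zero>"
    "\<And>a. a \<in> UNIV \<rightarrow> carrier R \<Longrightarrow> nc_eval R f a = standard_poly (Suc (card B)) a"
    using standard_poly_is_nc_eval[OF F] E X by blast
  have "nc_eval (R\<lparr>carrier := E\<rparr>) f a = \<zero>" if a: "range a \<subseteq> E" for a
  proof -
    have "a \<in> UNIV \<rightarrow> X" using a E by auto
    moreover then have "a \<in> UNIV \<rightarrow> carrier R" using X by auto
    ultimately show ?thesis
      using nc_eval_consistent[OF E(1,2) f(1) a] f(3)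
        standard_poly_vanishes[OF B lessI X Q rep] by simp
  qed
  then show ?thesis using f(1,2) unfolding PI_algebra_def nc_polynomial_def by auto
qed

end

section \<open>Division rings\<close>

context division_ring
begin

lemma Units_iff: "x \<in> Units R \<longleftrightarrow> x \<in> carrier R \<and> x \<noteq> \<zero>"
  using division_ring_Units by auto

lemma one_neq_zero [simp]: "\<one> \<noteq> \<zero>" "\<zero> \<noteq> \<one>"
  using Units_iff[of \<one>] Units_one_closed by auto

lemma dinv_closed [simp]: "x \<in> carrier R \<Longrightarrow> x \<noteq> \<zero> \<Longrightarrow> inv x \<in> carrier R"
  and dinv_l [simp]: "x \<in> carrier R \<Longrightarrow> x \<noteq> \<zero> \<Longrightarrow> inv x \<otimes> x = \<one>"
  and dinv_r [simp]: "x \<in> carrier R \<Longrightarrow> x \<noteq> \<zero> \<Longrightarrow> x \<otimes> inv x = \<one>"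
  using Units_iff by auto

lemma no_zero_divisors: "x \<in> carrier R \<Longrightarrow> y \<in> carrier R \<Longrightarrow> x \<otimes> y = \<zero> \<Longrightarrow> x = \<zero> \<or> y = \<zero>"
  by (metis dinv_closed dinv_l l_one m_assoc r_null)

lemma dinv_mult:
  assumes "x \<in> carrier R" "y \<in> carrier R" "x \<noteq> \<zero>" "y \<noteq> \<zero>"
  shows "inv (x \<otimes> y) = inv y \<otimes> inv x"
proof -
  have "(x \<otimes> y) \<otimes> (inv y \<otimes> inv x) = x \<otimes> (y \<otimes> inv y) \<otimes> inv x"
    using assms by (simp add: m_assoc del: dinv_r)
  moreover have "x \<otimes> y \<noteq> \<zero>" using assms no_zero_divisors by blast
  ultimately have "(x \<otimes> y) \<otimes> (inv y \<otimes> inv x) = (x \<otimes> y) \<otimes> inv (x \<otimes> y)" using assms by simp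
  then show ?thesis using assms \<open>x \<otimes> y \<noteq> \<zero>\<close> Units_l_cancel[of "x \<otimes> y" "inv y \<otimes> inv x" "inv (x \<otimes> y)"]
    by (simp add: Units_iff)
qed

lemma dinv_commute:
  assumes "x \<in> carrier R" "y \<in> carrier R" "x \<noteq> \<zero>" "x \<otimes> y = y \<otimes> x"
  shows "inv x \<otimes> y = y \<otimes> inv x"
proof -
  have "inv x \<otimes> y = inv x \<otimes> (y \<otimes> x) \<otimes> inv x" using assms by (simp add: m_assoc)
  also have "\<dots> = inv x \<otimes> (x \<otimes> y) \<otimes> inv x" using assms by simp
  also have "\<dots> = (inv x \<otimes> x) \<otimes> y \<otimes> inv x" using assms by (simp add: m_assoc del: dinv_l)
  finally show ?thesis using assms by simp
qed

lemma add_minus_add: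
  assumes "a \<in> carrier R" "b \<in> carrier R" "c \<in> carrier R"
  shows "(c \<oplus> a) \<ominus> (c \<oplus> b) = a \<ominus> b"
proof -
  have "(c \<oplus> a) \<ominus> (c \<oplus> b) = c \<oplus> (\<ominus> c \<oplus> (a \<oplus> \<ominus> b))"
    using assms by (simp add: a_minus_def minus_add a_ac)
  then show ?thesis using assms by (simp add: a_minus_def r_neg2)
qed

lemma subdomain_of_commutative_subring:
  assumes "subring C R" "\<And>x y. x \<in> C \<Longrightarrow> y \<in> C \<Longrightarrow> x \<otimes> y = y \<otimes> x"
  shows "domain (R\<lparr>carrier := C\<rparr>)"
proof -
  interpret C: ring "R\<lparr>carrier := C\<rparr>" using subring_is_ring[OF assms(1)] .
  show ?thesis
    by unfold_locales
      (use assms(2) subringE(1)[OF assms(1)] no_zero_divisors in \<open>auto simp: subset_iff\<close>)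
qed

end

section \<open>Twisted group rings inside a division ring\<close>

text \<open>\<open>P\<close> is the copy of the field and \<open>u g\<close> that of a group
  element. The twist is internal: the automorphism belonging to \<open>g\<close> is conjugation by
  \<open>u g\<close>, so no map into an automorphism group has to be carried along, and
  \<open>u\<close> is a true homomorphism because no cocycle is involved.\<close>

locale twisted_group_in_division_ring = division_ring D + G: comm_group G
  for D :: "('d, 'k) ring_scheme" (structure) and G :: "('g, 'h) monoid_scheme" +
  fixes P :: "'d set" and u :: "'g \<Rightarrow> 'd"
  assumes P: "subfield P D"
    and u_closed: "g \<in> carrier G \<Longrightarrow> u g \<in> carrier D"
    and u_mult: "g \<in> carrier G \<Longrightarrow> h \<in> carrier G \<Longrightarrow> u (g \<otimes>\<^bsub>G\<^esub> h) = u g \<otimes> u h"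
    and u_one: "u \<one>\<^bsub>G\<^esub> = \<one>"
    and conj_closed: "g \<in> carrier G \<Longrightarrow> x \<in> P \<Longrightarrow> u g \<otimes> x \<otimes> u (inv\<^bsub>G\<^esub> g) \<in> P"
    and faithful: "g \<in> carrier G \<Longrightarrow> g \<noteq> \<one>\<^bsub>G\<^esub> \<Longrightarrow> \<exists>x\<in>P. u g \<otimes> x \<noteq> x \<otimes> u g"
    and u_independent: "finite A \<Longrightarrow> A \<subseteq> carrier G \<Longrightarrow> c \<in> A \<rightarrow> P \<Longrightarrow>
      (\<Oplus>g\<in>A. c g \<otimes> u g) = \<zero> \<Longrightarrow> g \<in> A \<Longrightarrow> c g = \<zero>"
    and right_fraction: "x \<in> carrier D \<Longrightarrow>
      \<exists>a\<in>adspan (product_set P u (carrier G)). \<exists>s\<in>adspan (product_set P u (carrier G)) - {\<zero>}.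
        x = a \<otimes> inv s"
begin

definition tw :: "'d set \<Rightarrow> 'g set \<Rightarrow> 'd set"
  where "tw X A = adspan (product_set X u A)"

definition act :: "'g \<Rightarrow> 'd \<Rightarrow> 'd"
  where "act g x = u g \<otimes> x \<otimes> u (inv\<^bsub>G\<^esub> g)"

lemma P_ring: "subring P D"
  using subfieldE(1)[OF P] .

lemma P_simps [simp, intro]:
  "x \<in> P \<Longrightarrow> x \<in> carrier D" "\<zero> \<in> P" "\<one> \<in> P" "x \<in> P \<Longrightarrow> y \<in> P \<Longrightarrow> x \<oplus> y \<in> P"
  "x \<in> P \<Longrightarrow> y \<in> P \<Longrightarrow> x \<otimes> y \<in> P" "x \<in> P \<Longrightarrow> \<ominus> x \<in> P"
  using subringE[OF P_ring] by auto

lemma P_comm: "x \<in> P \<Longrightarrow> y \<in> P \<Longrightarrow> x \<otimes> y = y \<otimes> x"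
  using subfieldE(4)[OF P] by auto

lemma P_inv [simp, intro]:
  assumes "x \<in> P" "x \<noteq> \<zero>" shows "inv x \<in> P"
  using subfield_m_inv(1)[OF P, of x] assms by auto

lemma P_subgroup: "subgroup P (add_monoid D)"
  by (rule add_subgroupI) auto

lemma u_closed' [simp, intro]: "g \<in> carrier G \<Longrightarrow> u g \<in> carrier D"
  by (rule u_closed)

lemma u_inv [simp]:
  assumes "g \<in> carrier G"
  shows "u g \<otimes> u (inv\<^bsub>G\<^esub> g) = \<one>" "u (inv\<^bsub>G\<^esub> g) \<otimes> u g = \<one>"
  using u_mult[of g "inv\<^bsub>G\<^esub> g"] u_mult[of "inv\<^bsub>G\<^esub> g" g] assms u_one by auto

lemma act_closed [simp, intro]: "g \<in> carrier G \<Longrightarrow> x \<in> P \<Longrightarrow> act g x \<in> P"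
  unfolding act_def by (rule conj_closed)

lemma u_act:
  assumes "g \<in> carrier G" "x \<in> carrier D" shows "u g \<otimes> x = act g x \<otimes> u g"
  using assms by (simp add: act_def m_assoc)

lemma act_eqI:
  assumes "g \<in> carrier G" "x \<in> carrier D" "y \<in> carrier D" "u g \<otimes> x = y \<otimes> u g" shows "act g x = y"
  using assms by (simp add: act_def m_assoc)

lemma act_add:
  assumes "g \<in> carrier G" "x \<in> carrier D" "y \<in> carrier D"
  shows "act g (x \<oplus> y) = act g x \<oplus> act g y"
  using assms by (simp add: act_def l_distr r_distr)

lemma act_mult:
  assumes "g \<in> carrier G" "x \<in> carrier D" "y \<in> carrier D"
  shows "act g (x \<otimes> y) = act g x \<otimes> act g y"
proof -
  have "act g x \<otimes> act g y = u g \<otimes> x \<otimes> (u (inv\<^bsub>G\<^esub> g) \<otimes> u g) \<otimes> y \<otimes> u (inv\<^bsub>G\<^esub> g)"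
    unfolding act_def using assms by (simp add: m_assoc del: u_inv)
  then show ?thesis using assms by (simp add: act_def m_assoc)
qed

lemma act_one [simp]: "g \<in> carrier G \<Longrightarrow> act g \<one> = \<one>"
  by (simp add: act_def)

lemma act_comp:
  assumes "g \<in> carrier G" "h \<in> carrier G" "x \<in> carrier D"
  shows "act (g \<otimes>\<^bsub>G\<^esub> h) x = act g (act h x)"
  using assms G.inv_mult_group[OF assms(1,2)] by (simp add: act_def u_mult m_assoc)

lemma act_fixed_iff:
  assumes "g \<in> carrier G" "x \<in> carrier D" shows "act g x = x \<longleftrightarrow> u g \<otimes> x = x \<otimes> u g"
  using act_eqI[OF assms assms(2)] u_act[OF assms] by auto

lemma tw_base: "X \<subseteq> P \<Longrightarrow> A \<subseteq> carrier G \<Longrightarrow> product_set X u A \<subseteq> carrier D"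
  by (rule product_set_closed) auto

lemma tw_closed: "X \<subseteq> P \<Longrightarrow> A \<subseteq> carrier G \<Longrightarrow> tw X A \<subseteq> carrier D"
  unfolding tw_def by (rule adspan_closed[OF tw_base])

lemma tw_subgroup: "X \<subseteq> P \<Longrightarrow> A \<subseteq> carrier G \<Longrightarrow> subgroup (tw X A) (add_monoid D)"
  unfolding tw_def by (rule adspan_subgroup[OF tw_base])

lemma tw_add: "x \<in> tw X A \<Longrightarrow> y \<in> tw X A \<Longrightarrow> x \<oplus> y \<in> tw X A"
  unfolding tw_def by (rule adspan_add)

lemma tw_neg: "X \<subseteq> P \<Longrightarrow> A \<subseteq> carrier G \<Longrightarrow> x \<in> tw X A \<Longrightarrow> \<ominus> x \<in> tw X A"
  unfolding tw_def by (rule adspan_neg[OF tw_base])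

lemma tw_minus: "X \<subseteq> P \<Longrightarrow> A \<subseteq> carrier G \<Longrightarrow> x \<in> tw X A \<Longrightarrow> y \<in> tw X A \<Longrightarrow> x \<ominus> y \<in> tw X A"
  unfolding tw_def by (rule adspan_minus[OF tw_base])

lemma tw_mono: "X \<subseteq> Y \<Longrightarrow> A \<subseteq> B \<Longrightarrow> tw X A \<subseteq> tw Y B"
  unfolding tw_def by (intro adspan_mono product_set_mono)

lemma tw_incl: "x \<in> X \<Longrightarrow> g \<in> A \<Longrightarrow> x \<otimes> u g \<in> tw X A"
  unfolding tw_def by (intro adspan_incl product_setI)

lemma tw_scalar: "x \<in> X \<Longrightarrow> X \<subseteq> P \<Longrightarrow> \<one>\<^bsub>G\<^esub> \<in> A \<Longrightarrow> x \<in> tw X A"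
  using tw_incl[of x X "\<one>\<^bsub>G\<^esub>" A] u_one by auto

text \<open>A product of \<open>x \<otimes> u g\<close> and \<open>y \<otimes> u h\<close> has
  coefficient \<open>x \<otimes> act g y\<close> at \<open>g h\<close>. Conditions on coefficients
  and on supports are therefore separate, and one statement covers the whole ring, scaling by
  \<open>P\<close>, the layers and the boxes.\<close>

lemma tw_mult:
  assumes "X \<subseteq> P" "Y \<subseteq> P" "Z \<subseteq> P" "A \<subseteq> carrier G" "B \<subseteq> carrier G" "C \<subseteq> carrier G"
    and Z: "\<And>x g y. x \<in> X \<Longrightarrow> g \<in> A \<Longrightarrow> y \<in> Y \<Longrightarrow> x \<otimes> act g y \<in> Z"
    and C: "\<And>g h. g \<in> A \<Longrightarrow> h \<in> B \<Longrightarrow> g \<otimes>\<^bsub>G\<^esub> h \<in> C"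
    and "a \<in> tw X A" "b \<in> tw Y B"
  shows "a \<otimes> b \<in> tw Z C"
proof -
  have "(x \<otimes> u g) \<otimes> (y \<otimes> u h) \<in> tw Z C" if h: "x \<in> X" "g \<in> A" "y \<in> Y" "h \<in> B" for x g y h
  proof -
    have c: "x \<in> carrier D" "y \<in> P" "y \<in> carrier D" "g \<in> carrier G" "h \<in> carrier G" using h assms by auto
    have "(x \<otimes> u g) \<otimes> (y \<otimes> u h) = x \<otimes> (u g \<otimes> y) \<otimes> u h" using c by (simp add: m_assoc)
    also have "\<dots> = x \<otimes> act g y \<otimes> u (g \<otimes>\<^bsub>G\<^esub> h)"
      using c act_closed[of g y] by (simp add: u_act[of g y] u_mult m_assoc)
    finally show ?thesis using tw_incl[OF Z[OF h(1-3)] C[OF h(2,4)]] by simp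
  qed
  then have "v \<otimes> w \<in> tw Z C" if "v \<in> product_set X u A" "w \<in> product_set Y u B" for v w
    using that unfolding product_set_def by auto
  then show ?thesis unfolding tw_def
    by (rule adspan_mult[OF tw_base[OF assms(1,4)] tw_base[OF assms(2,5)] tw_base[OF assms(3,6)] _
          assms(9,10)[unfolded tw_def]])
qed

abbreviation (input) "W \<equiv> tw P (carrier G)"

lemma W_mult: "a \<in> W \<Longrightarrow> b \<in> W \<Longrightarrow> a \<otimes> b \<in> W"
  by (rule tw_mult[of P P P]) auto

lemma W_closed: "x \<in> W \<Longrightarrow> x \<in> carrier D"
  using tw_closed by blast

lemma P_in_W: "x \<in> P \<Longrightarrow> x \<in> W"
  by (rule tw_scalar) auto

lemma u_in_W: "g \<in> carrier G \<Longrightarrow> u g \<in> W"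
  using tw_incl[of \<one> P g "carrier G"] by simp

lemma tw_scale_left: "y \<in> P \<Longrightarrow> A \<subseteq> carrier G \<Longrightarrow> x \<in> tw P A \<Longrightarrow> y \<otimes> x \<in> tw P A"
  by (rule tw_mult[of P P P "{\<one>\<^bsub>G\<^esub>}" A A]) (auto intro: tw_scalar)

lemma tw_scale_right: "y \<in> P \<Longrightarrow> A \<subseteq> carrier G \<Longrightarrow> x \<in> tw P A \<Longrightarrow> x \<otimes> y \<in> tw P A"
  by (rule tw_mult[of P P P A "{\<one>\<^bsub>G\<^esub>}" A]) (auto intro: tw_scalar)

lemma tw_repr:
  assumes "x \<in> tw P A" "A \<subseteq> carrier G"
  obtains B c where "finite B" "B \<subseteq> A" "c \<in> UNIV \<rightarrow> P" "x = (\<Oplus>g\<in>B. c g \<otimes> u g)"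
  by (rule adspan_product_set_repr[OF P_subgroup _ assms(1)[unfolded tw_def]]) (use assms(2) that in auto)

text \<open>The products \<open>y \<otimes> x\<close> and \<open>x \<otimes> y\<close> have the
  coefficients \<open>c g \<otimes> y\<close> and \<open>c g \<otimes> act g y\<close> at
  \<open>u g\<close>. By independence they agree, and a \<open>y\<close> moved by \<open>g\<close>
  forces \<open>c g = \<zero>\<close> off the identity.\<close>

lemma tw_centralizing_P:
  assumes A: "A \<subseteq> carrier G" and x: "x \<in> tw P A" and comm: "\<And>y. y \<in> P \<Longrightarrow> y \<otimes> x = x \<otimes> y"
  shows "x \<in> P" "\<one>\<^bsub>G\<^esub> \<notin> A \<Longrightarrow> x = \<zero>"
proof -
  obtain B c where B: "finite B" "B \<subseteq> A" "c \<in> UNIV \<rightarrow> P" "x = (\<Oplus>g\<in>B. c g \<otimes> u g)"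
    using tw_repr[OF x A] .
  have cP: "c g \<in> P" for g using B(3) by auto
  have ug: "u g \<in> carrier D" "g \<in> carrier G" if "g \<in> B" for g using that A B(2) by auto
  have c0: "c g = \<zero>" if g: "g \<in> B" "g \<noteq> \<one>\<^bsub>G\<^esub>" for g
  proof -
    obtain y where y: "y \<in> P" "u g \<otimes> y \<noteq> y \<otimes> u g" using faithful ug g by blast
    have "x \<in> carrier D" using tw_closed[OF order_refl A] x by auto
    then have "\<zero> = y \<otimes> x \<ominus> x \<otimes> y" using comm[OF y(1)] y(1) by (simp add: a_minus_def r_neg)
    also have "y \<otimes> x = (\<Oplus>g\<in>B. y \<otimes> (c g \<otimes> u g))" unfolding B(4)
      by (rule finsum_rdistr) (use B y cP ug in auto)
    also have "x \<otimes> y = (\<Oplus>g\<in>B. c g \<otimes> u g \<otimes> y)" unfolding B(4)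
      by (rule finsum_ldistr) (use B y cP ug in auto)
    also have "(\<Oplus>g\<in>B. y \<otimes> (c g \<otimes> u g)) \<ominus> (\<Oplus>g\<in>B. c g \<otimes> u g \<otimes> y)
        = (\<Oplus>g\<in>B. y \<otimes> (c g \<otimes> u g)) \<oplus> (\<Oplus>g\<in>B. \<ominus> \<one> \<otimes> (c g \<otimes> u g \<otimes> y))"
      by (subst finsum_rdistr[symmetric])
        (use B y cP ug in \<open>auto simp: a_minus_def l_minus intro!: finsum_closed\<close>)
    also have "\<dots> = (\<Oplus>g\<in>B. y \<otimes> (c g \<otimes> u g) \<oplus> \<ominus> \<one> \<otimes> (c g \<otimes> u g \<otimes> y))"
      by (rule finsum_addf[symmetric]) (use B y cP ug in auto)
    also have "\<dots> = (\<Oplus>g\<in>B. (c g \<otimes> (y \<ominus> act g y)) \<otimes> u g)"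
    proof (rule finsum_cong')
      fix g assume g: "g \<in> B"
      have a: "act g y \<in> P" "act g y \<in> carrier D" using ug[OF g] y by auto
      have "y \<otimes> (c g \<otimes> u g) = c g \<otimes> y \<otimes> u g"
        using ug[OF g] cP[of g] y by (simp add: m_assoc[symmetric] P_comm)
      moreover have "c g \<otimes> u g \<otimes> y = c g \<otimes> act g y \<otimes> u g"
        using ug[OF g] cP[of g] y a by (simp add: m_assoc u_act)
      ultimately show "y \<otimes> (c g \<otimes> u g) \<oplus> \<ominus> \<one> \<otimes> (c g \<otimes> u g \<otimes> y) = c g \<otimes> (y \<ominus> act g y) \<otimes> u g"
        using ug[OF g] P_simps(1)[OF cP[of g]] y a
        by (simp add: a_minus_def r_distr l_distr l_minus r_minus)
    qed (use ug cP y act_closed in \<open>auto simp: a_minus_def\<close>)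
    finally have "c g \<otimes> (y \<ominus> act g y) = \<zero>"
      using u_independent[of B "\<lambda>g. c g \<otimes> (y \<ominus> act g y)" g] B A g cP y ug(2)
      by (auto simp: a_minus_def Pi_iff)
    moreover have "y \<ominus> act g y \<noteq> \<zero>"
      using y ug[OF g(1)] act_fixed_iff[of g y] by (auto simp: r_right_minus_eq)
    ultimately show ?thesis using no_zero_divisors[of "c g" "y \<ominus> act g y"] cP y ug[OF g(1)] by auto
  qed
  have "x = (\<Oplus>g\<in>B \<inter> {\<one>\<^bsub>G\<^esub>}. c g \<otimes> u g)" unfolding B(4)
    by (rule finsum_split_zero) (use B(1) cP ug c0 in auto)
  also have "\<dots> = (if \<one>\<^bsub>G\<^esub> \<in> B then c \<one>\<^bsub>G\<^esub> else \<zero>)"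
    using cP[of "\<one>\<^bsub>G\<^esub>"] u_one by (auto simp: finsum_empty)
  finally show "x \<in> P" "\<one>\<^bsub>G\<^esub> \<notin> A \<Longrightarrow> x = \<zero>" using cP B(2) by auto
qed

text \<open>A minimal denominator \<open>s\<close> of \<open>x\<close>, normalised to have coefficient 1 at the identity, must
  centralize \<open>P\<close>: otherwise a commutator of \<open>s\<close> with an element of \<open>P\<close> would be a shorter one.\<close>

theorem centralizer_of_P:
  assumes x: "x \<in> carrier D" and comm: "\<And>y. y \<in> P \<Longrightarrow> y \<otimes> x = x \<otimes> y"
  shows "x \<in> P"
proof -
  \<comment> \<open>\<open>Q A\<close> says that \<open>x\<close> has a denominator supported in
    \<open>A\<close>; the minimum is taken over the sizes of such sets, which may exceed the true
    support.\<close>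
  define Q where "Q = (\<lambda>A. finite A \<and> A \<subseteq> carrier G \<and> (\<exists>s\<in>tw P A. s \<noteq> \<zero> \<and> x \<otimes> s \<in> W))"
  obtain a s where as: "a \<in> W" "s \<in> W" "s \<noteq> \<zero>" "x = a \<otimes> inv s"
    using right_fraction[OF x] unfolding tw_def by auto
  have xs: "x \<otimes> s = a" using as W_closed by (simp add: m_assoc)
  obtain B c where B: "finite B" "B \<subseteq> carrier G" "c \<in> UNIV \<rightarrow> P" "s = (\<Oplus>g\<in>B. c g \<otimes> u g)"
    using tw_repr[OF as(2)] by blast
  have "s \<in> tw P B" unfolding B(4)
    by (rule finsum_in_add_subgroup[OF tw_subgroup]) (use B in \<open>auto intro: tw_incl\<close>)
  then have "Q B" using B as xs by (auto simp: Q_def)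
  then obtain A where A: "Q A" "\<And>A'. Q A' \<Longrightarrow> card A \<le> card A'"
    using ex_has_least_nat[of Q B card] by blast
  then obtain s where s: "finite A" "A \<subseteq> carrier G" "s \<in> tw P A" "s \<noteq> \<zero>" "x \<otimes> s \<in> W"
    by (auto simp: Q_def)
  obtain c where c: "c \<in> UNIV \<rightarrow> P" "s = (\<Oplus>g\<in>A. c g \<otimes> u g)"
    using adspan_product_set_finite_repr[OF P_subgroup _ s(1) s(3)[unfolded tw_def]] s(2) by blast
  have cP: "c g \<in> P" for g using c(1) by auto
  have ug: "u g \<in> carrier D" "g \<in> carrier G" if "g \<in> A" for g using that s(2) by auto
  have "\<exists>k\<in>A. c k \<noteq> \<zero>"
  proof (rule ccontr)
    assume "\<not> ?thesis"
    then have "s = (\<Oplus>g\<in>A. \<zero>)" unfolding c(2) by (intro finsum_cong') (use ug in auto)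
    then show False using s(4) by (simp add: finsum_zero)
  qed
  then obtain k where k: "k \<in> A" "c k \<noteq> \<zero>" by auto
  have kG: "k \<in> carrier G" using k s(2) by auto
  \<comment> \<open>Left multiplication by \<open>inv (c k)\<close> keeps
    \<open>x \<otimes> s1\<close> in \<open>W\<close> because \<open>x\<close> commutes with
    \<open>P\<close>; right multiplication by the inverse of \<open>u k\<close> moves the term of
    \<open>k\<close> to the identity, where it becomes \<open>\<one>\<close>. The rest of
    \<open>s1\<close> is \<open>r\<close>.\<close>
  define s1 where "s1 = inv (c k) \<otimes> s \<otimes> u (inv\<^bsub>G\<^esub> k)"
  define r where "r = inv (c k) \<otimes> (\<Oplus>g\<in>A - {k}. c g \<otimes> u g) \<otimes> u (inv\<^bsub>G\<^esub> k)"
  define A' where "A' = (\<lambda>g. g \<otimes>\<^bsub>G\<^esub> inv\<^bsub>G\<^esub> k) ` (A - {k})"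
  have A'G: "A' \<subseteq> carrier G" using s(2) kG by (auto simp: A'_def)
  have sc: "s \<in> carrier D" using s(3) tw_closed[OF order_refl s(2)] by auto
  have ck: "c k \<in> carrier D" "inv (c k) \<in> carrier D" "inv (c k) \<in> P" using cP[of k] k by auto
  have S: "(\<Oplus>g\<in>A - {k}. c g \<otimes> u g) \<in> tw P (A - {k})"
    by (rule finsum_in_add_subgroup[OF tw_subgroup]) (use s(2) cP in \<open>auto intro: tw_incl\<close>)
  have Sc: "(\<Oplus>g\<in>A - {k}. c g \<otimes> u g) \<in> carrier D"
    using S tw_closed[of P "A - {k}"] s(2) by auto
  have "inv (c k) \<otimes> (\<Oplus>g\<in>A - {k}. c g \<otimes> u g) \<in> tw P (A - {k})"
    by (rule tw_scale_left) (use S ck s(2) in auto)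
  then have r: "r \<in> tw P A'" unfolding r_def
  proof (rule tw_mult[rotated 8, where B = "{inv\<^bsub>G\<^esub> k}" and Y = P])
    show "u (inv\<^bsub>G\<^esub> k) \<in> tw P {inv\<^bsub>G\<^esub> k}"
      using tw_incl[of \<one> P "inv\<^bsub>G\<^esub> k" "{inv\<^bsub>G\<^esub> k}"] kG by simp
  qed (use s(2) kG A'G in \<open>auto simp: A'_def\<close>)
  have rc: "r \<in> carrier D" using r tw_closed[OF order_refl A'G] by auto
  have "s = (\<Oplus>g\<in>insert k (A - {k}). c g \<otimes> u g)" unfolding c(2) using k(1) by (simp add: insert_absorb)
  also have "\<dots> = c k \<otimes> u k \<oplus> (\<Oplus>g\<in>A - {k}. c g \<otimes> u g)"
    by (rule finsum_insert) (use s(1) cP ug kG in auto)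
  finally have "s1 = inv (c k) \<otimes> (c k \<otimes> u k) \<otimes> u (inv\<^bsub>G\<^esub> k) \<oplus> r"
    using Sc ck kG cP unfolding s1_def r_def by (simp add: r_distr l_distr)
  moreover have "inv (c k) \<otimes> (c k \<otimes> u k) \<otimes> u (inv\<^bsub>G\<^esub> k) = (inv (c k) \<otimes> c k) \<otimes> (u k \<otimes> u (inv\<^bsub>G\<^esub> k))"
    using ck kG by (simp add: m_assoc del: u_inv dinv_l)
  ultimately have s1: "s1 = \<one> \<oplus> r" using ck k kG by simp
  have "x \<otimes> s1 = inv (c k) \<otimes> (x \<otimes> s) \<otimes> u (inv\<^bsub>G\<^esub> k)"
    unfolding s1_def using comm[OF ck(3)] x sc ck kG by (simp add: m_assoc[symmetric])
  then have xs1: "x \<otimes> s1 \<in> W" using s(5) ck(3) kG by (simp add: W_mult P_in_W u_in_W)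
  have s1c: "s1 \<in> carrier D" using s1 rc by simp
  have "card A' < card A"
    using s(1) k(1) unfolding A'_def by (metis card_Diff1_less card_image_le finite_Diff le_less_trans)
  \<comment> \<open>Consequently an element supported in \<open>A'\<close> that clears
    \<open>x\<close> must be zero.\<close>
  then have nQ: "\<not> Q A'" using A(2) by fastforce
  have "y \<otimes> r = r \<otimes> y" if y: "y \<in> P" for y
  proof -
    let ?t = "y \<otimes> r \<ominus> r \<otimes> y"
    have yc: "y \<in> carrier D" using y by simp
    have tA: "?t \<in> tw P A'"
      by (intro tw_minus tw_scale_left tw_scale_right) (use y r A'G in auto)
    \<comment> \<open>The term \<open>\<one>\<close> of \<open>s1\<close> commutes with
      \<open>y\<close> and drops out: the commutator is supported in \<open>A'\<close>, yet it
      clears \<open>x\<close> because \<open>s1\<close> does and \<open>x\<close> commutes with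
      \<open>y\<close>.\<close>
    have "?t = y \<otimes> s1 \<ominus> s1 \<otimes> y"
    proof -
      have "y \<otimes> s1 \<ominus> s1 \<otimes> y = (y \<oplus> y \<otimes> r) \<ominus> (y \<oplus> r \<otimes> y)"
        using yc rc by (simp add: s1 l_distr r_distr)
      also have "\<dots> = ?t" using yc rc by (intro add_minus_add) auto
      finally show ?thesis by simp
    qed
    then have "x \<otimes> ?t = x \<otimes> y \<otimes> s1 \<ominus> x \<otimes> s1 \<otimes> y"
      using x yc s1c by (simp add: a_minus_def r_distr r_minus m_assoc)
    also have "\<dots> = y \<otimes> (x \<otimes> s1) \<ominus> (x \<otimes> s1) \<otimes> y"
      using x yc s1c comm[OF y] by (simp add: m_assoc[symmetric])
    also have "\<dots> \<in> W"
      by (rule tw_minus[OF order_refl order_refl tw_scale_left[OF y order_refl xs1]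
            tw_scale_right[OF y order_refl xs1]])
    finally have "x \<otimes> ?t \<in> W" .
    moreover have "finite A'" using s(1) by (simp add: A'_def)
    ultimately have "?t = \<zero>" using nQ tA A'G unfolding Q_def by blast
    then show ?thesis using yc rc by (simp add: r_right_minus_eq)
  qed
  moreover have "\<one>\<^bsub>G\<^esub> \<notin> A'"
  proof
    assume "\<one>\<^bsub>G\<^esub> \<in> A'"
    then obtain g where g: "\<one>\<^bsub>G\<^esub> = g \<otimes>\<^bsub>G\<^esub> inv\<^bsub>G\<^esub> k" "g \<in> A - {k}" unfolding A'_def by (rule imageE)
    then have "g = k" using kG ug(2)[of g] G.inv_equality[OF g(1)[symmetric]] by simp
    then show False using g by simp
  qed
  ultimately have "r = \<zero>" using tw_centralizing_P[OF A'G r] by blast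
  \<comment> \<open>Now \<open>s1 = \<one>\<close>, so \<open>x\<close> itself lies in
    \<open>W\<close>, where centralizing \<open>P\<close> is decided coefficient by
    coefficient.\<close>
  then have "x \<in> W" using xs1 x by (simp add: s1)
  then show ?thesis using tw_centralizing_P(1)[OF order_refl _ comm] by blast
qed

end

section \<open>Absence of polynomial identities\<close>

text \<open>\<open>twisted_monomial \<alpha> c [j\<^sub>0, j\<^sub>1, \<dots>]\<close> is the coefficient of the word
  \<open>(c\<^sub>j\<^sub>0 t) (c\<^sub>j\<^sub>1 t) \<dots>\<close> at the power of \<open>t\<close> when \<open>t x = \<alpha> x t\<close>.\<close>

primrec (in ring) twisted_monomial :: "('a \<Rightarrow> 'a) \<Rightarrow> (nat \<Rightarrow> 'a) \<Rightarrow> nat list \<Rightarrow> 'a" where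
  "twisted_monomial \<alpha> c [] = \<one>"
| "twisted_monomial \<alpha> c (j # \<pi>) = c j \<otimes> \<alpha> (twisted_monomial \<alpha> c \<pi>)"

text \<open>The index words that arise when a product of sums, one sum over \<open>J v\<close> for
  each letter \<open>v\<close> of \<open>w\<close>, is multiplied out.\<close>

definition fillings :: "(nat \<Rightarrow> nat set) \<Rightarrow> nat list \<Rightarrow> nat list set"
  where "fillings J w = {\<pi>. list_all2 (\<lambda>j v. j \<in> J v) \<pi> w}"

lemma fillings_Nil: "fillings J [] = {[]}"
  by (auto simp: fillings_def)

lemma fillings_Cons: "fillings J (v # w) = (\<Union>j\<in>J v. (#) j ` fillings J w)"
  by (auto simp: fillings_def list_all2_Cons2)

lemma finite_fillings: "(\<And>v. finite (J v)) \<Longrightarrow> finite (fillings J w)"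
  by (induction w) (auto simp: fillings_Nil fillings_Cons)

context twisted_group_in_division_ring
begin

lemma act_P_add: "g \<in> carrier G \<Longrightarrow> x \<in> P \<Longrightarrow> y \<in> P \<Longrightarrow> act g (x \<oplus> y) = act g x \<oplus> act g y"
  by (rule act_add) auto

lemma act_zero [simp]: "g \<in> carrier G \<Longrightarrow> act g \<zero> = \<zero>"
  by (simp add: act_def)

lemma act_finsum:
  assumes "g \<in> carrier G" "f \<in> A \<rightarrow> P"
  shows "act g (finsum D f A) = (\<Oplus>a\<in>A. act g (f a))"
proof (cases "finite A")
  case True
  from True assms(2) show ?thesis
  proof (induction A)
    case empty
    then show ?case using assms(1) by (simp add: finsum_empty)
  next
    case (insert a A)
    have f: "f a \<in> P" "f \<in> A \<rightarrow> P" using insert.prems by auto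
    have "finsum D f (insert a A) = f a \<oplus> finsum D f A"
      by (rule finsum_insert) (use insert f in auto)
    moreover have "(\<Oplus>a\<in>insert a A. act g (f a)) = act g (f a) \<oplus> (\<Oplus>a\<in>A. act g (f a))"
      by (rule finsum_insert) (use insert f assms(1) in auto)
    moreover have "finsum D f A \<in> P" by (rule finsum_in_add_subgroup[OF P_subgroup f(2)])
    ultimately show ?case using insert.IH[OF f(2)] f assms(1) by (simp add: act_P_add)
  qed
qed (use assms in \<open>simp add: finsum_infinite\<close>)

lemma act_inverse [simp]:
  assumes "g \<in> carrier G" "x \<in> carrier D"
  shows "act (inv\<^bsub>G\<^esub> g) (act g x) = x" "act g (act (inv\<^bsub>G\<^esub> g) x) = x"
proof -
  have one: "act \<one>\<^bsub>G\<^esub> x = x" using assms(2) by (simp add: act_def u_one)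
  show "act (inv\<^bsub>G\<^esub> g) (act g x) = x"
    unfolding act_comp[OF G.inv_closed[OF assms(1)] assms, symmetric] G.l_inv[OF assms(1)] by (rule one)
  show "act g (act (inv\<^bsub>G\<^esub> g) x) = x"
    unfolding act_comp[OF assms(1) G.inv_closed[OF assms(1)] assms(2), symmetric] G.r_inv[OF assms(1)]
    by (rule one)
qed

lemma act_inj:
  assumes "g \<in> carrier G" "x \<in> carrier D" "y \<in> carrier D" "act g x = act g y" shows "x = y"
  using act_inverse(1)[OF assms(1,2)] unfolding assms(4) act_inverse(1)[OF assms(1,3)] by simp

lemma act_distinct:
  assumes "g \<in> carrier G" "h \<in> carrier G" "g \<noteq> h"
  obtains x where "x \<in> P" "act g x \<noteq> act h x"
proof -
  let ?k = "inv\<^bsub>G\<^esub> h \<otimes>\<^bsub>G\<^esub> g"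
  have "?k \<noteq> \<one>\<^bsub>G\<^esub>" using assms G.inv_equality[of "inv\<^bsub>G\<^esub> h" g] by auto
  moreover have k: "?k \<in> carrier G" using assms by simp
  ultimately obtain x where x: "x \<in> P" "act ?k x \<noteq> x"
    using faithful[of ?k] act_fixed_iff[of ?k] by (metis P_simps(1))
  have "act g x \<noteq> act h x"
  proof
    assume e: "act g x = act h x"
    have "act ?k x = act (inv\<^bsub>G\<^esub> h) (act g x)" using act_comp[of "inv\<^bsub>G\<^esub> h" g x] assms x by simp
    then show False using e x assms by simp
  qed
  then show ?thesis using that x by blast
qed

lemma twisted_monomial_closed:
  assumes "g \<in> carrier G" "c \<in> UNIV \<rightarrow> P"
  shows "twisted_monomial (act g) c \<pi> \<in> P"
  using assms by (induction \<pi>) auto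

text \<open>Since \<open>P\<close> is commutative and \<open>act g\<close> multiplicative, each
  index word defines a character of the monoid of families \<open>c\<close>; to these the
  independence of characters is applied.\<close>

lemma twisted_monomial_mult:
  assumes g: "g \<in> carrier G" and c: "c \<in> UNIV \<rightarrow> P" "e \<in> UNIV \<rightarrow> P"
  shows "twisted_monomial (act g) (\<lambda>j. c j \<otimes> e j) \<pi>
    = twisted_monomial (act g) c \<pi> \<otimes> twisted_monomial (act g) e \<pi>"
proof (induction \<pi>)
  case (Cons j \<pi>)
  let ?M = "\<lambda>c. twisted_monomial (act g) c \<pi>"
  have m: "?M c \<in> P" "?M e \<in> P" "c j \<in> P" "e j \<in> P" "act g (?M c) \<in> P" "act g (?M e) \<in> P"
    using twisted_monomial_closed[OF g] c g by auto
  have mc: "?M c \<in> carrier D" "?M e \<in> carrier D" "c j \<in> carrier D" "e j \<in> carrier D"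
    "act g (?M c) \<in> carrier D" "act g (?M e) \<in> carrier D" using m by auto
  have "e j \<otimes> (act g (?M c) \<otimes> act g (?M e)) = act g (?M c) \<otimes> (e j \<otimes> act g (?M e))"
    using m mc P_comm[of "e j" "act g (?M c)"] by (simp add: m_assoc[symmetric])
  then show ?case using Cons.IH g mc by (simp add: act_mult m_assoc)
qed simp

lemma twisted_monomial_absent:
  "g \<in> carrier G \<Longrightarrow> k \<notin> set \<pi> \<Longrightarrow> twisted_monomial (act g) (\<lambda>l. if l = k then y else \<one>) \<pi> = \<one>"
  by (induction \<pi>) auto

text \<open>A family that is \<open>\<one>\<close> except at one index makes the position of that
  index visible: exactly \<open>i\<close> factors \<open>u g\<close> stand to the left of the
  coefficient at position \<open>i\<close>.\<close>

lemma twisted_monomial_single: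
  assumes g: "g \<in> carrier G" and y: "y \<in> P"
  shows "distinct \<pi> \<Longrightarrow> i < length \<pi> \<Longrightarrow>
    twisted_monomial (act g) (\<lambda>l. if l = \<pi> ! i then y else \<one>) \<pi> = act (g [^]\<^bsub>G\<^esub> i) y"
proof (induction \<pi> arbitrary: i)
  case (Cons j \<pi>)
  show ?case
  proof (cases i)
    case 0
    have "twisted_monomial (act g) (\<lambda>l. if l = j then y else \<one>) \<pi> = \<one>"
      by (rule twisted_monomial_absent) (use Cons.prems g in auto)
    moreover have "act \<one>\<^bsub>G\<^esub> y = y" using y by (simp add: act_def u_one)
    ultimately show ?thesis using 0 g y by simp
  next
    case (Suc m)
    then have "twisted_monomial (act g) (\<lambda>l. if l = \<pi> ! m then y else \<one>) \<pi> = act (g [^]\<^bsub>G\<^esub> m) y" "\<pi> ! m \<noteq> j"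
      using Cons by auto
    moreover have "act (g [^]\<^bsub>G\<^esub> Suc m) y = act g (act (g [^]\<^bsub>G\<^esub> m) y)"
      unfolding G.nat_pow_Suc2[OF g] by (rule act_comp) (use g y in auto)
    ultimately show ?thesis using Suc g y by (auto simp del: G.nat_pow_Suc)
  qed
qed simp

text \<open>All factors \<open>u g\<close> are moved to the right end, twisting the coefficients
  they pass. The exponent that remains is the length of the word, so word length becomes degree in
  \<open>u g\<close>.\<close>

lemma word_value_fillings:
  assumes g: "g \<in> carrier G" and c: "c \<in> UNIV \<rightarrow> P" and J: "\<And>v. finite (J v)"
  shows "word_value D (map (\<lambda>v. (\<Oplus>j\<in>J v. c j) \<otimes> u g) w)
    = (\<Oplus>\<pi>\<in>fillings J w. twisted_monomial (act g) c \<pi>) \<otimes> u (g [^]\<^bsub>G\<^esub> length w)"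
proof (induction w)
  case Nil
  then show ?case by (simp add: fillings_Nil u_one)
next
  case (Cons v w)
  let ?M = "twisted_monomial (act g) c"
  let ?S = "\<Oplus>\<pi>\<in>fillings J w. ?M \<pi>" and ?C = "\<Oplus>j\<in>J v. c j"
  have M: "?M \<pi> \<in> P" for \<pi> by (rule twisted_monomial_closed[OF g c])
  have cP: "c j \<in> P" for j using c by auto
  have S: "?S \<in> P" "?C \<in> P"
    by (rule finsum_in_add_subgroup[OF P_subgroup]; use M cP in auto)+
  have fin: "finite (fillings J w)" by (rule finite_fillings[OF J])
  let ?N = "length w"
  have "word_value D (map (\<lambda>v. (\<Oplus>j\<in>J v. c j) \<otimes> u g) (v # w)) = (?C \<otimes> u g) \<otimes> (?S \<otimes> u (g [^]\<^bsub>G\<^esub> ?N))"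
    using Cons by simp
  also have "\<dots> = ?C \<otimes> act g ?S \<otimes> (u g \<otimes> u (g [^]\<^bsub>G\<^esub> ?N))"
  proof -
    have k: "?C \<in> carrier D" "?S \<in> carrier D" "act g ?S \<in> carrier D" "u g \<in> carrier D"
      "u (g [^]\<^bsub>G\<^esub> ?N) \<in> carrier D" using S g act_closed[OF g S(1)] by auto
    have "(?C \<otimes> u g) \<otimes> (?S \<otimes> u (g [^]\<^bsub>G\<^esub> ?N)) = ?C \<otimes> (u g \<otimes> ?S) \<otimes> u (g [^]\<^bsub>G\<^esub> ?N)"
      using k by (simp add: m_assoc)
    then show ?thesis using k u_act[OF g, of ?S] by (simp add: m_assoc)
  qed
  also have "u g \<otimes> u (g [^]\<^bsub>G\<^esub> ?N) = u (g [^]\<^bsub>G\<^esub> length (v # w))"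
    using g by (simp add: u_mult[symmetric] G.nat_pow_Suc2[symmetric] del: G.nat_pow_Suc)
  also have "?C \<otimes> act g ?S = (\<Oplus>j\<in>J v. c j \<otimes> act g ?S)"
    by (rule finsum_ldistr) (use J S g cP in auto)
  also have "\<dots> = (\<Oplus>j\<in>J v. \<Oplus>\<pi>\<in>(#) j ` fillings J w. ?M \<pi>)"
  proof (rule finsum_cong')
    fix j assume "j \<in> J v"
    have "(\<Oplus>\<pi>\<in>(#) j ` fillings J w. ?M \<pi>) = (\<Oplus>\<pi>\<in>fillings J w. ?M (j # \<pi>))"
      by (rule finsum_reindex) (use M in \<open>auto simp del: twisted_monomial.simps\<close>)
    also have "\<dots> = (\<Oplus>\<pi>\<in>fillings J w. c j \<otimes> act g (?M \<pi>))" by simp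
    also have "\<dots> = c j \<otimes> (\<Oplus>\<pi>\<in>fillings J w. act g (?M \<pi>))"
      by (rule finsum_rdistr[symmetric]) (use fin M g cP in auto)
    also have "\<dots> = c j \<otimes> act g ?S" using act_finsum[OF g, of ?M "fillings J w"] M by simp
    finally show "c j \<otimes> act g ?S = (\<Oplus>\<pi>\<in>(#) j ` fillings J w. ?M \<pi>)" by simp
  qed (use M in \<open>auto intro!: finsum_closed\<close>)
  also have "\<dots> = (\<Oplus>\<pi>\<in>fillings J (v # w). ?M \<pi>)" unfolding fillings_Cons
    by (rule add.finprod_UN_disjoint[symmetric]) (use J fin M in \<open>auto simp: pairwise_def disjnt_def\<close>)
  finally show ?case .
qed

lemma coefficient_in_tw_zero:
  assumes A: "A \<subseteq> carrier G" and g: "g \<in> carrier G" "g \<notin> A" and c: "c \<in> P" "c \<otimes> u g \<in> tw P A"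
  shows "c = \<zero>"
proof -
  obtain B e where B: "finite B" "B \<subseteq> A" "e \<in> UNIV \<rightarrow> P" "c \<otimes> u g = (\<Oplus>h\<in>B. e h \<otimes> u h)"
    using tw_repr[OF c(2) A] .
  have BG: "h \<in> carrier G" "h \<noteq> g" if "h \<in> B" for h using B(2) A g that by auto
  have eP: "e h \<in> P" for h using B(3) by auto
  let ?e = "\<lambda>h. if h = g then \<ominus> c else e h"
  have "(\<Oplus>h\<in>insert g B. ?e h \<otimes> u h) = ?e g \<otimes> u g \<oplus> (\<Oplus>h\<in>B. ?e h \<otimes> u h)"
    by (rule finsum_insert) (use B(1) BG eP c g in auto)
  also have "(\<Oplus>h\<in>B. ?e h \<otimes> u h) = (\<Oplus>h\<in>B. e h \<otimes> u h)"
    by (rule finsum_cong') (use BG eP in auto)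
  also have "?e g \<otimes> u g \<oplus> (\<Oplus>h\<in>B. e h \<otimes> u h) = \<zero>"
    unfolding B(4)[symmetric] using c g by (simp add: l_minus l_neg)
  finally have "?e g = \<zero>"
    by (rule u_independent[rotated 3]) (use B(1) BG g eP c in auto)
  then show ?thesis using c by simp
qed

text \<open>Substitute \<open>x\<^sub>v = \<Sum> c\<^sub>j t\<close>, summed over the positions \<open>j\<close> of \<open>v\<close> in a longest word \<open>w\<^sub>0\<close>. The
  top coefficient in \<open>t\<close> is a combination of characters of \<open>(c\<^sub>j)\<close>, among which the one belonging
  to \<open>w\<^sub>0\<close> itself occurs with the coefficient of \<open>w\<^sub>0\<close>.\<close>

theorem not_PI_algebra:
  assumes g: "g \<in> carrier G" and inf: "\<And>i j::nat. g [^]\<^bsub>G\<^esub> i = g [^]\<^bsub>G\<^esub> j \<Longrightarrow> i = j"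
    and F: "F \<subseteq> P"
  shows "\<not> PI_algebra D F"
proof
  assume "PI_algebra D F"
  then obtain f where f: "nc_polynomial D F f" "\<exists>w. f w \<noteq> \<zero>"
     "\<And>a :: nat \<Rightarrow> 'd. range a \<subseteq> carrier D \<Longrightarrow> nc_eval D f a = \<zero>"
    unfolding PI_algebra_def by auto
  let ?supp = "{w. f w \<noteq> \<zero>}"
  have fin: "finite ?supp" and fP: "f w \<in> P" for w using f(1) F by (auto simp: nc_polynomial_def)
  define d where "d = Max (length ` ?supp)"
  have "d \<in> length ` ?supp" unfolding d_def using fin f(2) by (intro Max_in) auto
  then obtain w0 where w0: "f w0 \<noteq> \<zero>" "length w0 = d" by auto
  have dmax: "length w \<le> d" if "f w \<noteq> \<zero>" for w unfolding d_def using fin that by (intro Max_ge) auto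
  define J where "J = (\<lambda>v. {j. j < d \<and> w0 ! j = v})"
  have J: "finite (J v)" for v by (auto simp: J_def)
  define Sd where "Sd = {w. f w \<noteq> \<zero> \<and> length w = d}"
  define Sl where "Sl = {w. f w \<noteq> \<zero> \<and> length w < d}"
  define Ts where "Ts = {\<pi>::nat list. length \<pi> = d \<and> set \<pi> \<subseteq> {..<d} \<and> f (map (nth w0) \<pi>) \<noteq> \<zero>}"
  let ?i = "[0..<d]"
  have finS: "finite Sd" "finite Sl" using fin by (auto simp: Sd_def Sl_def elim: finite_subset[rotated])
  \<comment> \<open>An index \<open>j\<close> can only stand under the letter \<open>w0 ! j\<close>,
    so an index word determines the word that it fills. Fillings of different words are thus
    disjoint, and \<open>Ts\<close> is their union over the words of length \<open>d\<close> that
    occur in \<open>f\<close>.\<close>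
  have fill: "fillings J w = {\<pi>. length \<pi> = length w \<and> set \<pi> \<subseteq> {..<d} \<and> map (nth w0) \<pi> = w}" for w
  proof -
    have "list_all2 (\<lambda>j v. j \<in> J v) \<pi> w \<longleftrightarrow> length \<pi> = length w \<and> set \<pi> \<subseteq> {..<d} \<and> map (nth w0) \<pi> = w"
      for \<pi>
      by (induction \<pi> arbitrary: w) (auto simp: J_def list_all2_Cons1 Cons_eq_map_conv)
    then show ?thesis by (auto simp: fillings_def)
  qed
  have PiU: "Ts = (\<Union>w\<in>Sd. fillings J w)"
    unfolding fill by (auto simp: Ts_def Sd_def)
  have finF: "finite (fillings J w)" for w by (rule finite_fillings[OF J])
  have fPi: "finite Ts" unfolding PiU using finS finF by auto
  let ?M = "twisted_monomial (act g)"
  have M: "?M c \<pi> \<in> P" if "c \<in> UNIV \<rightarrow> P" for c \<pi> by (rule twisted_monomial_closed[OF g that])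
  have vanish: "(\<Oplus>\<pi>\<in>Ts. f (map (nth w0) \<pi>) \<otimes> ?M c \<pi>) = \<zero>" if c: "c \<in> UNIV \<rightarrow> P" for c
  proof -
    let ?x = "\<lambda>v. (\<Oplus>j\<in>J v. c j) \<otimes> u g"
    let ?S = "\<lambda>w. \<Oplus>\<pi>\<in>fillings J w. ?M c \<pi>"
    let ?t = "\<lambda>w. f w \<otimes> (?S w \<otimes> u (g [^]\<^bsub>G\<^esub> length w))"
    have SP: "?S w \<in> P" for w by (rule finsum_in_add_subgroup[OF P_subgroup]) (use M c in auto)
    have tc: "?t w \<in> carrier D" for w using fP[of w] SP[of w] g by auto
    have "(\<Oplus>j\<in>J v. c j) \<in> P" for v by (rule finsum_in_add_subgroup[OF P_subgroup]) (use c in auto)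
    then have "range ?x \<subseteq> carrier D" using g by auto
    then have "\<zero> = nc_eval D f ?x" using f(3) by simp
    also have "\<dots> = (\<Oplus>w\<in>?supp. ?t w)" unfolding nc_eval_def
      by (rule finsum_cong') (use tc word_value_fillings[OF g c J] in auto)
    also have "?supp = Sd \<union> Sl" using dmax by (force simp: Sd_def Sl_def le_less)
    also have "(\<Oplus>w\<in>Sd \<union> Sl. ?t w) = (\<Oplus>w\<in>Sd. ?t w) \<oplus> (\<Oplus>w\<in>Sl. ?t w)"
      by (rule finsum_Un_disjoint) (use finS tc in \<open>auto simp: Sd_def Sl_def\<close>)
    finally have e: "(\<Oplus>w\<in>Sd. ?t w) \<oplus> (\<Oplus>w\<in>Sl. ?t w) = \<zero>" by simp
    \<comment> \<open>Words shorter than \<open>d\<close> contribute only powers of \<open>g\<close>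
      below \<open>d\<close>; as the powers of \<open>g\<close> are distinct, the part of degree
      \<open>d\<close> has to vanish by itself.\<close>
    let ?A = "(\<lambda>i. g [^]\<^bsub>G\<^esub> i) ` {..<d}"
    have A: "?A \<subseteq> carrier G" using g by auto
    have low: "(\<Oplus>w\<in>Sl. ?t w) \<in> tw P ?A"
    proof (rule finsum_in_add_subgroup[OF tw_subgroup[OF order_refl A]], rule Pi_I)
      fix w assume w: "w \<in> Sl"
      have "?t w = (f w \<otimes> ?S w) \<otimes> u (g [^]\<^bsub>G\<^esub> length w)" using fP[of w] SP[of w] g by (simp add: m_assoc)
      also have "\<dots> \<in> tw P ?A" using w fP SP by (intro tw_incl) (auto simp: Sl_def)
      finally show "?t w \<in> tw P ?A" .
    qed
    have "(\<Oplus>w\<in>Sd. ?t w) = (\<Oplus>w\<in>Sd. (f w \<otimes> ?S w) \<otimes> u (g [^]\<^bsub>G\<^esub> d))"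
    proof (rule finsum_cong')
      fix w assume "w \<in> Sd"
      then show "?t w = (f w \<otimes> ?S w) \<otimes> u (g [^]\<^bsub>G\<^esub> d)"
        using fP[of w] SP[of w] g by (simp add: Sd_def m_assoc)
    qed (use fP SP g in auto)
    also have "\<dots> = (\<Oplus>w\<in>Sd. f w \<otimes> ?S w) \<otimes> u (g [^]\<^bsub>G\<^esub> d)"
      by (rule finsum_ldistr[symmetric]) (use fP SP g finS in auto)
    finally have top: "(\<Oplus>w\<in>Sd. ?t w) = (\<Oplus>w\<in>Sd. f w \<otimes> ?S w) \<otimes> u (g [^]\<^bsub>G\<^esub> d)" .
    have TP: "(\<Oplus>w\<in>Sd. f w \<otimes> ?S w) \<in> P"
      by (rule finsum_in_add_subgroup[OF P_subgroup]) (use fP SP in auto)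
    have lc: "(\<Oplus>w\<in>Sl. ?t w) \<in> carrier D" using low tw_closed[OF order_refl A] by auto
    have "(\<Oplus>w\<in>Sd. ?t w) = \<ominus> (\<Oplus>w\<in>Sl. ?t w)"
      using e lc tc by (intro minus_equality[symmetric]) (auto intro!: finsum_closed)
    also have "\<dots> \<in> tw P ?A" by (rule tw_neg[OF order_refl A low])
    finally have "(\<Oplus>w\<in>Sd. f w \<otimes> ?S w) = \<zero>"
      unfolding top by (intro coefficient_in_tw_zero[OF A _ _ TP]) (use g inf in auto)
    moreover have "(\<Oplus>\<pi>\<in>Ts. f (map (nth w0) \<pi>) \<otimes> ?M c \<pi>)
        = (\<Oplus>w\<in>Sd. \<Oplus>\<pi>\<in>fillings J w. f (map (nth w0) \<pi>) \<otimes> ?M c \<pi>)"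
      unfolding PiU
      by (rule add.finprod_UN_disjoint)
        (use finS finF fP M c in \<open>auto simp: pairwise_def disjnt_def fill\<close>)
    moreover have "\<dots> = (\<Oplus>w\<in>Sd. f w \<otimes> ?S w)"
    proof (rule finsum_cong')
      fix w assume "w \<in> Sd"
      have "(\<Oplus>\<pi>\<in>fillings J w. f (map (nth w0) \<pi>) \<otimes> ?M c \<pi>) = (\<Oplus>\<pi>\<in>fillings J w. f w \<otimes> ?M c \<pi>)"
        by (rule finsum_cong') (use fP M c in \<open>auto simp: fill\<close>)
      also have "\<dots> = f w \<otimes> ?S w"
        by (rule finsum_rdistr[symmetric]) (use finF fP M c in auto)
      finally show "(\<Oplus>\<pi>\<in>fillings J w. f (map (nth w0) \<pi>) \<otimes> ?M c \<pi>) = f w \<otimes> ?S w" .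
    qed (use fP SP in auto)
    ultimately show ?thesis by simp
  qed
  have map_i: "map (nth w0) ?i = w0" using w0(2) by (metis map_nth)
  then have iPi: "?i \<in> Ts" using w0 by (auto simp: Ts_def)
  interpret Pd: domain "D\<lparr>carrier := P\<rparr>"
    by (rule subdomain_of_commutative_subring[OF P_ring P_comm])
  have "f (map (nth w0) ?i) = \<zero>\<^bsub>D\<lparr>carrier := P\<rparr>\<^esub>"
  proof (rule Pd.independence_of_characters[where J = "Ts - {?i}" and X = "UNIV \<rightarrow> P"
        and f = "\<lambda>c e j. c j \<otimes> e j" and \<chi> = "\<lambda>\<pi> c. ?M c \<pi>" and i = ?i and k = "\<lambda>\<pi>. f (map (nth w0) \<pi>)"])
    show "finite (Ts - {?i})" using fPi by simp
    show "\<exists>c\<in>UNIV \<rightarrow> P. ?M c ?i \<noteq> \<zero>\<^bsub>D\<lparr>carrier := P\<rparr>\<^esub>"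
    proof
      have "?M (\<lambda>_. \<one>) \<pi> = \<one>" for \<pi> using g by (induction \<pi>) auto
      then show "?M (\<lambda>_. \<one>) ?i \<noteq> \<zero>\<^bsub>D\<lparr>carrier := P\<rparr>\<^esub>" by simp
    qed auto
    show "\<exists>c\<in>UNIV \<rightarrow> P. ?M c \<pi> \<noteq> ?M c ?i" if \<pi>: "\<pi> \<in> Ts - {?i}" for \<pi>
    proof -
      have len: "length \<pi> = d" "set \<pi> \<subseteq> {..<d}" "\<pi> \<noteq> ?i" using \<pi> by (auto simp: Ts_def)
      have single: "?M (\<lambda>l. if l = k then y else \<one>) ?i = act (g [^]\<^bsub>G\<^esub> k) y" if "k < d" "y \<in> P" for k y
        using twisted_monomial_single[OF g that(2), of ?i k] that by simp
      show ?thesis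
      proof (cases "\<exists>k<d. k \<notin> set \<pi>")
        case True
        \<comment> \<open>Probing an index \<open>k\<close> that \<open>\<pi>\<close> omits gives
          \<open>\<one>\<close> on \<open>\<pi>\<close>, while on \<open>?i\<close>, where
          \<open>k\<close> stands at position \<open>k\<close>, it gives an image of
          \<open>y \<noteq> \<one>\<close> under an injective map.\<close>
        then obtain k where k: "k < d" "k \<notin> set \<pi>" by auto
        have "g \<noteq> \<one>\<^bsub>G\<^esub>" using inf[of 0 1] g by auto
        then obtain y where y: "y \<in> P" "u g \<otimes> y \<noteq> y \<otimes> u g" using faithful[OF g] by auto
        have "y \<noteq> \<one>" using y g by auto
        have "act (g [^]\<^bsub>G\<^esub> k) y \<noteq> \<one>"
          using \<open>y \<noteq> \<one>\<close> act_inj[of "g [^]\<^bsub>G\<^esub> k" y \<one>] y g by auto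
        then have "?M (\<lambda>l. if l = k then y else \<one>) \<pi> \<noteq> ?M (\<lambda>l. if l = k then y else \<one>) ?i"
          using single[OF k(1) y(1)] twisted_monomial_absent[OF g k(2)] by simp
        then show ?thesis using y(1) by (intro bexI[of _ "\<lambda>l. if l = k then y else \<one>"]) auto
      next
        case False
        \<comment> \<open>With no index omitted, \<open>\<pi>\<close> is a permutation of the
          positions. If it moves position \<open>i\<close>, the index \<open>\<pi> ! i\<close> is
          probed: it stands at position \<open>i\<close> in \<open>\<pi>\<close>, but at position
          \<open>\<pi> ! i\<close> in \<open>?i\<close>.\<close>
        then have "set \<pi> = {..<d}" using len by auto
        then have "distinct \<pi>" using len(1) by (intro card_distinct) simp
        obtain i where i: "i < d" "\<pi> ! i \<noteq> i" using len
          by (metis length_upt nth_equalityI nth_upt add_0 minus_nat.diff_0)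
        let ?k = "\<pi> ! i"
        have k: "?k < d" using i len by (metis lessThan_iff nth_mem subsetD)
        have "g [^]\<^bsub>G\<^esub> i \<noteq> g [^]\<^bsub>G\<^esub> ?k" using inf i by metis
        then obtain y where y: "y \<in> P" "act (g [^]\<^bsub>G\<^esub> i) y \<noteq> act (g [^]\<^bsub>G\<^esub> ?k) y"
          using act_distinct[of "g [^]\<^bsub>G\<^esub> i" "g [^]\<^bsub>G\<^esub> ?k"] g by auto
        have "?M (\<lambda>l. if l = ?k then y else \<one>) \<pi> = act (g [^]\<^bsub>G\<^esub> i) y"
          using twisted_monomial_single[OF g y(1) \<open>distinct \<pi>\<close>, of i] i len by simp
        then have "?M (\<lambda>l. if l = ?k then y else \<one>) \<pi> \<noteq> ?M (\<lambda>l. if l = ?k then y else \<one>) ?i"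
          using single[OF k y(1)] y(2) by simp
        then show ?thesis using y(1) by (intro bexI[of _ "\<lambda>l. if l = ?k then y else \<one>"]) auto
      qed
    qed
    fix c :: "nat \<Rightarrow> 'd" assume c: "c \<in> UNIV \<rightarrow> P"
    let ?h = "\<lambda>\<pi>. f (map (nth w0) \<pi>) \<otimes> ?M c \<pi>"
    have hP: "?h \<pi> \<in> P" for \<pi> using fP M[OF c] by auto
    have "(\<Oplus>\<^bsub>D\<lparr>carrier := P\<rparr>\<^esub>\<pi>\<in>Ts - {?i}. ?h \<pi>) = (\<Oplus>\<pi>\<in>Ts - {?i}. ?h \<pi>)"
      by (rule finsum_consistent[OF P_ring]) (use hP in auto)
    moreover have "(\<Oplus>\<pi>\<in>insert ?i (Ts - {?i}). ?h \<pi>) = ?h ?i \<oplus> (\<Oplus>\<pi>\<in>Ts - {?i}. ?h \<pi>)"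
      by (rule finsum_insert) (use hP fPi in auto)
    moreover have "insert ?i (Ts - {?i}) = Ts" using iPi by auto
    ultimately show "f (map (nth w0) ?i) \<otimes>\<^bsub>D\<lparr>carrier := P\<rparr>\<^esub> ?M c ?i \<oplus>\<^bsub>D\<lparr>carrier := P\<rparr>\<^esub>
        (\<Oplus>\<^bsub>D\<lparr>carrier := P\<rparr>\<^esub>\<pi>\<in>Ts - {?i}. f (map (nth w0) \<pi>) \<otimes>\<^bsub>D\<lparr>carrier := P\<rparr>\<^esub> ?M c \<pi>) = \<zero>\<^bsub>D\<lparr>carrier := P\<rparr>\<^esub>"
      using vanish[OF c] by simp
  qed (use M twisted_monomial_mult[OF g] fP in \<open>auto simp: Pi_iff\<close>)
  then show False using w0 map_i by simp
qed

end

section \<open>Local finiteness over centres\<close>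

lemma (in ring) finsum_swap:
  assumes "finite A" "finite B" "\<And>a b. a \<in> A \<Longrightarrow> b \<in> B \<Longrightarrow> f a b \<in> carrier R"
  shows "(\<Oplus>a\<in>A. \<Oplus>b\<in>B. f a b) = (\<Oplus>b\<in>B. \<Oplus>a\<in>A. f a b)"
  using assms(1,3)
proof (induction A)
  case empty
  then show ?case by (simp add: finsum_empty finsum_zero)
next
  case (insert x A)
  have c: "f x b \<in> carrier R" "(\<Oplus>a\<in>A. f a b) \<in> carrier R" if "b \<in> B" for b
    using insert.prems that by (auto intro!: finsum_closed)
  have "(\<Oplus>a\<in>insert x A. \<Oplus>b\<in>B. f a b) = (\<Oplus>b\<in>B. f x b) \<oplus> (\<Oplus>a\<in>A. \<Oplus>b\<in>B. f a b)"
    by (rule finsum_insert) (use insert in \<open>auto intro!: finsum_closed\<close>)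
  also have "(\<Oplus>a\<in>A. \<Oplus>b\<in>B. f a b) = (\<Oplus>b\<in>B. \<Oplus>a\<in>A. f a b)" using insert by simp
  also have "(\<Oplus>b\<in>B. f x b) \<oplus> (\<Oplus>b\<in>B. \<Oplus>a\<in>A. f a b) = (\<Oplus>b\<in>B. f x b \<oplus> (\<Oplus>a\<in>A. f a b))"
    by (rule finsum_addf[symmetric]) (use c in auto)
  also have "\<dots> = (\<Oplus>b\<in>B. \<Oplus>a\<in>insert x A. f a b)"
    by (rule finsum_cong') (use c insert in \<open>auto intro!: finsum_insert[symmetric] finsum_closed\<close>)
  finally show ?case .
qed

text \<open>Galois theory enters through \<open>L_conj\<close> and \<open>L_power\<close>: layers
  are stable under \<open>G\<close>, and \<open>q m\<close>-th powers act trivially on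
  \<open>L m\<close>. The conditions on \<open>s\<close> provide coordinates on a free abelian group
  of rank \<open>n\<close>.\<close>

locale twisted_tower = twisted_group_in_division_ring D G P u
  for D :: "('d, 'k) ring_scheme" (structure) and G :: "('g, 'h) monoid_scheme" and P u +
  fixes F :: "'d set" and L :: "nat \<Rightarrow> 'd set" and q :: "nat \<Rightarrow> nat" and n :: nat and s :: "nat \<Rightarrow> 'g"
  assumes F: "subfield F D" and F_L: "F \<subseteq> L m"
    and F_commutes: "g \<in> carrier G \<Longrightarrow> x \<in> F \<Longrightarrow> u g \<otimes> x = x \<otimes> u g"
    and L: "subfield (L m) D" and L_Suc: "L m \<subseteq> L (Suc m)" and P_eq: "P = (\<Union>m. L m)"
    and L_conj: "g \<in> carrier G \<Longrightarrow> x \<in> L m \<Longrightarrow> u g \<otimes> x \<otimes> u (inv\<^bsub>G\<^esub> g) \<in> L m"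
    and L_finite: "\<exists>ls. set ls \<subseteq> carrier D \<and> L m = Span F ls"
    and q_pos: "q m > 0"
    and L_power: "g \<in> carrier G \<Longrightarrow> x \<in> L m \<Longrightarrow> u (g [^]\<^bsub>G\<^esub> q m) \<otimes> x = x \<otimes> u (g [^]\<^bsub>G\<^esub> q m)"
    and s_closed: "i \<in> {1..n} \<Longrightarrow> s i \<in> carrier G"
    and s_generate: "carrier G = range (\<lambda>k::nat \<Rightarrow> int. finprod G (\<lambda>i. s i [^]\<^bsub>G\<^esub> k i) {1..n})"
    and s_independent: "finprod G (\<lambda>i. s i [^]\<^bsub>G\<^esub> (k i :: int)) {1..n} = \<one>\<^bsub>G\<^esub> \<Longrightarrow> i \<in> {1..n} \<Longrightarrow> k i = 0"
begin

text \<open>The coordinate map from exponent vectors to \<open>G\<close>. Vectors are total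
  functions of which only the values on \<open>{1..n}\<close> count, which makes addition pointwise;
  they are cut down to \<open>{1..n}\<close> only when finitely many have to be listed.\<close>

definition gexp :: "(nat \<Rightarrow> int) \<Rightarrow> 'g"
  where "gexp k = finprod G (\<lambda>i. s i [^]\<^bsub>G\<^esub> k i) {1..n}"

lemma gexp_closed [simp, intro]: "gexp k \<in> carrier G"
  unfolding gexp_def by (rule G.finprod_closed) (use s_closed in auto)

lemma gexp_surj:
  assumes "g \<in> carrier G" obtains k where "g = gexp k"
  using assms s_generate that unfolding gexp_def by blast

lemma gexp_add: "gexp (\<lambda>i. k i + l i) = gexp k \<otimes>\<^bsub>G\<^esub> gexp l"
proof -
  have "gexp (\<lambda>i. k i + l i) = finprod G (\<lambda>i. s i [^]\<^bsub>G\<^esub> k i \<otimes>\<^bsub>G\<^esub> s i [^]\<^bsub>G\<^esub> l i) {1..n}"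
    unfolding gexp_def by (rule G.finprod_cong') (use s_closed in \<open>auto simp: G.int_pow_mult\<close>)
  then show ?thesis unfolding gexp_def
    by (simp add: G.finprod_multf s_closed Pi_iff)
qed

lemma gexp_zero: "gexp (\<lambda>_. 0) = \<one>\<^bsub>G\<^esub>"
  unfolding gexp_def by (simp add: G.finprod_one)

lemma gexp_cong: "(\<And>i. i \<in> {1..n} \<Longrightarrow> k i = l i) \<Longrightarrow> gexp k = gexp l"
  unfolding gexp_def by (rule G.finprod_cong') (use s_closed in auto)

lemma gexp_power: fixes N :: nat shows "gexp (\<lambda>i. int N * k i) = gexp k [^]\<^bsub>G\<^esub> N"
proof (induction N)
  case 0
  then show ?case by (simp add: gexp_zero)
next
  case (Suc N)
  have "gexp (\<lambda>i. int (Suc N) * k i) = gexp (\<lambda>i. int N * k i + k i)"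
    by (rule gexp_cong) (simp add: algebra_simps)
  then show ?case by (simp add: gexp_add Suc)
qed

lemma gexp_inj:
  assumes "gexp k = gexp l" "i \<in> {1..n}" shows "k i = l i"
proof -
  have "gexp (\<lambda>i. k i - l i) \<otimes>\<^bsub>G\<^esub> gexp l = gexp k"
    unfolding gexp_add[symmetric] by (rule gexp_cong) simp
  then have "gexp (\<lambda>i. k i - l i) = \<one>\<^bsub>G\<^esub>" using assms(1) by (simp add: G.r_cancel_one')
  then show ?thesis using s_independent[of "\<lambda>i. k i - l i" i] assms(2) unfolding gexp_def by simp
qed

text \<open>Division with remainder in each exponent: the \<open>N\<close>-th powers have finite
  index in \<open>G\<close>.\<close>

lemma finite_coset_representatives:
  assumes "N > (0::nat)"
  obtains T where "finite T" "T \<subseteq> carrier G"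
    "\<And>g. g \<in> carrier G \<Longrightarrow> \<exists>h\<in>carrier G. \<exists>t\<in>T. g = h [^]\<^bsub>G\<^esub> N \<otimes>\<^bsub>G\<^esub> t"
proof
  let ?T = "gexp ` ({1..n} \<rightarrow>\<^sub>E {0..<int N})"
  show "finite ?T" by (intro finite_imageI finite_PiE) auto
  show "?T \<subseteq> carrier G" by auto
  fix g assume "g \<in> carrier G"
  then obtain k where k: "g = gexp k" by (rule gexp_surj)
  let ?t = "\<lambda>i\<in>{1..n}. k i mod int N"
  have "g = gexp (\<lambda>i. int N * (k i div int N) + ?t i)" unfolding k by (rule gexp_cong) simp
  also have "\<dots> = gexp (\<lambda>i. k i div int N) [^]\<^bsub>G\<^esub> N \<otimes>\<^bsub>G\<^esub> gexp ?t"
    by (simp only: gexp_add gexp_power)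
  finally show "\<exists>h\<in>carrier G. \<exists>t\<in>?T. g = h [^]\<^bsub>G\<^esub> N \<otimes>\<^bsub>G\<^esub> t"
    using assms by (intro bexI[of _ "gexp (\<lambda>i. k i div int N)"] bexI[of _ "gexp ?t"]) auto
qed

lemma L_P: "L m \<subseteq> P" using P_eq by auto

lemma L_subring: "subring (L m) D"
  using subfieldE(1)[OF L] .

lemma L_simps [simp, intro]:
  "\<zero> \<in> L m" "\<one> \<in> L m" "x \<in> L m \<Longrightarrow> y \<in> L m \<Longrightarrow> x \<oplus> y \<in> L m"
  "x \<in> L m \<Longrightarrow> y \<in> L m \<Longrightarrow> x \<otimes> y \<in> L m" "x \<in> L m \<Longrightarrow> \<ominus> x \<in> L m"
  using subringE[OF L_subring] by auto

lemma L_act: "g \<in> carrier G \<Longrightarrow> x \<in> L m \<Longrightarrow> act g x \<in> L m"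
  unfolding act_def by (rule L_conj)

lemma L_mono: "i \<le> j \<Longrightarrow> L i \<subseteq> L j"
  by (rule lift_Suc_mono_le[of L]) (rule L_Suc)

text \<open>The twisted group ring \<open>L_m#G\<close> of a single layer, realised inside
  \<open>D\<close>.\<close>

definition Wl :: "nat \<Rightarrow> 'd set" where "Wl m = tw (L m) (carrier G)"

lemma Wl_subring: "subring (Wl m) D"
proof (rule subringI)
  note c = tw_closed[OF L_P order_refl, of m, folded Wl_def]
  show "Wl m \<subseteq> carrier D" by (rule c)
  show "\<one> \<in> Wl m" unfolding Wl_def by (rule tw_scalar) (use L_P in auto)
  show "\<ominus> x \<in> Wl m" if "x \<in> Wl m" for x using that unfolding Wl_def by (intro tw_neg L_P) auto
  show "x \<otimes> y \<in> Wl m" if "x \<in> Wl m" "y \<in> Wl m" for x y using that unfolding Wl_def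
    by (intro tw_mult[OF L_P L_P L_P order_refl order_refl order_refl]) (auto intro: L_act)
  show "x \<oplus> y \<in> Wl m" if "x \<in> Wl m" "y \<in> Wl m" for x y using that unfolding Wl_def by (rule tw_add)
qed

lemma Wl_simps:
  "Wl m \<subseteq> carrier D" "\<zero> \<in> Wl m" "\<one> \<in> Wl m" "x \<in> Wl m \<Longrightarrow> y \<in> Wl m \<Longrightarrow> x \<oplus> y \<in> Wl m"
  "x \<in> Wl m \<Longrightarrow> y \<in> Wl m \<Longrightarrow> x \<otimes> y \<in> Wl m" "x \<in> Wl m \<Longrightarrow> \<ominus> x \<in> Wl m"
  using subringE[OF Wl_subring] by auto

lemma Wl_carrier [simp, intro]: "x \<in> Wl m \<Longrightarrow> x \<in> carrier D"
  using Wl_simps(1) by auto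

lemma Wl_mono: "i \<le> j \<Longrightarrow> Wl i \<subseteq> Wl j"
  unfolding Wl_def by (intro tw_mono L_mono) auto

lemma L_in_Wl: "x \<in> L m \<Longrightarrow> x \<in> Wl m"
  unfolding Wl_def by (rule tw_scalar) (use L_P in auto)

lemma u_in_Wl: "g \<in> carrier G \<Longrightarrow> u g \<in> Wl m"
  using tw_incl[of \<one> "L m" g "carrier G"] unfolding Wl_def by simp

text \<open>The centre of the layer. It need not increase with \<open>m\<close>, because an element
  \<open>u g\<close> that commutes with one layer may fail to commute with the next.\<close>

definition Zl :: "nat \<Rightarrow> 'd set" where "Zl m = Wl m \<inter> centralizer (Wl m)"

lemma Zl_subring: "subring (Zl m) D"
  unfolding Zl_def
  using subring_inter[OF Wl_subring centralizer_subring[OF Wl_simps(1)]] .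

lemma Zl_simps:
  "\<zero> \<in> Zl m" "\<one> \<in> Zl m" "x \<in> Zl m \<Longrightarrow> y \<in> Zl m \<Longrightarrow> x \<oplus> y \<in> Zl m"
  "x \<in> Zl m \<Longrightarrow> y \<in> Zl m \<Longrightarrow> x \<otimes> y \<in> Zl m" "x \<in> Zl m \<Longrightarrow> \<ominus> x \<in> Zl m"
  using subringE[OF Zl_subring] by auto

lemma Zl_Wl: "z \<in> Zl m \<Longrightarrow> z \<in> Wl m"
  unfolding Zl_def by auto

lemma Zl_carrier [simp, intro]: "z \<in> Zl m \<Longrightarrow> z \<in> carrier D"
  using Zl_Wl by auto

lemma Zl_commutes: "z \<in> Zl m \<Longrightarrow> w \<in> Wl m \<Longrightarrow> z \<otimes> w = w \<otimes> z"
  unfolding Zl_def centralizer_def by auto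

lemma Zl_domain: "domain (D\<lparr>carrier := Zl m\<rparr>)"
  by (rule subdomain_of_commutative_subring[OF Zl_subring]) (rule Zl_commutes[OF _ Zl_Wl])

lemma F_P: "F \<subseteq> P" using F_L L_P by blast

text \<open>Commuting with \<open>z\<close> is preserved under sums and products, so the
  coefficients and the \<open>u g\<close> can be tested separately.\<close>

lemma Zl_I:
  assumes "z \<in> Wl m" "\<And>x. x \<in> L m \<Longrightarrow> z \<otimes> x = x \<otimes> z"
    "\<And>g. g \<in> carrier G \<Longrightarrow> z \<otimes> u g = u g \<otimes> z"
  shows "z \<in> Zl m"
proof -
  have zc: "z \<in> carrier D" using assms(1) by auto
  have "z \<otimes> (x \<otimes> u g) = x \<otimes> u g \<otimes> z" if "x \<in> L m" "g \<in> carrier G" for x g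
  proof -
    have xc: "x \<in> carrier D" using that L_P by blast
    have "z \<otimes> (x \<otimes> u g) = x \<otimes> (z \<otimes> u g)"
      using assms(2)[OF that(1)] zc xc that(2) by (simp add: m_assoc[symmetric])
    then show ?thesis using assms(3)[OF that(2)] zc xc that(2) by (simp add: m_assoc)
  qed
  then have "z \<in> centralizer (product_set (L m) u (carrier G))"
    using zc by (auto simp: centralizer_def product_set_def)
  then show ?thesis using assms(1) centralizer_adspan[OF tw_base[OF L_P order_refl]]
    by (simp add: Zl_def Wl_def tw_def)
qed

lemma F_Zl: "x \<in> F \<Longrightarrow> x \<in> Zl m"
  by (rule Zl_I) (use F_L L_P P_comm F_commutes in \<open>auto intro: L_in_Wl simp: subset_iff\<close>)

lemma u_power_Zl: "g \<in> carrier G \<Longrightarrow> u (g [^]\<^bsub>G\<^esub> q m) \<in> Zl m"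
  by (rule Zl_I) (auto intro: u_in_Wl simp: L_power u_mult[symmetric] G.m_comm)

text \<open>Generators are the \<open>l \<otimes> u t\<close> with \<open>l\<close> from a spanning
  list of \<open>L m\<close> over \<open>F\<close> and \<open>t\<close> a representative modulo
  \<open>q m\<close>-th powers. The unit of a \<open>q m\<close>-th power commutes with
  \<open>l\<close>, can be moved to the left of it, and is then a central coefficient.\<close>

lemma Wl_finite_over_Zl:
  obtains B where "finite B" "B \<subseteq> Wl m" "Wl m \<subseteq> adspan (product_set (Zl m) (\<lambda>b. b) B)"
proof -
  obtain ls where ls: "set ls \<subseteq> carrier D" "L m = Span F ls" using L_finite by blast
  obtain T where T: "finite T" "T \<subseteq> carrier G"
    "\<And>g. g \<in> carrier G \<Longrightarrow> \<exists>h\<in>carrier G. \<exists>t\<in>T. g = h [^]\<^bsub>G\<^esub> q m \<otimes>\<^bsub>G\<^esub> t"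
    using finite_coset_representatives[OF q_pos[of m]] by blast
  define B where "B = (\<lambda>(l, t). l \<otimes> u t) ` (set ls \<times> T)"
  have lsL: "set ls \<subseteq> L m" using Span_base_incl[OF F ls(1)] ls(2) by simp
  have BW: "B \<subseteq> Wl m" unfolding B_def
    using lsL T(2) by (auto intro!: Wl_simps(5) intro: L_in_Wl u_in_Wl)
  let ?C = "product_set (Zl m) (\<lambda>b. b) B"
  have C: "?C \<subseteq> carrier D" using product_set_closed[of "Zl m" "\<lambda>b. b" B] BW by auto
  have LF: "L m = adspan (F <#> set ls)" unfolding ls(2) adspan_def by (rule Span_eq_generate[OF F ls(1)])
  have Fls: "F <#> set ls \<subseteq> carrier D" using subfieldE(3)[OF F] ls(1) by (auto simp: set_mult_def)
  have "x \<otimes> u g \<in> adspan ?C" if x: "x \<in> L m" and g: "g \<in> carrier G" for x g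
  proof (rule adspan_mult[OF Fls _ C])
    show "x \<in> adspan (F <#> set ls)" using x LF by simp
    show "u g \<in> adspan {u g}" by (rule adspan_incl) simp
    show "{u g} \<subseteq> carrier D" using g by auto
    fix a b assume "a \<in> F <#> set ls" "b \<in> {u g}"
    then obtain f l where a: "f \<in> F" "l \<in> set ls" "a = f \<otimes> l" "b = u g" by (auto simp: set_mult_def)
    obtain h t where ht: "h \<in> carrier G" "t \<in> T" "g = h [^]\<^bsub>G\<^esub> q m \<otimes>\<^bsub>G\<^esub> t" using T(3)[OF g] by blast
    have tG: "t \<in> carrier G" using ht T by auto
    have c: "f \<in> carrier D" "l \<in> carrier D" "l \<in> L m" using a(1,2) F_P lsL ls(1) by auto
    let ?z = "u (h [^]\<^bsub>G\<^esub> q m)"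
    have z: "?z \<in> carrier D" "u t \<in> carrier D" using ht tG by auto
    have "a \<otimes> b = f \<otimes> (l \<otimes> ?z) \<otimes> u t"
      using a(3,4) ht tG c z by (simp add: u_mult m_assoc)
    also have "l \<otimes> ?z = ?z \<otimes> l" using L_power[OF ht(1) c(3)] by simp
    also have "f \<otimes> (?z \<otimes> l) \<otimes> u t = (f \<otimes> ?z) \<otimes> (l \<otimes> u t)" using c z by (simp add: m_assoc)
    also have "\<dots> \<in> adspan ?C"
    proof (intro adspan_incl product_setI)
      show "f \<otimes> ?z \<in> Zl m" using F_Zl[OF a(1)] u_power_Zl[OF ht(1)] by (rule Zl_simps(4))
      show "l \<otimes> u t \<in> B" using a(2) ht(2) by (auto simp: B_def)
    qed
    finally show "a \<otimes> b \<in> adspan ?C" .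
  qed
  then have "product_set (L m) u (carrier G) \<subseteq> adspan ?C" by (auto simp: product_set_def)
  then have "Wl m \<subseteq> adspan ?C"
    unfolding Wl_def tw_def by (rule adspan_min[OF _ adspan_subgroup[OF C]])
  moreover have "finite B" unfolding B_def using T(1) by auto
  ultimately show ?thesis using that BW by blast
qed

lemma Wl_subgroup: "subgroup (Wl m) (add_monoid D)"
  by (rule add_subgroupI) (use Wl_simps in auto)

lemma Zl_subgroup: "subgroup (Zl m) (add_monoid D)"
  by (rule add_subgroupI) (use Zl_simps in auto)

lemma Wl_power: "x \<in> Wl m \<Longrightarrow> x [^] (i::nat) \<in> Wl m"
  by (induction i) (auto intro: Wl_simps(3,5))

text \<open>An algebraic relation \<open>\<Sum> k\<^sub>i x\<^sup>i = 0\<close> over the centre, with its lowest powers cancelled, exhibits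
  a nonzero central multiple of \<open>x\<close>.\<close>

lemma central_multiple_of_root:
  assumes x: "x \<in> Wl m" "x \<noteq> \<zero>"
    and "k \<in> UNIV \<rightarrow> Zl m" "\<exists>i\<le>(N::nat). k i \<noteq> \<zero>" "(\<Oplus>i\<in>{..N}. k i \<otimes> x [^] i) = \<zero>"
  shows "\<exists>y\<in>Wl m. x \<otimes> y \<in> Zl m \<and> x \<otimes> y \<noteq> \<zero>"
  using assms(3-)
proof (induction N arbitrary: k)
  case 0
  then have "k 0 \<in> carrier D" by auto
  then show ?case using 0 by (simp add: finsum_insert)
next
  case (Suc N)
  have xc: "x \<in> carrier D" using x by auto
  have kZ: "k i \<in> Zl m" for i using Suc.prems by auto
  have kc: "k i \<in> carrier D" for i using kZ by auto
  let ?S = "\<Oplus>i\<in>{..N}. k (Suc i) \<otimes> x [^] i"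
  have SW: "?S \<in> Wl m"
    by (rule finsum_in_add_subgroup[OF Wl_subgroup])
      (use kZ Wl_power[OF x(1)] in \<open>auto intro: Wl_simps(5) Zl_Wl\<close>)
  have Sc: "?S \<in> carrier D" using SW by auto
  have pc: "x [^] i \<in> carrier D" for i :: nat using xc by simp
  have "(\<Oplus>i\<in>{..Suc N}. k i \<otimes> x [^] i) = (\<Oplus>i\<in>{..N}. k (Suc i) \<otimes> x [^] Suc i) \<oplus> k 0 \<otimes> x [^] (0::nat)"
    by (rule finsum_Suc2) (use kc pc in auto)
  also have "(\<Oplus>i\<in>{..N}. k (Suc i) \<otimes> x [^] Suc i) = (\<Oplus>i\<in>{..N}. x \<otimes> (k (Suc i) \<otimes> x [^] i))"
  proof (rule finsum_cong')
    fix i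
    have "k (Suc i) \<otimes> x [^] Suc i = k (Suc i) \<otimes> (x \<otimes> x [^] i)" using xc nat_pow_Suc2[of x i] by simp
    also have "\<dots> = x \<otimes> (k (Suc i) \<otimes> x [^] i)"
      using Zl_commutes[OF kZ x(1), of "Suc i"] xc kc pc by (simp add: m_assoc[symmetric])
    finally show "k (Suc i) \<otimes> x [^] Suc i = x \<otimes> (k (Suc i) \<otimes> x [^] i)" .
  qed (use kc xc pc in auto)
  also have "\<dots> = x \<otimes> ?S" by (rule finsum_rdistr[symmetric]) (use kc xc pc in auto)
  finally have e: "x \<otimes> ?S \<oplus> k 0 = \<zero>" using Suc.prems(3) kc[of 0] by simp
  show ?case
  proof (cases "k 0 = \<zero>")
    case True
    then have "x \<otimes> ?S = \<zero>" using e xc Sc by simp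
    then have "?S = \<zero>" using no_zero_divisors xc Sc x(2) by blast
    moreover have "\<exists>i\<le>N. k (Suc i) \<noteq> \<zero>"
    proof -
      obtain i where "i \<le> Suc N" "k i \<noteq> \<zero>" using Suc.prems by auto
      then show ?thesis using True by (cases i) auto
    qed
    ultimately show ?thesis using Suc.IH[of "\<lambda>i. k (Suc i)"] kZ by auto
  next
    case False
    have "x \<otimes> ?S = \<ominus> k 0" using e xc Sc kc[of 0] by (simp add: minus_equality)
    moreover have "\<ominus> k 0 \<noteq> \<zero>" using False kc[of 0] by (metis add.inv_eq_1_iff)
    ultimately show ?thesis using SW Zl_simps(5)[OF kZ[of 0]] by (intro bexI[of _ ?S]) auto
  qed
qed

text \<open>With \<open>N\<close> generators over the commutative domain \<open>Zl m\<close>, the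
  \<open>N + 1\<close> powers of \<open>x\<close> up to exponent \<open>N\<close> satisfy a
  relation: \<open>N\<close> equations in \<open>N + 1\<close> unknowns. This takes the place of a
  characteristic polynomial.\<close>

lemma central_multiple:
  assumes x: "x \<in> Wl m" "x \<noteq> \<zero>"
  obtains y where "y \<in> Wl m" "x \<otimes> y \<in> Zl m" "x \<otimes> y \<noteq> \<zero>"
proof -
  obtain B where B: "finite B" "B \<subseteq> Wl m" "Wl m \<subseteq> adspan (product_set (Zl m) (\<lambda>b. b) B)"
    by (rule Wl_finite_over_Zl)
  have Bc: "b \<in> carrier D" if "b \<in> B" for b using B(2) that by auto
  have xc: "x \<in> carrier D" using x by auto
  let ?N = "card B"
  have "\<exists>c. c \<in> UNIV \<rightarrow> Zl m \<and> x [^] i = (\<Oplus>b\<in>B. c b \<otimes> b)" for i :: nat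
  proof -
    have "x [^] i \<in> adspan (product_set (Zl m) (\<lambda>b. b) B)" using Wl_power[OF x(1)] B(3) by blast
    then obtain c where "c \<in> UNIV \<rightarrow> Zl m" "x [^] i = (\<Oplus>b\<in>B. c b \<otimes> b)"
      by (rule adspan_product_set_finite_repr[OF Zl_subgroup _ B(1), rotated]) (use Bc in auto)
    then show ?thesis by (intro exI[of _ c] conjI)
  qed
  then have "\<forall>i::nat. \<exists>c. c \<in> UNIV \<rightarrow> Zl m \<and> x [^] i = (\<Oplus>b\<in>B. c b \<otimes> b)" by (intro allI)
  from choice[OF this] obtain c where
    c': "\<forall>i::nat. c i \<in> UNIV \<rightarrow> Zl m \<and> x [^] i = (\<Oplus>b\<in>B. c i b \<otimes> b)" by (elim exE)
  then have c: "\<And>i. c i \<in> UNIV \<rightarrow> Zl m" "\<And>i::nat. x [^] i = (\<Oplus>b\<in>B. c i b \<otimes> b)"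
    by (simp_all only: simp_thms)
  have cZ: "c i b \<in> Zl m" for i b using c(1)[of i] by auto
  interpret Z: domain "D\<lparr>carrier := Zl m\<rparr>" by (rule Zl_domain)
  obtain k where k: "k \<in> {..?N} \<rightarrow> Zl m" "\<exists>j\<in>{..?N}. k j \<noteq> \<zero>"
    "\<And>b. b \<in> B \<Longrightarrow> (\<Oplus>\<^bsub>D\<lparr>carrier := Zl m\<rparr>\<^esub>i\<in>{..?N}. c i b \<otimes> k i) = \<zero>"
    by (rule Z.homogeneous_system[of B "{..?N}" "\<lambda>b i. c i b"]) (use B(1) cZ in auto)
  have kc: "k i \<in> carrier D" if "i \<le> ?N" for i using k(1) that by auto
  have cc: "c i b \<in> carrier D" for i b using cZ by auto
  have kk: "(\<Oplus>i\<in>{..?N}. c i b \<otimes> k i) = \<zero>" if "b \<in> B" for b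
    using k(3)[OF that] finsum_consistent[OF Zl_subring, of "\<lambda>i. c i b \<otimes> k i" "{..?N}" m] k(1) cZ
    by (auto simp: Pi_iff Zl_simps(4))
  have "(\<Oplus>i\<in>{..?N}. k i \<otimes> x [^] i) = (\<Oplus>i\<in>{..?N}. \<Oplus>b\<in>B. c i b \<otimes> k i \<otimes> b)"
  proof (rule finsum_cong')
    fix i assume i: "i \<in> {..?N}"
    have "k i \<otimes> x [^] i = (\<Oplus>b\<in>B. k i \<otimes> (c i b \<otimes> b))" unfolding c(2)
      by (rule finsum_rdistr) (use B(1) Bc cc kc i in auto)
    also have "\<dots> = (\<Oplus>b\<in>B. c i b \<otimes> k i \<otimes> b)"
    proof (rule finsum_cong')
      fix b assume b: "b \<in> B"
      have "k i \<otimes> c i b = c i b \<otimes> k i" using k(1) i cZ by (auto intro!: Zl_commutes[of _ m] Zl_Wl)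
      then show "k i \<otimes> (c i b \<otimes> b) = c i b \<otimes> k i \<otimes> b"
        using b i Bc cc kc by (simp add: m_assoc[symmetric])
    qed (use Bc cc kc i in auto)
    finally show "k i \<otimes> x [^] i = (\<Oplus>b\<in>B. c i b \<otimes> k i \<otimes> b)" .
  qed (use Bc cc kc in \<open>auto intro!: finsum_closed\<close>)
  also have "\<dots> = (\<Oplus>b\<in>B. \<Oplus>i\<in>{..?N}. c i b \<otimes> k i \<otimes> b)"
    by (rule finsum_swap) (use B(1) Bc cc kc in auto)
  also have "\<dots> = (\<Oplus>b\<in>B. \<zero>)"
  proof (rule finsum_cong')
    fix b assume b: "b \<in> B"
    have "(\<Oplus>i\<in>{..?N}. c i b \<otimes> k i \<otimes> b) = (\<Oplus>i\<in>{..?N}. c i b \<otimes> k i) \<otimes> b"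
      by (rule finsum_ldistr[symmetric]) (use b Bc cc kc in auto)
    then show "(\<Oplus>i\<in>{..?N}. c i b \<otimes> k i \<otimes> b) = \<zero>" using kk[OF b] Bc[OF b] by simp
  qed auto
  finally have e: "(\<Oplus>i\<in>{..?N}. k i \<otimes> x [^] i) = \<zero>" by (simp add: finsum_zero)
  \<comment> \<open>The solution is controlled only for exponents up to \<open>card B\<close>; zero
    beyond them makes it a total family in \<open>Zl m\<close>.\<close>
  let ?k = "\<lambda>i. if i \<le> ?N then k i else \<zero>"
  have "\<exists>y\<in>Wl m. x \<otimes> y \<in> Zl m \<and> x \<otimes> y \<noteq> \<zero>"
  proof (rule central_multiple_of_root[OF x, of ?k ?N])
    show "?k \<in> UNIV \<rightarrow> Zl m" using k(1) Zl_simps(1) by auto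
    have "(\<Oplus>i\<in>{..?N}. ?k i \<otimes> x [^] i) = (\<Oplus>i\<in>{..?N}. k i \<otimes> x [^] i)"
      by (rule finsum_cong') (use kc xc in auto)
    then show "(\<Oplus>i\<in>{..?N}. ?k i \<otimes> x [^] i) = \<zero>" using e by simp
  qed (use k(2) in auto)
  then show ?thesis using that by blast
qed

end

section \<open>Central localizations of the layers\<close>

context twisted_tower
begin

text \<open>The localization of \<open>L_m#G\<close> at the nonzero elements of its centre. Since
  denominators are central, fractions add and multiply as over a commutative ring.\<close>

definition Dl :: "nat \<Rightarrow> 'd set"
  where "Dl m = {w \<otimes> inv z | w z. w \<in> Wl m \<and> z \<in> Zl m \<and> z \<noteq> \<zero>}"

lemma DlI: "w \<in> Wl m \<Longrightarrow> z \<in> Zl m \<Longrightarrow> z \<noteq> \<zero> \<Longrightarrow> w \<otimes> inv z \<in> Dl m"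
  unfolding Dl_def by auto

lemma DlE:
  assumes "x \<in> Dl m" obtains w z where "w \<in> Wl m" "z \<in> Zl m" "z \<noteq> \<zero>" "x = w \<otimes> inv z"
  using assms unfolding Dl_def by auto

lemma Dl_carrier: "Dl m \<subseteq> carrier D"
  unfolding Dl_def by auto

lemma Zl_inv_commutes: "z \<in> Zl m \<Longrightarrow> z \<noteq> \<zero> \<Longrightarrow> w \<in> Wl m \<Longrightarrow> inv z \<otimes> w = w \<otimes> inv z"
  by (rule dinv_commute) (auto intro: Zl_commutes)

lemma Zl_centralizes_Dl: "z \<in> Zl m \<Longrightarrow> z \<in> centralizer (Dl m)"
proof -
  assume z: "z \<in> Zl m"
  have "z \<otimes> x = x \<otimes> z" if x: "x \<in> Dl m" for x
  proof -
    obtain w y where wy: "w \<in> Wl m" "y \<in> Zl m" "y \<noteq> \<zero>" "x = w \<otimes> inv y" using x by (rule DlE)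
    have c: "z \<in> carrier D" "w \<in> carrier D" "inv y \<in> carrier D" using z wy by auto
    have "z \<otimes> x = w \<otimes> (z \<otimes> inv y)"
      unfolding wy(4) using Zl_commutes[OF z wy(1)] c by (simp add: m_assoc[symmetric])
    also have "z \<otimes> inv y = inv y \<otimes> z" using Zl_inv_commutes[OF wy(2,3) Zl_Wl[OF z]] by simp
    finally show ?thesis unfolding wy(4) using c by (simp add: m_assoc)
  qed
  then show ?thesis using z by (auto simp: centralizer_def)
qed

lemma Zl_inv_centralizes_Dl:
  assumes "z \<in> Zl m" "z \<noteq> \<zero>" shows "inv z \<in> centralizer (Dl m)"
  using Zl_centralizes_Dl[OF assms(1)] Dl_carrier assms
  by (auto simp: centralizer_def subset_iff intro!: dinv_commute)

lemma Zl_nonzero_mult: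
  "z \<in> Zl m \<Longrightarrow> z \<noteq> \<zero> \<Longrightarrow> y \<in> Zl m \<Longrightarrow> y \<noteq> \<zero> \<Longrightarrow> z \<otimes> y \<in> Zl m \<and> z \<otimes> y \<noteq> \<zero>"
  using no_zero_divisors[of z y] by (auto intro: Zl_simps)

lemma Wl_Dl: "w \<in> Wl m \<Longrightarrow> w \<in> Dl m"
proof -
  assume w: "w \<in> Wl m"
  have "w \<otimes> inv \<one> \<in> Dl m" by (rule DlI[OF w]) (auto intro: Zl_simps)
  then show ?thesis using w by simp
qed

lemma Dl_mult:
  assumes "x \<in> Dl m" "y \<in> Dl m" shows "x \<otimes> y \<in> Dl m"
proof -
  obtain w z where x: "w \<in> Wl m" "z \<in> Zl m" "z \<noteq> \<zero>" "x = w \<otimes> inv z" using assms(1) by (rule DlE)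
  obtain v t where y: "v \<in> Wl m" "t \<in> Zl m" "t \<noteq> \<zero>" "y = v \<otimes> inv t" using assms(2) by (rule DlE)
  have c: "w \<in> carrier D" "v \<in> carrier D" "z \<in> carrier D" "t \<in> carrier D" using x y by auto
  have c': "inv z \<in> carrier D" "inv t \<in> carrier D" using c x y by auto
  have "x \<otimes> y = w \<otimes> (inv z \<otimes> v) \<otimes> inv t" unfolding x(4) y(4) using c c' by (simp add: m_assoc)
  also have "\<dots> = (w \<otimes> v) \<otimes> inv (t \<otimes> z)"
    unfolding Zl_inv_commutes[OF x(2,3) y(1)] dinv_mult[OF c(4,3) y(3) x(3)]
    using c c' Zl_inv_commutes[OF x(2,3) Zl_Wl[OF y(2)]] by (simp add: m_assoc)
  also have "\<dots> \<in> Dl m"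
    by (rule DlI) (use x y Zl_nonzero_mult[of t m z] in \<open>auto intro: Wl_simps\<close>)
  finally show ?thesis .
qed

lemma Dl_add:
  assumes "x \<in> Dl m" "y \<in> Dl m" shows "x \<oplus> y \<in> Dl m"
proof -
  obtain w z where x: "w \<in> Wl m" "z \<in> Zl m" "z \<noteq> \<zero>" "x = w \<otimes> inv z" using assms(1) by (rule DlE)
  obtain v t where y: "v \<in> Wl m" "t \<in> Zl m" "t \<noteq> \<zero>" "y = v \<otimes> inv t" using assms(2) by (rule DlE)
  have c: "w \<in> carrier D" "v \<in> carrier D" "z \<in> carrier D" "t \<in> carrier D" using x y by auto
  have c': "inv z \<in> carrier D" "inv t \<in> carrier D" using c x y by auto
  have zt: "z \<otimes> t = t \<otimes> z" using Zl_commutes[OF x(2) Zl_Wl[OF y(2)]] .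
  have "x = w \<otimes> (t \<otimes> inv t) \<otimes> inv z" using c c' x y by simp
  then have 1: "x = (w \<otimes> t) \<otimes> inv (z \<otimes> t)"
    unfolding dinv_mult[OF c(3,4) x(3) y(3)] using c c' by (simp add: m_assoc del: dinv_r)
  have "y = v \<otimes> (z \<otimes> inv z) \<otimes> inv t" using c c' x y by simp
  then have 2: "y = (v \<otimes> z) \<otimes> inv (z \<otimes> t)"
    unfolding zt dinv_mult[OF c(4,3) y(3) x(3)] using c c' by (simp add: m_assoc del: dinv_r)
  have nz: "z \<otimes> t \<in> Zl m" "z \<otimes> t \<noteq> \<zero>" using Zl_nonzero_mult[OF x(2,3) y(2,3)] by auto
  have "x \<oplus> y = (w \<otimes> t \<oplus> v \<otimes> z) \<otimes> inv (z \<otimes> t)"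
    by (subst 1, subst 2) (use c nz in \<open>simp add: l_distr\<close>)
  also have "\<dots> \<in> Dl m"
    by (rule DlI[OF _ nz]) (use x y in \<open>auto intro: Wl_simps(4,5) Zl_Wl\<close>)
  finally show ?thesis .
qed

lemma Dl_subring: "subring (Dl m) D"
proof (rule subringI)
  show "\<ominus> x \<in> Dl m" if "x \<in> Dl m" for x
  proof -
    have "\<ominus> \<one> \<otimes> x \<in> Dl m" by (rule Dl_mult[OF Wl_Dl that]) (auto intro: Wl_simps)
    moreover have "x \<in> carrier D" using that Dl_carrier by blast
    ultimately show ?thesis by (simp add: l_minus)
  qed
qed (use Dl_carrier Dl_mult Dl_add in \<open>auto intro: Wl_Dl Wl_simps\<close>)

lemma W_in_Wl:
  assumes "x \<in> tw P (carrier G)" obtains m where "x \<in> Wl m"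
proof -
  have "\<exists>m. x \<in> Wl m"
    using assms tw_base[OF order_refl order_refl] unfolding tw_def
  proof (induction rule: adspan_induct)
    case zero
    then show ?case using Wl_simps(2) by auto
  next
    case (incl b)
    then obtain c g where cg: "c \<in> P" "g \<in> carrier G" "b = c \<otimes> u g" by (auto simp: product_set_def)
    then obtain m where "c \<in> L m" using P_eq by auto
    then have "b \<in> Wl m" using cg by (auto intro: Wl_simps(5) L_in_Wl u_in_Wl)
    then show ?case by auto
  next
    case (add x y)
    then obtain i j where "x \<in> Wl i" "y \<in> Wl j" by auto
    then have "x \<in> Wl (max i j)" "y \<in> Wl (max i j)"
      using Wl_mono[of i "max i j"] Wl_mono[of j "max i j"] by auto
    then show ?case using Wl_simps(4) by blast
  next
    case (neg x)
    then show ?case using Wl_simps(6) by blast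
  qed
  then show ?thesis using that by blast
qed

text \<open>If \<open>x \<otimes> y\<close> is central and nonzero, the fraction of \<open>y\<close>
  by \<open>x \<otimes> y\<close> is the inverse of \<open>x\<close>.\<close>

lemma Wl_inverse_in_Dl:
  assumes x: "x \<in> Wl m" "x \<noteq> \<zero>" shows "inv x \<in> Dl m"
proof -
  obtain y where y: "y \<in> Wl m" "x \<otimes> y \<in> Zl m" "x \<otimes> y \<noteq> \<zero>" using central_multiple[OF x] .
  let ?z = "x \<otimes> y"
  have c: "x \<in> carrier D" "y \<in> carrier D" "inv ?z \<in> carrier D" "inv x \<in> carrier D"
    using x y by auto
  have "inv x = inv x \<otimes> (?z \<otimes> inv ?z)" using y c by simp
  also have "\<dots> = inv x \<otimes> x \<otimes> y \<otimes> inv ?z" using c by (simp add: m_assoc del: dinv_r dinv_l)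
  also have "\<dots> = y \<otimes> inv ?z" using c x by simp
  also have "\<dots> \<in> Dl m" by (rule DlI[OF y])
  finally show ?thesis .
qed

text \<open>Stated for all large \<open>i\<close> because an inclusion between successive
  \<open>Dl m\<close> is not visible from the definition, a central denominator of one layer need
  not be central in the next. Instead numerator and denominator are viewed in the larger
  \<open>Wl i\<close>, and the inverse is formed there anew.\<close>

lemma carrier_in_Dl:
  assumes "x \<in> carrier D" obtains m where "\<And>i. m \<le> i \<Longrightarrow> x \<in> Dl i"
proof -
  obtain a t where at: "a \<in> tw P (carrier G)" "t \<in> tw P (carrier G)" "t \<noteq> \<zero>" "x = a \<otimes> inv t"
    using right_fraction[OF assms] unfolding tw_def by auto
  obtain i where i: "a \<in> Wl i" using at(1) by (rule W_in_Wl)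
  obtain j where j: "t \<in> Wl j" using at(2) by (rule W_in_Wl)
  have "x \<in> Dl k" if k: "max i j \<le> k" for k
  proof -
    have "a \<in> Wl k" "t \<in> Wl k" using i j k Wl_mono[of i k] Wl_mono[of j k] by auto
    then show ?thesis unfolding at(4) using at(3) by (intro Dl_mult Wl_Dl Wl_inverse_in_Dl)
  qed
  then show ?thesis using that by blast
qed

lemma finite_in_Dl:
  assumes "finite X" "X \<subseteq> carrier D" obtains m where "X \<subseteq> Dl m"
proof -
  have "\<exists>m. \<forall>i\<ge>m. X \<subseteq> Dl i"
    using assms
  proof (induction X)
    case (insert x X)
    then obtain m where m: "\<forall>i\<ge>m. X \<subseteq> Dl i" by auto
    obtain l where l: "\<And>i. l \<le> i \<Longrightarrow> x \<in> Dl i" using carrier_in_Dl[of x] insert.prems by auto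
    show ?case by (rule exI[of _ "max m l"]) (use m l in auto)
  qed auto
  then show ?thesis using that by blast
qed

text \<open>Finitely many elements lie in one \<open>Dl m\<close>. The generators \<open>B\<close>
  of \<open>Wl m\<close> over its centre also generate \<open>Dl m\<close>: dividing by a central
  \<open>z\<close> only changes the coefficients \<open>c b\<close> to
  \<open>inv z \<otimes> c b\<close>.\<close>

theorem locally_PI: "locally_PI_algebra D F"
  unfolding locally_PI_algebra_def
proof (intro allI impI)
  fix U assume U: "finite U \<and> U \<subseteq> carrier D"
  then obtain m where m: "U \<subseteq> Dl m" using finite_in_Dl by blast
  let ?E = "generate_ring D (F \<union> U)"
  have Fc: "F \<subseteq> carrier D" using F_P by auto
  have FD: "F \<subseteq> Dl m" using F_Zl Zl_Wl Wl_Dl by blast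
  obtain B where B: "finite B" "B \<subseteq> Wl m" "Wl m \<subseteq> adspan (product_set (Zl m) (\<lambda>b. b) B)"
    by (rule Wl_finite_over_Zl)
  \<comment> \<open>This centralizer contains \<open>Zl m\<close> as well as the inverses of its
    nonzero elements, so it can supply all the coefficients.\<close>
  define Q where "Q = centralizer (Dl m)"
  have Qr: "subring Q D" unfolding Q_def by (rule centralizer_subring[OF Dl_carrier])
  note Fr = subringE[OF subfieldE(1)[OF F]]
  show "PI_algebra (D\<lparr>carrier := ?E\<rparr>) F"
  proof (rule PI_algebra_of_finite_over_centre[where B = B and X = "Dl m" and Q = Q])
    show "subring ?E D" by (rule generate_ring_is_subring) (use Fc U in auto)
    show "F \<subseteq> ?E" by (auto intro: generate_ring.incl)
    show "?E \<subseteq> Dl m" by (rule generate_ring_min_subring1) (use Fc U m FD Dl_subring in auto)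
    show "finite B" "B \<subseteq> Dl m" using B Wl_Dl by auto
    fix x assume "x \<in> Dl m"
    then obtain w z where x: "w \<in> Wl m" "z \<in> Zl m" "z \<noteq> \<zero>" "x = w \<otimes> inv z" by (rule DlE)
    have "w \<in> adspan (product_set (Zl m) (\<lambda>b. b) B)" using x(1) B(3) by auto
    then obtain c where c: "c \<in> UNIV \<rightarrow> Zl m" "w = (\<Oplus>b\<in>B. c b \<otimes> b)"
      by (rule adspan_product_set_finite_repr[OF Zl_subgroup _ B(1), rotated]) (use B(2) in auto)
    have cc: "c b \<in> carrier D" "c b \<in> Q" for b
      using c(1) Zl_centralizes_Dl by (auto simp: Q_def)
    have zc: "inv z \<in> carrier D" "inv z \<in> Q" using x Zl_inv_centralizes_Dl by (auto simp: Q_def)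
    have Bc: "b \<in> carrier D" if "b \<in> B" for b using B(2) that by auto
    have "x = inv z \<otimes> w" unfolding x(4) using Zl_inv_commutes[OF x(2,3,1)] by simp
    also have "\<dots> = (\<Oplus>b\<in>B. inv z \<otimes> (c b \<otimes> b))" unfolding c(2)
      by (rule finsum_rdistr) (use B(1) zc cc Bc in auto)
    also have "\<dots> = (\<Oplus>b\<in>B. (inv z \<otimes> c b) \<otimes> b)"
      by (rule finsum_cong') (use zc cc Bc in \<open>auto simp: m_assoc\<close>)
    finally show "\<exists>q\<in>B \<rightarrow> Q. x = (\<Oplus>b\<in>B. q b \<otimes> b)"
      using subringE(6)[OF Qr zc(2) cc(2)] by (intro bexI[of _ "\<lambda>b. inv z \<otimes> c b"]) auto
  qed (use Dl_carrier Fr in \<open>auto simp: Q_def\<close>)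
qed

text \<open>Centralizing \<open>P\<close> already puts a central element into \<open>P\<close>,
  where commuting with the single \<open>u g\<close> is decisive. Conversely \<open>F\<close> is
  central in every layer, hence in every localization, and these exhaust \<open>D\<close>.\<close>

theorem center_eq:
  assumes g: "g \<in> carrier G" and fixed: "\<And>x. x \<in> P \<Longrightarrow> u g \<otimes> x = x \<otimes> u g \<Longrightarrow> x \<in> F"
  shows "ring_center D = F"
proof (intro equalityI subsetI)
  fix x assume x: "x \<in> ring_center D"
  then have xc: "x \<in> carrier D" and comm: "\<And>y. y \<in> carrier D \<Longrightarrow> x \<otimes> y = y \<otimes> x"
    by (auto simp: ring_center_def)
  have "x \<in> P" by (rule centralizer_of_P[OF xc]) (use comm in simp)
  then show "x \<in> F" by (rule fixed) (use comm[of "u g"] g in simp)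
next
  fix x assume x: "x \<in> F"
  have "x \<otimes> y = y \<otimes> x" if y: "y \<in> carrier D" for y
  proof -
    obtain m where "\<And>i. m \<le> i \<Longrightarrow> y \<in> Dl i" using carrier_in_Dl[OF y] by auto
    then have "y \<in> Dl m" by simp
    then show ?thesis using Zl_centralizes_Dl[OF F_Zl[OF x]] by (auto simp: centralizer_def)
  qed
  then show "x \<in> ring_center D" using x F_P by (auto simp: ring_center_def)
qed

text \<open>Once the finite set lies in a single \<open>Dl m\<close>, the denominators belong to one
  commutative ring and can simply be multiplied.\<close>

lemma common_denominator:
  assumes "finite X" "X \<subseteq> carrier D"
  obtains m z where "z \<in> Zl m" "z \<noteq> \<zero>" "\<And>x. x \<in> X \<Longrightarrow> x \<otimes> z \<in> Wl m"
proof -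
  obtain m where m: "X \<subseteq> Dl m" using finite_in_Dl[OF assms] .
  have "\<exists>z. z \<in> Zl m \<and> z \<noteq> \<zero> \<and> (\<forall>x\<in>X. x \<otimes> z \<in> Wl m)"
    using assms(1) m
  proof (induction X)
    case empty
    then show ?case using Zl_simps(2) by (intro exI[of _ \<one>]) auto
  next
    case (insert x X)
    then obtain z where z: "z \<in> Zl m" "z \<noteq> \<zero>" "\<forall>x\<in>X. x \<otimes> z \<in> Wl m" by auto
    have "x \<in> Dl m" using insert by auto
    then obtain w t where x: "w \<in> Wl m" "t \<in> Zl m" "t \<noteq> \<zero>" "x = w \<otimes> inv t" by (rule DlE)
    have c: "w \<in> carrier D" "t \<in> carrier D" "z \<in> carrier D" "inv t \<in> carrier D" using x z by auto
    have "x \<otimes> (t \<otimes> z) = w \<otimes> (inv t \<otimes> t) \<otimes> z" unfolding x(4) using c by (simp add: m_assoc del: dinv_l)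
    also have "\<dots> \<in> Wl m" using c x z by (auto intro: Wl_simps(5) Zl_Wl)
    finally have "x \<otimes> (t \<otimes> z) \<in> Wl m" .
    moreover have "y \<otimes> (t \<otimes> z) \<in> Wl m" if y: "y \<in> X" for y
    proof -
      have yc: "y \<in> carrier D" using insert.prems y Dl_carrier by auto
      have "y \<otimes> (t \<otimes> z) = y \<otimes> (z \<otimes> t)" using Zl_commutes[OF x(2) Zl_Wl[OF z(1)]] by simp
      also have "\<dots> = (y \<otimes> z) \<otimes> t" using yc c by (simp add: m_assoc)
      also have "\<dots> \<in> Wl m" using y z(3) x(2) by (auto intro: Wl_simps(5) Zl_Wl)
      finally show ?thesis .
    qed
    ultimately show ?case using Zl_nonzero_mult[OF x(2,3) z(1,2)] by (intro exI[of _ "t \<otimes> z"]) auto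
  qed
  then show ?thesis using that by blast
qed

end

section \<open>Growth\<close>

lemma ln_quotient_tendsto: "(\<lambda>k. ereal (C / ln (real k) + c)) \<longlonglongrightarrow> ereal c"
proof -
  have "filterlim (\<lambda>k. ln (real k)) at_top sequentially"
    by (rule filterlim_compose[OF ln_at_top filterlim_real_sequentially])
  then have "(\<lambda>k. C / ln (real k)) \<longlonglongrightarrow> 0"
    by (intro tendsto_divide_0[OF tendsto_const] filterlim_at_top_imp_at_infinity)
  then have "(\<lambda>k. C / ln (real k) + c) \<longlonglongrightarrow> 0 + c" by (intro tendsto_add tendsto_const)
  then show ?thesis by simp
qed

lemma limsup_log_growth_le:
  fixes a :: "nat \<Rightarrow> nat"
  assumes a: "\<And>k. a k \<le> d * (2 * (r * k) + 1) ^ n"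
  shows "limsup (\<lambda>k. ereal (ln (real (a k)) / ln (real k))) \<le> ereal (real n)"
proof -
  \<comment> \<open>The factor \<open>2 * r + 1\<close> comes from
    \<open>2 * (r * k) + 1 \<le> (2 * r + 1) * k\<close> for positive \<open>k\<close>. Taking
    \<open>d + 1\<close> instead of \<open>d\<close> makes \<open>C\<close> nonnegative also for
    \<open>d = 0\<close>, which the case \<open>a k = 0\<close> relies on, where the logarithm takes
    the value 0.\<close>
  define C where "C = ln (real (d + 1)) + real n * ln (real (2 * r + 1))"
  have C0: "C \<ge> 0" unfolding C_def by (intro add_nonneg_nonneg mult_nonneg_nonneg ln_ge_zero) auto
  have "ln (real (a k)) / ln (real k) \<le> C / ln (real k) + real n" if k: "k \<ge> 2" for k
  proof -
    have lk: "ln (real k) > 0" using k by simp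
    have "ln (real (a k)) \<le> C + real n * ln (real k)"
    proof (cases "a k = 0")
      case True
      then show ?thesis using C0 lk by simp
    next
      case False
      have "2 * (r * k) + 1 \<le> (2 * r + 1) * k" using k by (simp add: algebra_simps)
      then have "d * (2 * (r * k) + 1) ^ n \<le> (d + 1) * ((2 * r + 1) * k) ^ n"
        by (intro mult_le_mono power_mono) auto
      then have "a k \<le> (d + 1) * ((2 * r + 1) * k) ^ n" using a[of k] by linarith
      then have "real (a k) \<le> real ((d + 1) * ((2 * r + 1) * k) ^ n)" by (rule of_nat_mono)
      then have "ln (real (a k)) \<le> ln (real ((d + 1) * ((2 * r + 1) * k) ^ n))"
        using False k by (subst ln_le_cancel_iff) auto
      also have "\<dots> = ln (real (d + 1)) + real n * (ln (real (2 * r + 1)) + ln (real k))"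
      proof -
        have p: "real (d + 1) > 0" "real (2 * r + 1) > 0" "real k > 0" using k by auto
        have "ln (real ((d + 1) * ((2 * r + 1) * k) ^ n))
          = ln (real (d + 1) * (real (2 * r + 1) * real k) ^ n)" by (simp only: of_nat_mult of_nat_power)
        also have "\<dots> = ln (real (d + 1)) + ln ((real (2 * r + 1) * real k) ^ n)"
          by (rule ln_mult_pos) (use p in auto)
        also have "ln ((real (2 * r + 1) * real k) ^ n) = real n * ln (real (2 * r + 1) * real k)"
          by (rule ln_realpow)
        also have "ln (real (2 * r + 1) * real k) = ln (real (2 * r + 1)) + ln (real k)"
          by (rule ln_mult_pos) (use p in auto)
        finally show ?thesis .
      qed
      finally show ?thesis by (simp add: C_def algebra_simps)
    qed
    then show ?thesis using lk by (simp add: field_simps)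
  qed
  then have "\<forall>\<^sub>F k in sequentially. ereal (ln (real (a k)) / ln (real k)) \<le> ereal (C / ln (real k) + real n)"
    by (intro eventually_sequentiallyI[of 2]) simp
  then have "limsup (\<lambda>k. ereal (ln (real (a k)) / ln (real k))) \<le> limsup (\<lambda>k. ereal (C / ln (real k) + real n))"
    by (rule Limsup_mono)
  also have "\<dots> = ereal (real n)"
    by (rule lim_imp_Limsup[OF _ ln_quotient_tendsto]) simp
  finally show ?thesis .
qed

lemma limsup_log_growth_ge:
  fixes a :: "nat \<Rightarrow> nat"
  assumes a: "\<And>k. (k div n + 1) ^ n \<le> a k" and n: "n \<ge> 1"
  shows "ereal (real n) \<le> limsup (\<lambda>k. ereal (ln (real (a k)) / ln (real k)))"
proof -
  \<comment> \<open>From \<open>k / n \<le> k div n + 1\<close> follows a lower bound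
    \<open>n * ln k - n * ln n\<close> for \<open>ln (a k)\<close>; the second summand is this
    constant.\<close>
  define C where "C = - (real n * ln (real n))"
  have "C / ln (real k) + real n \<le> ln (real (a k)) / ln (real k)" if k: "k \<ge> 2" for k
  proof -
    have lk: "ln (real k) > 0" using k by simp
    have "k < n * (k div n + 1)" using n dividend_less_times_div[of n k] by simp
    then have "real k \<le> real n * real (k div n + 1)" by (metis less_imp_le of_nat_le_iff of_nat_mult)
    then have "real k / real n \<le> real (k div n + 1)" using n by (simp add: field_simps)
    then have "(real k / real n) ^ n \<le> real (k div n + 1) ^ n" using k n by (intro power_mono) auto
    also have "\<dots> = real ((k div n + 1) ^ n)" by (simp only: of_nat_power)
    also have "\<dots> \<le> real (a k)" using a[of k] by (rule of_nat_mono)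
    finally have le: "(real k / real n) ^ n \<le> real (a k)" .
    have pos: "(real k / real n) ^ n > 0" using k n by auto
    have "real n * (ln (real k) - ln (real n)) = ln ((real k / real n) ^ n)"
      using k n by (subst ln_realpow) (auto simp: ln_div)
    also have "\<dots> \<le> ln (real (a k))" using le pos by (subst ln_le_cancel_iff) auto
    finally have "C + real n * ln (real k) \<le> ln (real (a k))" by (simp add: C_def algebra_simps)
    then have "(C + real n * ln (real k)) / ln (real k) \<le> ln (real (a k)) / ln (real k)"
      by (rule divide_right_mono) (use lk in simp)
    then show ?thesis using lk by (simp add: add_divide_distrib)
  qed
  then have ev: "\<forall>\<^sub>F k in sequentially. ereal (C / ln (real k) + real n) \<le> ereal (ln (real (a k)) / ln (real k))"
    by (intro eventually_sequentiallyI[of 2]) simp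
  have "ereal (real n) = limsup (\<lambda>k. ereal (C / ln (real k) + real n))"
    by (rule lim_imp_Limsup[OF _ ln_quotient_tendsto, symmetric]) simp
  also have "\<dots> \<le> limsup (\<lambda>k. ereal (ln (real (a k)) / ln (real k)))" by (rule Limsup_mono[OF ev])
  finally show ?thesis .
qed

section \<open>Dimension bounds and linear spans\<close>

context ring
begin

lemma Span_basis_length:
  assumes K: "subfield K R" and "set us \<subseteq> carrier R"
  shows "\<exists>vs. independent K vs \<and> Span K vs = Span K us \<and> length vs \<le> length us"
  using assms(2)
proof (induction us)
  case (Cons x us)
  then obtain vs where vs: "independent K vs" "Span K vs = Span K us" "length vs \<le> length us" by auto
  have x: "x \<in> carrier R" "set us \<subseteq> carrier R" using Cons.prems by auto
  show ?case
  proof (cases "x \<in> Span K us")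
    case True
    have "Span K (x # us) \<subseteq> Span K us"
      by (rule mono_Span_subset[OF K]) (use True x Span_base_incl[OF K x(2)] in auto)
    then have "Span K (x # us) = Span K us" using mono_Span[OF K x(2,1)] by auto
    then show ?thesis using vs by auto
  next
    case False
    then have "independent K (x # vs)" using vs x by (intro li_Cons) auto
    moreover have "Span K (x # vs) = Span K (x # us)" using vs(2) by simp
    ultimately show ?thesis using vs(3) by (intro exI[of _ "x # vs"]) simp
  qed
qed (auto intro!: exI[of _ "[]"])

text \<open>A spanning list is thinned to a basis of its span. Finite dimension is concluded along
  with the bound because \<open>dim\<close> carries information only then.\<close>

lemma dim_le_length:
  assumes K: "subfield K R" and E: "subalgebra K E R" "E \<subseteq> Span K us" and us: "set us \<subseteq> carrier R"
  shows "finite_dimension K E" "dim K E \<le> length us"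
proof -
  show fd: "finite_dimension K E"
    by (rule subalbegra_incl_imp_finite_dimension[OF K Span_finite_dimension[OF K us] E])
  have "dimension (dim K E) K E" using finite_dimensionE[OF K fd] by (simp add: over_def)
  then obtain es where es: "independent K es" "length es = dim K E" "Span K es = E" "set es \<subseteq> carrier R"
    using exists_base[OF K] by blast
  obtain vs where vs: "independent K vs" "Span K vs = Span K us" "length vs \<le> length us"
    using Span_basis_length[OF K us] by blast
  have "set es \<subseteq> Span K vs" using Span_base_incl[OF K es(4)] es(3) E(2) vs(2) by auto
  then have "length es \<le> length vs" by (rule independent_length_le[OF K es(1) vs(1)])
  then show "dim K E \<le> length us" using es(2) vs(3) by simp
qed

lemma independent_length_le_dim:
  assumes K: "subfield K R" and E: "finite_dimension K E" and us: "independent K us" "set us \<subseteq> E"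
  shows "length us \<le> dim K E"
  using independent_length_le_dimension[OF K _ us] finite_dimensionE[OF K E] by (simp add: over_def)

lemma linear_span_subalgebra:
  assumes K: "subfield K R" and S: "S \<subseteq> carrier R"
  shows "subalgebra K (linear_span R K S) R"
proof -
  have sc: "set us \<subseteq> carrier R" if "us \<in> lists S" for us using that S by auto
  have "subgroup (linear_span R K S) (add_monoid R)"
  proof (rule add_subgroupI)
    show "linear_span R K S \<subseteq> carrier R"
      unfolding linear_span_def using Span_subgroup_props(1)[OF K sc] by blast
    show "\<zero> \<in> linear_span R K S"
      unfolding linear_span_def using Span_subgroup_props(2)[OF K, of "[]"] by (intro UN_I[of "[]"]) auto
    show "\<ominus> x \<in> linear_span R K S" if "x \<in> linear_span R K S" for x
      using that Span_subgroup_props(4)[OF K sc] unfolding linear_span_def by blast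
    fix x y assume "x \<in> linear_span R K S" "y \<in> linear_span R K S"
    then obtain us vs where uv: "us \<in> lists S" "x \<in> Span K us" "vs \<in> lists S" "y \<in> Span K vs"
      unfolding linear_span_def by blast
    have "x \<in> Span K (us @ vs)" "y \<in> Span K (us @ vs)"
      using uv mono_Span_append[OF K sc sc, of us vs] mono_Span_append(2)[OF K sc sc, of vs us] by blast+
    moreover have uvl: "us @ vs \<in> lists S" using uv by auto
    ultimately have "x \<oplus> y \<in> Span K (us @ vs)" using Span_subgroup_props(3)[OF K sc[OF uvl]] by blast
    then show "x \<oplus> y \<in> linear_span R K S" using uvl unfolding linear_span_def by blast
  qed
  moreover have "k \<otimes> v \<in> linear_span R K S" if "k \<in> K" "v \<in> linear_span R K S" for k v
    using that Span_smult_closed[OF K sc] unfolding linear_span_def by blast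
  ultimately show ?thesis by (intro subalgebra.intro subalgebra_axioms.intro)
qed

lemma linear_span_min:
  assumes "subfield K R" "subalgebra K E R" "S \<subseteq> E"
  shows "linear_span R K S \<subseteq> E"
proof -
  have "Span K us \<subseteq> E" if "us \<in> lists S" for us
    by (rule subalgebra_Span_incl[OF assms(1,2)]) (use that assms(3) in auto)
  then show ?thesis unfolding linear_span_def by blast
qed

lemma linear_span_incl:
  assumes "subfield K R" "S \<subseteq> carrier R" "x \<in> S"
  shows "x \<in> linear_span R K S"
proof -
  have "x \<in> Span K [x]" using Span_base_incl[OF assms(1), of "[x]"] assms by auto
  then show ?thesis unfolding linear_span_def using assms(3) by (intro UN_I[of "[x]"]) auto
qed

end

section \<open>The box filtration and the Gelfand-Kirillov dimension\<close>

context twisted_tower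
begin

text \<open>Balls of \<open>G\<close> for the maximum norm of the exponents: radii add under
  multiplication, and the size is bounded by a polynomial of degree \<open>n\<close> in the
  radius.\<close>

definition box :: "nat \<Rightarrow> 'g set"
  where "box r = gexp ` ({1..n} \<rightarrow>\<^sub>E {- int r..int r})"

lemma box_G: "box r \<subseteq> carrier G"
  unfolding box_def by auto

lemma gexp_box: "(\<And>i. i \<in> {1..n} \<Longrightarrow> \<bar>k i\<bar> \<le> int r) \<Longrightarrow> gexp k \<in> box r"
  unfolding box_def
  by (intro image_eqI[of _ _ "restrict k {1..n}"])
    (auto intro!: gexp_cong simp: abs_le_iff minus_le_iff)

lemma box_mult: "g \<in> box r \<Longrightarrow> h \<in> box t \<Longrightarrow> g \<otimes>\<^bsub>G\<^esub> h \<in> box (r + t)"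
proof -
  assume "g \<in> box r" "h \<in> box t"
  then obtain k l where kl: "g = gexp k" "k \<in> {1..n} \<rightarrow>\<^sub>E {- int r..int r}"
      "h = gexp l" "l \<in> {1..n} \<rightarrow>\<^sub>E {- int t..int t}"
    unfolding box_def by auto
  have "gexp (\<lambda>i. k i + l i) \<in> box (r + t)"
  proof (rule gexp_box)
    fix i assume "i \<in> {1..n}"
    then have "k i \<in> {- int r..int r}" "l i \<in> {- int t..int t}" using kl by auto
    then show "\<bar>k i + l i\<bar> \<le> int (r + t)" by auto
  qed
  then show ?thesis by (simp add: gexp_add kl)
qed

lemma box_mono: "r \<le> t \<Longrightarrow> box r \<subseteq> box t"
  unfolding box_def by (intro image_mono PiE_mono) auto

lemma one_in_box: "\<one>\<^bsub>G\<^esub> \<in> box r"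
  unfolding gexp_zero[symmetric] by (rule gexp_box) simp

lemma finite_box: "finite (box r)"
  unfolding box_def by (intro finite_imageI finite_PiE) auto

lemma card_box: "card (box r) \<le> (2 * r + 1) ^ n"
proof -
  have "card {- int r..int r} = 2 * r + 1" unfolding card_atLeastAtMost_int by linarith
  then have c: "card ({1..n} \<rightarrow>\<^sub>E {- int r..int r}) = (2 * r + 1) ^ n" by (simp add: card_PiE)
  have "card (box r) \<le> card ({1..n} \<rightarrow>\<^sub>E {- int r..int r})"
    unfolding box_def by (intro card_image_le finite_PiE) auto
  also note c
  finally show ?thesis .
qed

lemma in_some_box: "g \<in> carrier G \<Longrightarrow> \<exists>r. g \<in> box r"
proof -
  assume "g \<in> carrier G"
  then obtain k where k: "g = gexp k" by (rule gexp_surj)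
  let ?r = "\<Sum>i\<in>{1..n}. nat \<bar>k i\<bar>"
  have "gexp k \<in> box ?r"
  proof (rule gexp_box)
    fix i assume "i \<in> {1..n}"
    then have "nat \<bar>k i\<bar> \<le> ?r" by (intro member_le_sum) auto
    then show "\<bar>k i\<bar> \<le> int ?r" by linarith
  qed
  then show ?thesis unfolding k by blast
qed

definition Wbox :: "nat \<Rightarrow> nat \<Rightarrow> 'd set" where "Wbox m r = tw (L m) (box r)"

lemma Wbox_mono: "r \<le> t \<Longrightarrow> Wbox m r \<subseteq> Wbox m t"
  unfolding Wbox_def by (intro tw_mono box_mono order_refl)

lemma Wbox_Wl: "Wbox m r \<subseteq> Wl m"
  unfolding Wbox_def Wl_def by (intro tw_mono box_G order_refl)

lemma Wbox_add: "x \<in> Wbox m r \<Longrightarrow> y \<in> Wbox m r \<Longrightarrow> x \<oplus> y \<in> Wbox m r"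
  unfolding Wbox_def by (rule tw_add)

lemma Wbox_neg: "x \<in> Wbox m r \<Longrightarrow> \<ominus> x \<in> Wbox m r"
  unfolding Wbox_def by (rule tw_neg[OF L_P box_G])

text \<open>The action keeps coefficients in \<open>L m\<close>, so a product enlarges only the
  support; the growth of a layer is that of \<open>G\<close>.\<close>

lemma Wbox_mult: "x \<in> Wbox m r \<Longrightarrow> y \<in> Wbox m t \<Longrightarrow> x \<otimes> y \<in> Wbox m (r + t)"
  unfolding Wbox_def
  by (rule tw_mult[OF L_P L_P L_P box_G box_G box_G]) (use box_G in \<open>auto intro: L_act box_mult\<close>)

lemma Wbox_scalar: "x \<in> L m \<Longrightarrow> x \<in> Wbox m r"
  unfolding Wbox_def by (rule tw_scalar[OF _ L_P one_in_box])

lemma Wl_in_Wbox: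
  assumes "x \<in> Wl m" shows "\<exists>r. x \<in> Wbox m r"
  using assms[unfolded Wl_def tw_def] tw_base[OF L_P order_refl]
proof (induction rule: adspan_induct)
  case zero
  then show ?case using Wbox_scalar[of \<zero> m] by auto
next
  case (incl b)
  then obtain c g where cg: "c \<in> L m" "g \<in> carrier G" "b = c \<otimes> u g" by (auto simp: product_set_def)
  then show ?case using in_some_box[OF cg(2)] tw_incl[OF cg(1)] unfolding Wbox_def by blast
next
  case (add x y)
  then obtain i j where "x \<in> Wbox m i" "y \<in> Wbox m j" by auto
  then have "x \<in> Wbox m (max i j)" "y \<in> Wbox m (max i j)"
    using Wbox_mono[of i "max i j"] Wbox_mono[of j "max i j"] by auto
  then show ?case using Wbox_add by blast
next
  case (neg x)
  then show ?case using Wbox_neg by blast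
qed

text \<open>\<open>d\<close> is the length of a spanning list of \<open>L m\<close> over
  \<open>F\<close>. It is fixed before \<open>r\<close>, so it affects dimensions only by a constant
  factor.\<close>

lemma Wbox_Span:
  "\<exists>d. \<forall>r. \<exists>us. set us \<subseteq> carrier D \<and> length us \<le> d * (2 * r + 1) ^ n \<and> Wbox m r \<subseteq> Span F us"
proof -
  obtain ls where ls: "set ls \<subseteq> carrier D" "L m = Span F ls" using L_finite by blast
  have "\<exists>us. set us \<subseteq> carrier D \<and> length us \<le> length ls * (2 * r + 1) ^ n \<and> Wbox m r \<subseteq> Span F us" for r
  proof -
    obtain gs where gs: "set gs = box r" "length gs = card (box r)"
      using finite_distinct_list[OF finite_box[of r]] distinct_card by metis
    define us where "us = concat (map (\<lambda>l. map (\<lambda>g. l \<otimes> u g) gs) ls)"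
    have us_set: "set us = (\<Union>l\<in>set ls. (\<lambda>g. l \<otimes> u g) ` box r)" by (auto simp: us_def gs(1))
    have "length us = length ls * card (box r)"
      unfolding us_def length_concat by (simp add: comp_def gs(2) sum_list_triv)
    then have len: "length us \<le> length ls * (2 * r + 1) ^ n" using card_box[of r] by simp
    have usc: "set us \<subseteq> carrier D" using us_set ls(1) box_G[of r] by (auto intro!: m_closed u_closed)
    have LF: "L m = adspan (F <#> set ls)" unfolding ls(2) adspan_def by (rule Span_eq_generate[OF F ls(1)])
    have Fc: "F \<subseteq> carrier D" by (rule subfieldE(3)[OF F])
    have Fls: "F <#> set ls \<subseteq> carrier D" "F <#> set us \<subseteq> carrier D"
      using Fc ls(1) usc by (auto simp: set_mult_def)
    have US: "Span F us = adspan (F <#> set us)" unfolding adspan_def by (rule Span_eq_generate[OF F usc])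
    have "x \<otimes> u g \<in> adspan (F <#> set us)" if x: "x \<in> L m" and g: "g \<in> box r" for x g
    proof (rule adspan_mult[OF Fls(1) _ Fls(2)])
      show "x \<in> adspan (F <#> set ls)" using x LF by simp
      show "u g \<in> adspan {u g}" by (rule adspan_incl) simp
      have ug: "u g \<in> carrier D" using g box_G by auto
      then show "{u g} \<subseteq> carrier D" by auto
      fix a b assume "a \<in> F <#> set ls" "b \<in> {u g}"
      then obtain f l where a: "f \<in> F" "l \<in> set ls" "a = f \<otimes> l" "b = u g" by (auto simp: set_mult_def)
      have "a \<otimes> b = f \<otimes> (l \<otimes> u g)" unfolding a(3,4) by (rule m_assoc) (use a Fc ls ug in auto)
      then show "a \<otimes> b \<in> adspan (F <#> set us)"
        using a(1,2) g us_set by (intro adspan_incl) (auto simp: set_mult_def)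
    qed
    then have "product_set (L m) u (box r) \<subseteq> adspan (F <#> set us)" by (auto simp: product_set_def)
    then have "Wbox m r \<subseteq> Span F us"
      unfolding Wbox_def tw_def US by (rule adspan_min[OF _ adspan_subgroup[OF Fls(2)]])
    then show ?thesis using usc len by blast
  qed
  then show ?thesis by (intro exI[of _ "length ls"] allI)
qed

text \<open>Let \<open>z\<close> be a central common denominator of a spanning list of
  \<open>V\<close>. A word of length \<open>k\<close> in \<open>V\<close>, multiplied by
  \<open>z [^] k\<close>, becomes a product of \<open>k\<close> elements of \<open>Wbox m r\<close>
  and so lies in \<open>Wbox m (r * k)\<close>. Neither the layer \<open>m\<close> nor the radius
  \<open>r\<close> depends on \<open>k\<close>.\<close>

lemma subspace_power_bound:
  assumes V: "subalgebra F V D" "finite_dimension F V"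
  shows "\<exists>d r. \<forall>k. finite_dimension F (subspace_power D F V k) \<and>
    dim F (subspace_power D F V k) \<le> d * (2 * (r * k) + 1) ^ n"
proof -
  obtain vs where vs: "set vs \<subseteq> carrier D" "Span F vs = V"
    using V(2) exists_base[OF F] by blast
  obtain m z where z: "z \<in> Zl m" "z \<noteq> \<zero>" "\<And>x. x \<in> set vs \<Longrightarrow> x \<otimes> z \<in> Wl m"
    using common_denominator[OF finite_set vs(1)] by blast
  have zc: "z \<in> carrier D" using z by auto
  have "\<exists>r. \<forall>x\<in>X. x \<otimes> z \<in> Wbox m r" if "finite X" "X \<subseteq> set vs" for X
    using that
  proof (induction X)
    case (insert x X)
    then obtain r where r: "\<forall>x\<in>X. x \<otimes> z \<in> Wbox m r" by auto
    obtain t where t: "x \<otimes> z \<in> Wbox m t" using Wl_in_Wbox[OF z(3)[of x]] insert.prems by auto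
    show ?case
      by (rule exI[of _ "max r t"])
        (use r t Wbox_mono[of r "max r t" m] Wbox_mono[of t "max r t" m] in auto)
  qed auto
  from this[OF finite_set order_refl] obtain r where r: "\<forall>x\<in>set vs. x \<otimes> z \<in> Wbox m r"
    by (elim exE)
  \<comment> \<open>The elements that \<open>z [^] k\<close> brings into the box of radius
    \<open>r * k\<close>. They form an \<open>F\<close>-subspace because scalars from
    \<open>F\<close> belong to \<open>L m\<close> and do not enlarge the support.\<close>
  define H where "H = (\<lambda>k. {x \<in> carrier D. x \<otimes> z [^] (k::nat) \<in> Wbox m (r * k)})"
  have zk: "z [^] k \<in> Zl m" "z [^] k \<noteq> \<zero>" "z [^] k \<in> carrier D" for k :: nat
  proof -
    show "z [^] k \<in> Zl m" using z(1) by (induction k) (auto intro: Zl_simps)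
    show "z [^] k \<noteq> \<zero>"
      using z zc by (induction k) (auto dest!: no_zero_divisors[rotated 2] simp: nat_pow_closed)
    show "z [^] k \<in> carrier D" using zc by simp
  qed
  have Hsub: "subalgebra F (H k) D" for k
  proof -
    have "subgroup (H k) (add_monoid D)"
      by (rule add_subgroupI)
        (use zk Wbox_scalar[of \<zero> m] in \<open>auto simp: H_def l_distr l_minus intro: Wbox_add Wbox_neg\<close>)
    moreover have "f \<otimes> x \<in> H k" if "f \<in> F" "x \<in> H k" for f x
    proof -
      have f: "f \<in> carrier D" using that(1) F_P by auto
      have x: "x \<in> carrier D" "x \<otimes> z [^] k \<in> Wbox m (r * k)" using that(2) by (auto simp: H_def)
      have "f \<otimes> (x \<otimes> z [^] k) \<in> Wbox m (0 + r * k)"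
        by (rule Wbox_mult[OF Wbox_scalar x(2)]) (use that(1) F_L in auto)
      then show ?thesis using f x(1) zk by (simp add: H_def m_assoc)
    qed
    ultimately show ?thesis by (intro subalgebra.intro subalgebra_axioms.intro)
  qed
  have VH: "V \<subseteq> H 1"
    unfolding vs(2)[symmetric]
    by (rule subalgebra_Span_incl[OF F Hsub]) (use vs(1) r zc in \<open>auto simp: H_def\<close>)
  have Vc: "V \<subseteq> carrier D" using VH by (auto simp: H_def)
  have words: "word_value D xs \<in> H (length xs)" if "set xs \<subseteq> V" for xs
    using that
  proof (induction xs)
    case Nil
    then show ?case using Wbox_scalar[of \<one> m 0] by (simp add: H_def)
  next
    case (Cons x xs)
    let ?y = "word_value D xs" and ?k = "length xs"
    have y: "?y \<in> carrier D" "?y \<otimes> z [^] ?k \<in> Wbox m (r * ?k)" using Cons by (auto simp: H_def)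
    have x: "x \<in> carrier D" "x \<otimes> z \<in> Wbox m r" using Cons.prems VH zc by (auto simp: H_def)
    have "x \<otimes> ?y \<otimes> z [^] Suc ?k = x \<otimes> ((?y \<otimes> z [^] ?k) \<otimes> z)"
      using x y zc by (simp add: m_assoc)
    \<comment> \<open>The cleared product of the remaining letters lies in \<open>Wl m\<close>, so
      the extra factor \<open>z\<close> passes through it and clears the first letter
      \<open>x\<close>.\<close>
    also have "(?y \<otimes> z [^] ?k) \<otimes> z = z \<otimes> (?y \<otimes> z [^] ?k)"
      using Zl_commutes[OF z(1)] y(2) Wbox_Wl by (metis subsetD)
    also have "x \<otimes> (z \<otimes> (?y \<otimes> z [^] ?k)) = (x \<otimes> z) \<otimes> (?y \<otimes> z [^] ?k)"
      using x y zc by (simp add: m_assoc)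
    also have "\<dots> \<in> Wbox m (r + r * ?k)" by (rule Wbox_mult[OF x(2) y(2)])
    finally show ?case using x(1) y(1) by (simp add: H_def)
  qed
  have wc: "{word_value D xs |xs. length xs = k \<and> set xs \<subseteq> V} \<subseteq> carrier D" for k
    using Vc by auto
  have sub: "subalgebra F (subspace_power D F V k) D" for k
    unfolding subspace_power_def by (rule linear_span_subalgebra[OF F wc])
  have SH: "subspace_power D F V k \<subseteq> H k" for k
    unfolding subspace_power_def by (rule linear_span_min[OF F Hsub]) (use words in auto)
  from Wbox_Span[of m] obtain d where
    d: "\<forall>t. \<exists>us. set us \<subseteq> carrier D \<and> length us \<le> d * (2 * t + 1) ^ n \<and> Wbox m t \<subseteq> Span F us"
    by (elim exE)
  have main: "finite_dimension F (subspace_power D F V k) \<and>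
      dim F (subspace_power D F V k) \<le> d * (2 * (r * k) + 1) ^ n" for k
  proof -
    obtain us where us: "set us \<subseteq> carrier D" "length us \<le> d * (2 * (r * k) + 1) ^ n"
      "Wbox m (r * k) \<subseteq> Span F us" using spec[OF d, of "r * k"] by (elim exE conjE)
    let ?z = "inv (z [^] k)"
    have izc: "?z \<in> carrier D" using zk by simp
    \<comment> \<open>Undoing the multiplication on a spanning list of the box gives a list of the
      same length whose span contains \<open>H k\<close>.\<close>
    let ?us = "map (\<lambda>y. y \<otimes> ?z) us"
    have usc: "set ?us \<subseteq> carrier D" using us(1) izc by auto
    have US: "Span F us = adspan (F <#> set us)" "Span F ?us = adspan (F <#> set ?us)"
      unfolding adspan_def by (rule Span_eq_generate[OF F us(1)], rule Span_eq_generate[OF F usc])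
    have Fc: "F \<subseteq> carrier D" by (rule subfieldE(3)[OF F])
    have Fus: "F <#> set us \<subseteq> carrier D" "F <#> set ?us \<subseteq> carrier D"
      by (rule set_mult_closed[OF Fc us(1)], rule set_mult_closed[OF Fc usc])
    have "H k \<subseteq> Span F ?us"
    proof
      fix x assume x: "x \<in> H k"
      then have xc: "x \<in> carrier D" "x \<otimes> z [^] k \<in> Span F us" using us(3) by (auto simp: H_def)
      have "(x \<otimes> z [^] k) \<otimes> ?z \<in> adspan (F <#> set ?us)"
      proof (rule adspan_mult[OF Fus(1) _ Fus(2)])
        show "x \<otimes> z [^] k \<in> adspan (F <#> set us)" using xc US by simp
        show "?z \<in> adspan {?z}" by (rule adspan_incl) simp
        show "{?z} \<subseteq> carrier D" using izc by simp
        fix a b assume "a \<in> F <#> set us" "b \<in> {?z}"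
        then obtain f l where a: "f \<in> F" "l \<in> set us" "a = f \<otimes> l" "b = ?z" by (auto simp: set_mult_def)
        have "a \<otimes> b = f \<otimes> (l \<otimes> ?z)" unfolding a(3,4) by (rule m_assoc) (use a Fc us izc in auto)
        then show "a \<otimes> b \<in> adspan (F <#> set ?us)"
          using a(1,2) by (intro adspan_incl) (auto simp: set_mult_def)
      qed
      moreover have "(x \<otimes> z [^] k) \<otimes> ?z = x" using xc(1) zk izc by (simp add: m_assoc)
      ultimately show "x \<in> Span F ?us" using US by simp
    qed
    then show ?thesis using dim_le_length[OF F sub _ usc] SH[of k] us(2) by fastforce
  qed
  then show ?thesis by (intro exI[of _ d] exI[of _ r] allI)
qed

lemma independent_u:
  assumes "distinct gs" "set gs \<subseteq> carrier G" shows "independent F (map u gs)"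
  using assms
proof (induction gs)
  case (Cons g gs)
  have usc: "set (map u gs) \<subseteq> carrier D" using Cons by auto
  have "u g \<notin> Span F (map u gs)"
  proof
    assume "u g \<in> Span F (map u gs)"
    moreover have "Span F (map u gs) = adspan (F <#> set (map u gs))"
      unfolding adspan_def by (rule Span_eq_generate[OF F usc])
    moreover have "F <#> set (map u gs) \<subseteq> product_set P u (set gs)"
      using F_P by (auto simp: set_mult_def product_set_def)
    ultimately have "\<one> \<otimes> u g \<in> tw P (set gs)"
      unfolding tw_def using adspan_mono Cons.prems by (simp, blast)
    then have "\<one> = \<zero>" using Cons.prems by (intro coefficient_in_tw_zero[of "set gs" g]) auto
    then show False by simp
  qed
  then show ?case using Cons by (auto intro!: li_Cons)
qed auto

text \<open>The monomials \<open>s\<^sub>1\<^sup>k\<^sup>1 \<cdots> s\<^sub>n\<^sup>k\<^sup>n\<close> with all exponents at most \<open>k div n\<close> are words of length \<open>k\<close>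
  in \<open>1, s\<^sub>1, \<dots>, s\<^sub>n\<close>.\<close>

lemma GK_dimension_lower:
  assumes n: "n \<ge> 1"
  obtains V where "subalgebra F V D" "finite_dimension F V" "\<one> \<in> V"
    "\<And>k. (k div n + 1) ^ n \<le> dim F (subspace_power D F V k)"
proof -
  let ?gen = "\<one> # map (\<lambda>i. u (s i)) [1..<Suc n]"
  define V where "V = Span F ?gen"
  have gc: "set ?gen \<subseteq> carrier D" using s_closed by auto
  have gV: "set ?gen \<subseteq> V" unfolding V_def by (rule Span_base_incl[OF F gc])
  have sV: "u (s i) \<in> V" if "i \<in> {1..n}" for i
  proof -
    have "u (s i) \<in> set ?gen" using that by (auto simp del: upt_Suc)
    then show ?thesis using gV by blast
  qed
  have one': "\<one> \<in> V" using gV by auto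
  have V: "subalgebra F V D" "finite_dimension F V"
    unfolding V_def by (rule Span_is_subalgebra[OF F gc], rule Span_finite_dimension[OF F gc])
  have Vc: "V \<subseteq> carrier D" by (rule subalgebra_in_carrier[OF V(1)])
  define S where "S = (\<lambda>k::nat. {word_value D xs |xs. length xs = k \<and> set xs \<subseteq> V})"
  have Sc: "S k \<subseteq> carrier D" for k unfolding S_def using Vc by auto
  have S_mult: "x \<otimes> y \<in> S (i + j)" if xy: "x \<in> S i" "y \<in> S j" for x y i j
  proof -
    obtain xs where xs: "length xs = i" "set xs \<subseteq> V" "x = word_value D xs" using xy(1) by (auto simp: S_def)
    obtain ys where ys: "length ys = j" "set ys \<subseteq> V" "y = word_value D ys" using xy(2) by (auto simp: S_def)
    have "x \<otimes> y = word_value D (xs @ ys)" unfolding xs(3) ys(3)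
      by (rule word_value_append[symmetric]) (use xs ys Vc in auto)
    then show ?thesis unfolding S_def using xs ys by (intro CollectI exI[of _ "xs @ ys"]) auto
  qed
  have S1: "v \<in> S 1" if "v \<in> V" for v
    unfolding S_def using that Vc by (intro CollectI exI[of _ "[v]"]) auto
  have S_one: "\<one> \<in> S k" for k
  proof (induction k)
    case 0
    show ?case unfolding S_def by (intro CollectI exI[of _ "[]"]) simp
  next
    case (Suc k)
    then show ?case using S_mult[OF Suc S1[OF one']] by simp
  qed
  \<comment> \<open>Shorter words are padded with \<open>\<one>\<close>, an element of
    \<open>V\<close>, so length at most \<open>k\<close> is as good as length
    \<open>k\<close>.\<close>
  have S_mono: "x \<in> S j" if "x \<in> S i" "i \<le> j" for x i j
    using S_mult[OF that(1) S_one[of "j - i"]] that Sc[of i] by auto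
  have S_pow: "u (s i [^]\<^bsub>G\<^esub> (a::nat)) \<in> S a" if i: "i \<in> {1..n}" for i a
  proof (induction a)
    case 0
    then show ?case using S_one u_one by simp
  next
    case (Suc a)
    have "u (s i [^]\<^bsub>G\<^esub> Suc a) = u (s i [^]\<^bsub>G\<^esub> a) \<otimes> u (s i)" using s_closed[OF i] by (simp add: u_mult)
    then show ?case using S_mult[OF Suc S1[OF sV[OF i]]] by simp
  qed
  have S_prod: "u (finprod G (\<lambda>i. s i [^]\<^bsub>G\<^esub> k i) {1..j}) \<in> S (j * M)"
    if k: "\<And>i. i \<in> {1..n} \<Longrightarrow> 0 \<le> k i \<and> k i \<le> int M" and "j \<le> n" for k :: "nat \<Rightarrow> int" and j M
    using that(2)
  proof (induction j)
    case 0
    then show ?case using S_one u_one by (simp add: G.finprod_empty)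
  next
    case (Suc j)
    have j: "Suc j \<in> {1..n}" using Suc by auto
    have sc: "(\<lambda>i. s i [^]\<^bsub>G\<^esub> k i) \<in> {1..Suc j} \<rightarrow> carrier G" using s_closed Suc.prems by auto
    have ins: "{1..Suc j} = insert (Suc j) {1..j}" by auto
    have "finprod G (\<lambda>i. s i [^]\<^bsub>G\<^esub> k i) {1..Suc j}
       = s (Suc j) [^]\<^bsub>G\<^esub> k (Suc j) \<otimes>\<^bsub>G\<^esub> finprod G (\<lambda>i. s i [^]\<^bsub>G\<^esub> k i) {1..j}"
      unfolding ins by (rule G.finprod_insert) (use sc in auto)
    moreover have "finprod G (\<lambda>i. s i [^]\<^bsub>G\<^esub> k i) {1..j} \<in> carrier G"
      by (rule G.finprod_closed) (use sc in auto)
    moreover have "s (Suc j) [^]\<^bsub>G\<^esub> k (Suc j) = s (Suc j) [^]\<^bsub>G\<^esub> nat (k (Suc j))"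
      using k[OF j] int_pow_int[of G "s (Suc j)" "nat (k (Suc j))"] by simp
    moreover have "u (s (Suc j) [^]\<^bsub>G\<^esub> nat (k (Suc j))) \<in> S M"
      by (rule S_mono[OF S_pow[OF j]]) (use k[OF j] in auto)
    ultimately show ?case using S_mult[of _ M _ "j * M"] Suc s_closed[OF j] by (simp add: u_mult)
  qed
  have bound: "(k div n + 1) ^ n \<le> dim F (subspace_power D F V k)" for k
  proof -
    let ?M = "k div n"
    let ?X = "{1..n} \<rightarrow>\<^sub>E {0..int ?M}"
    have inj: "inj_on gexp ?X"
    proof (rule inj_onI)
      fix x y assume xy: "x \<in> ?X" "y \<in> ?X" "gexp x = gexp y"
      show "x = y" by (rule PiE_ext[OF xy(1,2)]) (rule gexp_inj[OF xy(3)])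
    qed
    have fin: "finite (gexp ` ?X)" by (intro finite_imageI finite_PiE) auto
    have card: "card (gexp ` ?X) = (?M + 1) ^ n"
      by (subst card_image[OF inj], subst card_PiE) (auto simp: nat_add_distrib)
    obtain gs where gs: "set gs = gexp ` ?X" "distinct gs" using finite_distinct_list[OF fin] by blast
    have len: "length (map u gs) = (?M + 1) ^ n" using distinct_card[OF gs(2)] gs(1) card by simp
    have "u g \<in> S k" if "g \<in> set gs" for g
    proof -
      obtain x where x: "g = gexp x" "x \<in> ?X" using \<open>g \<in> set gs\<close> gs(1) by auto
      have "u (gexp x) \<in> S (n * ?M)" unfolding gexp_def by (rule S_prod) (use x in auto)
      then show ?thesis unfolding x(1) by (rule S_mono) simp
    qed
    moreover have "subspace_power D F V k = linear_span D F (S k)"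
      by (simp add: subspace_power_def S_def)
    ultimately have sub: "set (map u gs) \<subseteq> subspace_power D F V k"
      using linear_span_incl[OF F Sc] by auto
    have "independent F (map u gs)" by (rule independent_u) (use gs in auto)
    moreover have "finite_dimension F (subspace_power D F V k)" using subspace_power_bound[OF V] by auto
    ultimately have "length (map u gs) \<le> dim F (subspace_power D F V k)"
      using sub by (intro independent_length_le_dim[OF F])
    then show ?thesis unfolding len .
  qed
  show ?thesis by (rule that[OF V one' bound])
qed

theorem GK_dimension_eq:
  assumes "n \<ge> 1" shows "GK_dimension D F = ereal (real n)"
  unfolding GK_dimension_def
proof (rule antisym)
  show "(SUP V\<in>{V. subalgebra F V D \<and> finite_dimension F V \<and> \<one> \<in> V}.
      limsup (\<lambda>m. ereal (ln (real (dim F (subspace_power D F V m))) / ln (real m)))) \<le> ereal (real n)"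
  proof (rule SUP_least)
    fix V assume "V \<in> {V. subalgebra F V D \<and> finite_dimension F V \<and> \<one> \<in> V}"
    then obtain d r where dr: "\<forall>k. finite_dimension F (subspace_power D F V k) \<and>
        dim F (subspace_power D F V k) \<le> d * (2 * (r * k) + 1) ^ n"
      using subspace_power_bound[of V] by auto
    have "dim F (subspace_power D F V k) \<le> d * (2 * (r * k) + 1) ^ n" for k
      using spec[OF dr, of k] by (rule conjunct2)
    then show "limsup (\<lambda>m. ereal (ln (real (dim F (subspace_power D F V m))) / ln (real m))) \<le> ereal (real n)"
      by (rule limsup_log_growth_le)
  qed
  obtain V where V: "subalgebra F V D" "finite_dimension F V" "\<one> \<in> V"
    "\<And>k. (k div n + 1) ^ n \<le> dim F (subspace_power D F V k)"
    using GK_dimension_lower[OF assms] by blast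
  show "ereal (real n) \<le> (SUP V\<in>{V. subalgebra F V D \<and> finite_dimension F V \<and> \<one> \<in> V}.
      limsup (\<lambda>m. ereal (ln (real (dim F (subspace_power D F V m))) / ln (real m))))"
    by (rule SUP_upper2[of V]) (use V limsup_log_growth_ge[OF V(4) assms] in auto)
qed

end

section \<open>Galois groups of cyclic towers\<close>

lemma Gal_iff:
  "\<tau> \<in> carrier (Gal K F) \<longleftrightarrow> \<tau> \<in> ring_iso K K \<and> \<tau> \<in> extensional (carrier K) \<and> (\<forall>x\<in>F. \<tau> x = x)"
  by (auto simp: Gal_def)

lemma Gal_Bij: "\<tau> \<in> carrier (Gal K F) \<Longrightarrow> \<tau> \<in> Bij (carrier K)"
  by (auto simp: Gal_iff Bij_def ring_iso_def)

lemma Gal_mult: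
  "\<tau> \<in> carrier (Gal K F) \<Longrightarrow> \<rho> \<in> carrier (Gal K F) \<Longrightarrow> \<tau> \<otimes>\<^bsub>Gal K F\<^esub> \<rho> = compose (carrier K) \<tau> \<rho>"
  using Gal_Bij[of \<tau> K F] Gal_Bij[of \<rho> K F] by (simp add: Gal_def BijGroup_def)

lemma Gal_one: "\<one>\<^bsub>Gal K F\<^esub> = (\<lambda>x\<in>carrier K. x)"
  by (simp add: Gal_def BijGroup_def)

lemma Gal_hom:
  assumes "\<tau> \<in> carrier (Gal K F)"
  shows "x \<in> carrier K \<Longrightarrow> \<tau> x \<in> carrier K"
    "x \<in> carrier K \<Longrightarrow> y \<in> carrier K \<Longrightarrow> \<tau> (x \<otimes>\<^bsub>K\<^esub> y) = \<tau> x \<otimes>\<^bsub>K\<^esub> \<tau> y"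
    "x \<in> carrier K \<Longrightarrow> y \<in> carrier K \<Longrightarrow> \<tau> (x \<oplus>\<^bsub>K\<^esub> y) = \<tau> x \<oplus>\<^bsub>K\<^esub> \<tau> y"
    "\<tau> \<one>\<^bsub>K\<^esub> = \<one>\<^bsub>K\<^esub>"
    "x \<in> F \<Longrightarrow> \<tau> x = x"
  using assms unfolding Gal_iff ring_iso_def ring_hom_def by auto

lemma (in ring) Gal_zero_neg:
  assumes "\<tau> \<in> carrier (Gal R F)"
  shows "\<tau> \<zero> = \<zero>" "x \<in> carrier R \<Longrightarrow> \<tau> (\<ominus> x) = \<ominus> \<tau> x"
proof -
  have "\<tau> \<in> ring_hom R R" using assms by (simp add: Gal_iff ring_iso_def)
  then interpret h: ring_hom_ring R R \<tau> by unfold_locales auto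
  show "\<tau> \<zero> = \<zero>" "x \<in> carrier R \<Longrightarrow> \<tau> (\<ominus> x) = \<ominus> \<tau> x" by (simp_all add: h.hom_zero h.hom_a_inv)
qed

lemma Gal_mult_apply:
  "\<tau> \<in> carrier (Gal K F) \<Longrightarrow> \<rho> \<in> carrier (Gal K F) \<Longrightarrow> x \<in> carrier K \<Longrightarrow>
    (\<tau> \<otimes>\<^bsub>Gal K F\<^esub> \<rho>) x = \<tau> (\<rho> x)"
  by (simp add: Gal_mult compose_def)

lemma Gal_eqI:
  assumes "\<tau> \<in> carrier (Gal K F)" "\<rho> \<in> carrier (Gal K F)" "\<And>x. x \<in> carrier K \<Longrightarrow> \<tau> x = \<rho> x"
  shows "\<tau> = \<rho>"
  by (rule extensionalityI[of _ "carrier K"]) (use assms in \<open>auto simp: Gal_iff\<close>)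

lemma Gal_group:
  assumes "ring K" "F \<subseteq> carrier K" shows "group (Gal K F)"
proof -
  let ?S = "carrier K" and ?A = "carrier (Gal K F)"
  let ?B = "BijGroup ?S"
  interpret B: group ?B by (rule group_BijGroup)
  have car: "carrier ?B = Bij ?S" by (simp add: BijGroup_def)
  have "subgroup ?A ?B"
  proof
    show "?A \<subseteq> carrier ?B" using Gal_Bij car by auto
    show "\<one>\<^bsub>?B\<^esub> \<in> ?A"
    proof -
      have "(\<lambda>x\<in>?S. x) \<in> ring_iso K K"
        by (rule ring.ring_iso_restrict[OF assms(1) ring_iso_set_refl]) simp
      then show ?thesis using assms(2) by (auto simp: Gal_iff BijGroup_def subset_iff)
    qed
    fix \<tau> assume \<tau>: "\<tau> \<in> ?A"
    note Bt = Gal_Bij[OF \<tau>]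
    show "inv\<^bsub>?B\<^esub> \<tau> \<in> ?A"
    proof -
      have "inv_into ?S \<tau> \<in> ring_iso K K"
        by (rule ring_iso_set_sym[OF assms(1)]) (use \<tau> in \<open>simp add: Gal_iff\<close>)
      then have "(\<lambda>x\<in>?S. inv_into ?S \<tau> x) \<in> ring_iso K K"
        by (rule ring.ring_iso_restrict[OF assms(1)]) simp
      moreover have "inv_into ?S \<tau> x = x" if "x \<in> F" for x
      proof -
        have "\<tau> x = x" "x \<in> ?S" using \<tau> that assms(2) by (auto simp: Gal_iff)
        then show ?thesis using Bt inv_into_f_f[of \<tau> ?S x] by (simp add: Bij_def bij_betw_def)
      qed
      ultimately show ?thesis using assms(2) by (auto simp: Gal_iff inv_BijGroup[OF Bt])
    qed
    fix \<rho> assume \<rho>: "\<rho> \<in> ?A"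
    show "\<tau> \<otimes>\<^bsub>?B\<^esub> \<rho> \<in> ?A"
    proof -
      have "\<tau> \<circ> \<rho> \<in> ring_iso K K" using \<tau> \<rho> by (intro ring_iso_set_trans) (auto simp: Gal_iff)
      then have "compose ?S \<tau> \<rho> \<in> ring_iso K K"
        by (rule ring.ring_iso_restrict[OF assms(1)]) (simp add: compose_def)
      moreover have "compose ?S \<tau> \<rho> x = x" if "x \<in> F" for x
        using that \<tau> \<rho> assms(2) by (auto simp: compose_def Gal_iff subset_iff)
      moreover have "\<tau> \<otimes>\<^bsub>?B\<^esub> \<rho> = compose ?S \<tau> \<rho>"
        using Bt Gal_Bij[OF \<rho>] by (simp add: BijGroup_def)
      ultimately show ?thesis by (simp add: Gal_iff compose_extensional)
    qed
  qed
  then have "group (?B\<lparr>carrier := ?A\<rparr>)" by (rule B.subgroup_imp_group)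
  then show ?thesis by (simp add: Gal_def)
qed

lemma Gal_pow_apply:
  assumes "group (Gal K F)" "\<tau> \<in> carrier (Gal K F)" "x \<in> carrier K"
  shows "(\<tau> [^]\<^bsub>Gal K F\<^esub> (i::nat)) x = (\<tau> ^^ i) x"
proof -
  interpret group "Gal K F" by fact
  show ?thesis
    using assms(3)
  proof (induction i arbitrary: x)
    case 0
    then show ?case by (simp add: Gal_one)
  next
    case (Suc i)
    have "(\<tau> [^]\<^bsub>Gal K F\<^esub> Suc i) x = (\<tau> [^]\<^bsub>Gal K F\<^esub> i) (\<tau> x)"
      using Gal_mult_apply[OF nat_pow_closed[OF assms(2)] assms(2) Suc.prems] by simp
    then show ?case using Suc.IH[OF Gal_hom(1)[OF assms(2) Suc.prems]] by (simp add: funpow_swap1)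
  qed
qed

text \<open>Any \<open>N + 1\<close> distinct \<open>F\<close>-embeddings of an extension of degree \<open>N\<close> would be linearly dependent,
  so an automorphism of \<open>K\<close> restricts to one of the \<open>N\<close> automorphisms of \<open>M\<close>.\<close>

lemma (in domain) Gal_restrict:
  assumes F: "subfield F R" and M: "subring M R" "F \<subseteq> M" and dimM: "dimension N F M"
    and card: "card (carrier (Gal (R\<lparr>carrier := M\<rparr>) F)) = N" and N: "N > 0"
    and \<tau>: "\<tau> \<in> carrier (Gal R F)"
  shows "\<exists>\<rho>\<in>carrier (Gal (R\<lparr>carrier := M\<rparr>) F). \<forall>x\<in>M. \<tau> x = \<rho> x"
proof (rule ccontr)
  assume no: "\<not> ?thesis"
  let ?E = "R\<lparr>carrier := M\<rparr>"
  let ?J = "carrier (Gal ?E F)"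
  \<comment> \<open>Restriction makes the map extensional on \<open>M\<close> and so comparable, as
    a function, with the elements of the Galois group of \<open>M\<close>; by assumption it is none
    of them.\<close>
  define t where "t = restrict \<tau> M"
  have Mc: "x \<in> carrier R" if "x \<in> M" for x using subringE(1)[OF M(1)] that by auto
  have Fc: "F \<subseteq> carrier R" using M(2) Mc by auto
  have finJ: "finite ?J" using card N by (auto intro: card_ge_0_finite)
  have tJ: "t \<notin> ?J" using no by (auto simp: t_def)
  let ?K = "insert t ?J"
  note Ehom = Gal_hom[of _ ?E F, simplified]
  have \<sigma>: "\<sigma> x \<in> carrier R" "\<sigma> (x \<otimes> y) = \<sigma> x \<otimes> \<sigma> y" "\<sigma> (x \<oplus> y) = \<sigma> x \<oplus> \<sigma> y" "\<sigma> \<one> = \<one>"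
    "\<sigma> (\<ominus> x) = \<ominus> \<sigma> x" "\<sigma> \<zero> = \<zero>"
    if \<sigma>: "\<sigma> \<in> ?K" and x: "x \<in> M" and y: "y \<in> M" for \<sigma> x y
  proof -
    note S = subringE[OF M(1)]
    have "t x = \<tau> x" "t y = \<tau> y" "t (x \<otimes> y) = \<tau> (x \<otimes> y)" "t (x \<oplus> y) = \<tau> (x \<oplus> y)" "t \<one> = \<tau> \<one>"
      using x y S by (auto simp: t_def)
    then have *: "\<sigma> x \<in> carrier R \<and> \<sigma> (x \<otimes> y) = \<sigma> x \<otimes> \<sigma> y \<and> \<sigma> (x \<oplus> y) = \<sigma> x \<oplus> \<sigma> y \<and> \<sigma> \<one> = \<one>"
      if "x \<in> M" "y \<in> M" for x y
      using \<sigma>[unfolded t_def] Gal_hom(1-4)[OF \<tau>] Ehom(1-4)[of \<sigma>] that Mc S by auto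
    show "\<sigma> x \<in> carrier R" "\<sigma> (x \<otimes> y) = \<sigma> x \<otimes> \<sigma> y" "\<sigma> (x \<oplus> y) = \<sigma> x \<oplus> \<sigma> y" "\<sigma> \<one> = \<one>"
      using *[OF x y] by auto
    have z: "\<sigma> \<zero> \<oplus> \<sigma> \<zero> = \<sigma> \<zero>" "\<sigma> \<zero> \<in> carrier R" using *[OF S(2,2)] by auto
    then show z0: "\<sigma> \<zero> = \<zero>" by (metis add.l_cancel_one')
    have "\<sigma> (\<ominus> x) \<oplus> \<sigma> x = \<zero>" using *[OF S(5)[OF x] x] z0 Mc[OF x] by (simp add: l_neg)
    then show "\<sigma> (\<ominus> x) = \<ominus> \<sigma> x" using *[OF S(5)[OF x] x] *[OF x x] by (simp add: minus_equality)
  qed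
  have \<sigma>F: "\<sigma> x = x" if "\<sigma> \<in> ?K" "x \<in> F" for \<sigma> x
    using that Gal_hom(5)[OF \<tau>] Ehom(5)[of \<sigma>] M(2) by (auto simp: t_def)
  obtain es where es: "set es \<subseteq> carrier R" "length es = N" "Span F es = M"
    using exists_base[OF F dimM] by blast
  have esM: "set es \<subseteq> M" using Span_base_incl[OF F es(1)] es(3) by simp
  \<comment> \<open>One equation for each of the \<open>N\<close> basis vectors of \<open>M\<close>,
    one unknown for each of the \<open>N + 1\<close> maps.\<close>
  obtain k where k: "k \<in> ?K \<rightarrow> carrier R" "\<exists>\<sigma>\<in>?K. k \<sigma> \<noteq> \<zero>"
    "\<And>i. i \<in> {..<N} \<Longrightarrow> (\<Oplus>\<sigma>\<in>?K. \<sigma> (es ! i) \<otimes> k \<sigma>) = \<zero>"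
  proof (rule homogeneous_system[of "{..<N}" ?K "\<lambda>i \<sigma>. \<sigma> (es ! i)"])
    show "card {..<N} < card ?K" using finJ tJ card by simp
    show "\<sigma> (es ! i) \<in> carrier R" if "i \<in> {..<N}" "\<sigma> \<in> ?K" for i \<sigma>
    proof -
      have "es ! i \<in> M" using that(1) es(2) esM nth_mem[of i es] by auto
      then show ?thesis using \<sigma>(1)[OF that(2)] by blast
    qed
  qed (use finJ in auto)
  have kc: "k \<sigma> \<in> carrier R" if "\<sigma> \<in> ?K" for \<sigma> using k(1) that by auto
  \<comment> \<open>All maps are additive and fix \<open>F\<close>, so a relation that holds on the
    basis holds on its whole \<open>F\<close>-span \<open>M\<close>.\<close>
  define H where "H = {x \<in> M. (\<Oplus>\<sigma>\<in>?K. k \<sigma> \<otimes> \<sigma> x) = \<zero>}"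
  have HM: "H = M"
  proof
    have "M = adspan (F <#> set es)" unfolding es(3)[symmetric] adspan_def by (rule Span_eq_generate[OF F es(1)])
    also have "\<dots> \<subseteq> H"
    proof (rule adspan_min)
      show "F <#> set es \<subseteq> H"
      proof
        fix x assume "x \<in> F <#> set es"
        then obtain f e where fe: "f \<in> F" "e \<in> set es" "x = f \<otimes> e" by (auto simp: set_mult_def)
        obtain i where i: "i < N" "e = es ! i" using fe(2) es(2) by (metis in_set_conv_nth)
        have c: "f \<in> M" "e \<in> M" "f \<in> carrier R" using fe esM M(2) Mc by auto
        have "(\<Oplus>\<sigma>\<in>?K. k \<sigma> \<otimes> \<sigma> x) = (\<Oplus>\<sigma>\<in>?K. f \<otimes> (\<sigma> (es ! i) \<otimes> k \<sigma>))"
        proof (rule finsum_cong')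
          fix \<sigma> assume s: "\<sigma> \<in> ?K"
          show "k \<sigma> \<otimes> \<sigma> x = f \<otimes> (\<sigma> (es ! i) \<otimes> k \<sigma>)"
            using \<sigma>(1,2)[OF s c(1,2)] \<sigma>(1)[OF s c(2,2)] \<sigma>F[OF s fe(1)] kc[OF s] c(3) fe(3) i(2)
            by (simp add: m_ac)
        qed (use \<sigma>(1)[OF _ c(2,2)] kc c i in auto)
        also have "\<dots> = f \<otimes> (\<Oplus>\<sigma>\<in>?K. \<sigma> (es ! i) \<otimes> k \<sigma>)"
          by (rule finsum_rdistr[symmetric]) (use \<sigma>(1)[OF _ c(2,2)] kc c i finJ in auto)
        also have "\<dots> = \<zero>" using k(3)[of i] i(1) c(3) by simp
        finally show "x \<in> H" using fe(3) c subringE(6)[OF M(1)] by (simp add: H_def)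
      qed
      note S = subringE[OF M(1)]
      show "subgroup H (add_monoid R)"
      proof (rule add_subgroupI)
        show "H \<subseteq> carrier R" using Mc by (auto simp: H_def)
        have "(\<Oplus>\<sigma>\<in>?K. k \<sigma> \<otimes> \<sigma> \<zero>) = (\<Oplus>\<sigma>\<in>?K. \<zero>)"
        proof (rule finsum_cong')
          show "k \<sigma> \<otimes> \<sigma> \<zero> = \<zero>" if "\<sigma> \<in> ?K" for \<sigma>
            unfolding \<sigma>(6)[OF that S(2,2)] using kc[OF that] by simp
        qed auto
        then show "\<zero> \<in> H" using S(2) by (simp add: H_def finsum_zero)
        fix x assume x: "x \<in> H"
        then have xM: "x \<in> M" "(\<Oplus>\<sigma>\<in>?K. k \<sigma> \<otimes> \<sigma> x) = \<zero>" by (auto simp: H_def)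
        have "(\<Oplus>\<sigma>\<in>?K. k \<sigma> \<otimes> \<sigma> (\<ominus> x)) = (\<Oplus>\<sigma>\<in>?K. \<ominus> \<one> \<otimes> (k \<sigma> \<otimes> \<sigma> x))"
        proof (rule finsum_cong')
          show "k \<sigma> \<otimes> \<sigma> (\<ominus> x) = \<ominus> \<one> \<otimes> (k \<sigma> \<otimes> \<sigma> x)" if "\<sigma> \<in> ?K" for \<sigma>
            unfolding \<sigma>(5)[OF that xM(1) xM(1)] using \<sigma>(1)[OF that xM(1) xM(1)] kc[OF that]
            by (simp add: l_minus r_minus)
        qed (use \<sigma>(1)[OF _ xM(1) xM(1)] kc in auto)
        also have "\<dots> = \<ominus> \<one> \<otimes> (\<Oplus>\<sigma>\<in>?K. k \<sigma> \<otimes> \<sigma> x)"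
          by (rule finsum_rdistr[symmetric]) (use \<sigma>(1)[OF _ xM(1) xM(1)] kc finJ in auto)
        finally show "\<ominus> x \<in> H" using xM S(5) by (simp add: H_def)
        fix y assume "y \<in> H"
        then have yM: "y \<in> M" "(\<Oplus>\<sigma>\<in>?K. k \<sigma> \<otimes> \<sigma> y) = \<zero>" by (auto simp: H_def)
        have "(\<Oplus>\<sigma>\<in>?K. k \<sigma> \<otimes> \<sigma> (x \<oplus> y)) = (\<Oplus>\<sigma>\<in>?K. k \<sigma> \<otimes> \<sigma> x \<oplus> k \<sigma> \<otimes> \<sigma> y)"
        proof (rule finsum_cong')
          show "k \<sigma> \<otimes> \<sigma> (x \<oplus> y) = k \<sigma> \<otimes> \<sigma> x \<oplus> k \<sigma> \<otimes> \<sigma> y" if "\<sigma> \<in> ?K" for \<sigma>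
            unfolding \<sigma>(3)[OF that xM(1) yM(1)]
            using \<sigma>(1)[OF that xM(1) xM(1)] \<sigma>(1)[OF that yM(1) yM(1)] kc[OF that] by (simp add: r_distr)
        qed (use \<sigma>(1)[OF _ xM(1) xM(1)] \<sigma>(1)[OF _ yM(1) yM(1)] kc in auto)
        also have "\<dots> = (\<Oplus>\<sigma>\<in>?K. k \<sigma> \<otimes> \<sigma> x) \<oplus> (\<Oplus>\<sigma>\<in>?K. k \<sigma> \<otimes> \<sigma> y)"
          by (rule finsum_addf) (use \<sigma>(1)[OF _ xM(1) xM(1)] \<sigma>(1)[OF _ yM(1) yM(1)] kc in auto)
        finally show "x \<oplus> y \<in> H" using xM yM S(7) by (simp add: H_def)
      qed
    qed
    finally show "M \<subseteq> H" .
  qed (auto simp: H_def)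
  obtain \<sigma>0 where s0: "\<sigma>0 \<in> ?K" "k \<sigma>0 \<noteq> \<zero>" using k(2) by blast
  \<comment> \<open>The maps are distinct and multiplicative on \<open>M\<close>, so independence of
    characters forbids a nonzero coefficient.\<close>
  have "k \<sigma>0 = \<zero>"
  proof (rule independence_of_characters[where J = "?K - {\<sigma>0}" and X = M and f = "(\<otimes>)"
        and \<chi> = "\<lambda>\<sigma> x. \<sigma> x" and k = k])
    show "finite (?K - {\<sigma>0})" using finJ by simp
    show "\<exists>x\<in>M. \<sigma>0 x \<noteq> \<zero>" using \<sigma>(4)[OF s0(1)] subringE(3)[OF M(1)] by (metis one_not_zero)
    show "\<exists>x\<in>M. \<rho> x \<noteq> \<sigma>0 x" if r: "\<rho> \<in> ?K - {\<sigma>0}" for \<rho>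
    proof (rule ccontr)
      assume a: "\<not> ?thesis"
      have ext: "\<sigma> \<in> extensional M" if "\<sigma> \<in> ?K" for \<sigma> using that by (auto simp: Gal_iff t_def)
      have "\<rho> = \<sigma>0" by (rule extensionalityI[of _ M]) (use a r s0 ext in auto)
      then show False using r by simp
    qed
    fix x assume x: "x \<in> M"
    have "(\<Oplus>\<sigma>\<in>insert \<sigma>0 (?K - {\<sigma>0}). k \<sigma> \<otimes> \<sigma> x) = k \<sigma>0 \<otimes> \<sigma>0 x \<oplus> (\<Oplus>\<sigma>\<in>?K - {\<sigma>0}. k \<sigma> \<otimes> \<sigma> x)"
      by (rule finsum_insert) (use finJ s0 kc \<sigma>(1)[OF _ x x] in auto)
    moreover have "insert \<sigma>0 (?K - {\<sigma>0}) = ?K" using s0(1) by auto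
    moreover have "(\<Oplus>\<sigma>\<in>?K. k \<sigma> \<otimes> \<sigma> x) = \<zero>" using x HM by (auto simp: H_def)
    ultimately show "k \<sigma>0 \<otimes> \<sigma>0 x \<oplus> (\<Oplus>\<sigma>\<in>?K - {\<sigma>0}. k \<sigma> \<otimes> \<sigma> x) = \<zero>" by simp
  next
    show "x \<otimes> y \<in> M" if "x \<in> M" "y \<in> M" for x y using subringE(6)[OF M(1) that] .
  next
    fix x y \<sigma> assume h: "\<sigma> \<in> insert \<sigma>0 (?K - {\<sigma>0})" "x \<in> M" "y \<in> M"
    then have "\<sigma> \<in> ?K" using s0 by auto
    then show "\<sigma> (x \<otimes> y) = \<sigma> x \<otimes> \<sigma> y" using \<sigma>(2) h by blast
  next
    fix x \<sigma> assume h: "\<sigma> \<in> insert \<sigma>0 (?K - {\<sigma>0})" "x \<in> M"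
    then have "\<sigma> \<in> ?K" using s0 by auto
    then show "\<sigma> x \<in> carrier R" using \<sigma>(1) h by blast
  next
    show "k \<sigma>0 \<in> carrier R" "k \<in> ?K - {\<sigma>0} \<rightarrow> carrier R" using kc s0 by auto
  qed
  then show False using s0 by simp
qed

text \<open>Every automorphism of \<open>K\<close> agrees on \<open>M\<close> with an element of the
  Galois group of \<open>M\<close>. There the claims are closure, commutativity of a cyclic group,
  and annihilation by the group order. The isomorphism also yields the number of automorphisms that
  \<open>Gal_restrict\<close> asks for.\<close>

lemma cyclic_level:
  assumes K: "field K" "subfield F K" and M: "subfield M K" "F \<subseteq> M" and N: "N > 0"
    and dimM: "ring.dimension K N F M"
    and iso: "Gal (K\<lparr>carrier := M\<rparr>) F \<cong> integer_mod_group N"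
    and \<tau>: "\<tau> \<in> carrier (Gal K F)"
  shows "x \<in> M \<Longrightarrow> \<tau> x \<in> M"
    and "\<tau>' \<in> carrier (Gal K F) \<Longrightarrow> x \<in> M \<Longrightarrow> \<tau> (\<tau>' x) = \<tau>' (\<tau> x)"
    and "x \<in> M \<Longrightarrow> (\<tau> [^]\<^bsub>Gal K F\<^esub> N) x = x"
proof -
  interpret K: field K by fact
  let ?E = "K\<lparr>carrier := M\<rparr>"
  have Mr: "subring M K" by (rule subfieldE(1)[OF M(1)])
  have Fc: "F \<subseteq> carrier K" by (rule subfieldE(3)[OF K(2)])
  have Mc: "M \<subseteq> carrier K" by (rule subringE(1)[OF Mr])
  interpret A: group "Gal ?E F"
    by (rule Gal_group[OF K.subring_is_ring[OF Mr]]) (use M(2) in simp)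
  interpret B: group "Gal K F" by (rule Gal_group[OF K.ring_axioms Fc])
  have card: "card (carrier (Gal ?E F)) = N"
    using iso_same_card[OF iso] N by (simp add: carrier_integer_mod_group)
  have res: "\<exists>\<rho>\<in>carrier (Gal ?E F). \<forall>x\<in>M. \<tau> x = \<rho> x" if "\<tau> \<in> carrier (Gal K F)" for \<tau>
    by (rule K.Gal_restrict[OF K(2) Mr M(2) dimM card N that])
  obtain \<rho> where \<rho>: "\<rho> \<in> carrier (Gal ?E F)" "\<forall>x\<in>M. \<tau> x = \<rho> x" using res[OF \<tau>] by blast
  have inM: "\<rho> x \<in> M" if "\<rho> \<in> carrier (Gal ?E F)" "x \<in> M" for \<rho> x
    using Gal_hom(1)[OF that(1)] that(2) by simp
  show "\<tau> x \<in> M" if "x \<in> M" using \<rho> inM that by simp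
  show "\<tau> (\<tau>' x) = \<tau>' (\<tau> x)" if t: "\<tau>' \<in> carrier (Gal K F)" and x: "x \<in> M"
  proof -
    obtain \<rho>' where \<rho>': "\<rho>' \<in> carrier (Gal ?E F)" "\<forall>x\<in>M. \<tau>' x = \<rho>' x" using res[OF t] by blast
    obtain h where h: "h \<in> hom (Gal ?E F) (integer_mod_group N)" "inj_on h (carrier (Gal ?E F))"
      using iso by (auto simp: is_iso_def iso_def bij_betw_def)
    have "h (\<rho> \<otimes>\<^bsub>Gal ?E F\<^esub> \<rho>') = h (\<rho>' \<otimes>\<^bsub>Gal ?E F\<^esub> \<rho>)"
      using hom_mult[OF h(1)] \<rho>(1) \<rho>'(1) by (simp add: add.commute)
    then have "\<rho> \<otimes>\<^bsub>Gal ?E F\<^esub> \<rho>' = \<rho>' \<otimes>\<^bsub>Gal ?E F\<^esub> \<rho>"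
      using inj_onD[OF h(2)] \<rho>(1) \<rho>'(1) by simp
    then have "\<rho> (\<rho>' x) = \<rho>' (\<rho> x)"
      using Gal_mult_apply[of \<rho> ?E F \<rho>' x] Gal_mult_apply[of \<rho>' ?E F \<rho> x] \<rho>(1) \<rho>'(1) x by simp
    then show ?thesis using \<rho> \<rho>' x inM by simp
  qed
  show "(\<tau> [^]\<^bsub>Gal K F\<^esub> N) x = x" if x: "x \<in> M"
  proof -
    have "(\<tau> ^^ i) x = (\<rho> ^^ i) x \<and> (\<rho> ^^ i) x \<in> M" for i
      by (induction i) (use x \<rho> inM in auto)
    then have "(\<tau> [^]\<^bsub>Gal K F\<^esub> N) x = (\<rho> [^]\<^bsub>Gal ?E F\<^esub> N) x"
      using Gal_pow_apply[OF B.is_group \<tau>, of x N] Gal_pow_apply[OF A.is_group \<rho>(1), of x N] x Mc by auto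
    also have "\<rho> [^]\<^bsub>Gal ?E F\<^esub> N = \<one>\<^bsub>Gal ?E F\<^esub>"
      using A.pow_order_eq_1[OF \<rho>(1)] card by (simp add: order_def)
    finally show ?thesis using x by (simp add: Gal_one)
  qed
qed

section \<open>Finitely generated abelian groups\<close>

lemma (in comm_group) finprod_subgroup_generated:
  assumes "f \<in> I \<rightarrow> carrier (subgroup_generated G S)"
  shows "finprod (subgroup_generated G S) f I = finprod G f I"
proof -
  interpret H: comm_group "subgroup_generated G S"
    by (rule abelian_subgroup_generated) (rule comm_group_axioms)
  show ?thesis
  proof (cases "finite I")
    case True
    from True assms show ?thesis
    proof (induction I)
      case empty
      then show ?case using H.finprod_empty by simp
    next
      case (insert i I)
      have f: "f i \<in> carrier (subgroup_generated G S)" "f \<in> I \<rightarrow> carrier (subgroup_generated G S)"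
        using insert.prems by auto
      have f': "f i \<in> carrier G" "f \<in> I \<rightarrow> carrier G" using f carrier_subgroup_generated_subset by blast+
      show ?case
        using H.finprod_insert[OF insert.hyps f(2,1)] finprod_insert[OF insert.hyps f'(2,1)] insert.IH[OF f(2)]
        by simp
    qed
  qed (simp add: H.finprod_infinite)
qed

text \<open>In an abelian group the products of powers already form a subgroup. The statement
  computes inside the generated subgroup, the verification in the ambient group, where products and
  powers have the same values.\<close>

lemma (in comm_group) carrier_subgroup_generated_finite:
  assumes I: "finite I" and s: "s \<in> I \<rightarrow> carrier G"
  shows "carrier (subgroup_generated G (s ` I))
    = range (\<lambda>k::'i \<Rightarrow> int. finprod (subgroup_generated G (s ` I)) (\<lambda>i. s i [^]\<^bsub>subgroup_generated G (s ` I)\<^esub> k i) I)"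
    (is "carrier ?H = range ?f")
proof -
  interpret H: comm_group ?H
    by (rule abelian_subgroup_generated) (rule comm_group_axioms)
  have sH: "s i \<in> carrier ?H" if "i \<in> I" for i
    using subgroup_generated_subset_carrier_subset[of "s ` I"] s that by auto
  let ?g = "\<lambda>k::'i \<Rightarrow> int. finprod G (\<lambda>i. s i [^] k i) I"
  have fg: "?f k = ?g k" for k
  proof -
    have "?f k = finprod G (\<lambda>i. s i [^]\<^bsub>?H\<^esub> k i) I"
      by (rule finprod_subgroup_generated) (use sH in auto)
    also have "\<dots> = ?g k" by (rule finprod_cong') (use sH s in \<open>auto simp: int_pow_subgroup_generated\<close>)
    finally show ?thesis .
  qed
  have sp: "(\<lambda>i. s i [^] k i) \<in> I \<rightarrow> carrier G" for k :: "'i \<Rightarrow> int" using s by auto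
  show ?thesis
  proof
    show "range ?f \<subseteq> carrier ?H" using sH by (auto intro!: H.finprod_closed)
    have "subgroup (range ?g) G"
    proof (rule subgroupI)
      show "range ?g \<subseteq> carrier G" using sp by (auto intro!: finprod_closed)
      fix x assume "x \<in> range ?g"
      then obtain k where k: "x = ?g k" by auto
      have "?g (\<lambda>i. - k i) \<otimes> ?g k = finprod G (\<lambda>i. s i [^] (- k i) \<otimes> s i [^] k i) I"
        by (rule finprod_multf[symmetric]) (use sp[of k] sp[of "\<lambda>i. - k i"] in auto)
      also have "\<dots> = finprod G (\<lambda>i. \<one>) I"
        by (rule finprod_cong') (use s in \<open>auto simp: int_pow_mult[symmetric] Pi_iff\<close>)
      finally have "?g (\<lambda>i. - k i) \<otimes> ?g k = \<one>" by (simp add: finprod_one)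
      then have "inv x = ?g (\<lambda>i. - k i)" unfolding k
        by (intro inv_equality) (use sp[of k] sp[of "\<lambda>i. - k i"] in \<open>auto intro!: finprod_closed\<close>)
      then show "inv x \<in> range ?g" by (rule range_eqI[of _ _ "\<lambda>i. - k i"])
      fix y assume "y \<in> range ?g"
      then obtain l where l: "y = ?g l" by auto
      have "x \<otimes> y = finprod G (\<lambda>i. s i [^] k i \<otimes> s i [^] l i) I" unfolding k l
        by (rule finprod_multf[symmetric]) (use sp[of k] sp[of l] in auto)
      also have "\<dots> = ?g (\<lambda>i. k i + l i)"
        by (rule finprod_cong') (use s in \<open>auto simp: int_pow_mult Pi_iff\<close>)
      finally show "x \<otimes> y \<in> range ?g" by (rule range_eqI[of _ _ "\<lambda>i. k i + l i"])
    qed simp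
    moreover have "s ` I \<subseteq> range ?g"
    proof
      fix x assume "x \<in> s ` I"
      then obtain j where j: "j \<in> I" "x = s j" by auto
      have "?g (\<lambda>i. if j = i then 1 else 0) = finprod G (\<lambda>i. if j = i then s i else \<one>) I"
        by (rule finprod_cong') (use s in \<open>auto simp: int_pow_1 Pi_iff\<close>)
      also have "\<dots> = s j" by (rule finprod_singleton[OF j(1) I s])
      finally show "x \<in> range ?g" unfolding j(2)
        by (intro range_eqI[of _ _ "\<lambda>i. if j = i then 1 else 0"]) simp
    qed
    ultimately have "carrier ?H \<subseteq> range ?g" by (rule subgroup_generated_minimal)
    then show "carrier ?H \<subseteq> range ?f" unfolding fg .
  qed
qed

context twisted_tower
begin

text \<open>Injectivity of the coordinates on multiples of a unit vector: each generator has
  infinite order, as \<open>not_PI_algebra\<close> demands of its group element.\<close>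

lemma s_powers_distinct:
  assumes i: "i \<in> {1..n}" and eq: "s i [^]\<^bsub>G\<^esub> (a::nat) = s i [^]\<^bsub>G\<^esub> (b::nat)"
  shows "a = b"
proof -
  have "gexp (\<lambda>l. if i = l then int c else 0) = s i [^]\<^bsub>G\<^esub> c" for c :: nat
  proof -
    have "gexp (\<lambda>l. if i = l then int c else 0) = finprod G (\<lambda>l. if i = l then s l [^]\<^bsub>G\<^esub> int c else \<one>\<^bsub>G\<^esub>) {1..n}"
      unfolding gexp_def by (rule G.finprod_cong') (use s_closed in auto)
    also have "\<dots> = s i [^]\<^bsub>G\<^esub> int c"
      by (rule G.finprod_singleton[OF i]) (use s_closed in auto)
    finally show ?thesis by (simp add: int_pow_int)
  qed
  then have "gexp (\<lambda>l. if i = l then int a else 0) = gexp (\<lambda>l. if i = l then int b else 0)"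
    using eq by simp
  from gexp_inj[OF this i] show ?thesis by simp
qed

end

section \<open>Twisted group rings of automorphism groups\<close>

locale automorphism_group_ring = field K + G: comm_group G
  for K :: "('a, 'm) ring_scheme" (structure) and G :: "('a \<Rightarrow> 'a) monoid" +
  fixes F :: "'a set"
  assumes F: "subfield F K"
    and G_Gal: "carrier G \<subseteq> carrier (Gal K F)"
    and G_one: "\<one>\<^bsub>G\<^esub> = \<one>\<^bsub>Gal K F\<^esub>"
begin

abbreviation (input) R where "R \<equiv> twisted_group_ring K G (\<lambda>g. g)"

definition tmono :: "'a \<Rightarrow> ('a \<Rightarrow> 'a) \<Rightarrow> ('a \<Rightarrow> 'a) \<Rightarrow> 'a"
  where "tmono a g = (\<lambda>h\<in>carrier G. if h = g then a else \<zero>)"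

lemma tgr_scalar_tmono: "tgr_scalar K G a = tmono a \<one>\<^bsub>G\<^esub>"
  by (simp add: tgr_scalar_def tmono_def)

lemma G_one_apply [simp]: "x \<in> carrier K \<Longrightarrow> \<one>\<^bsub>G\<^esub> x = x"
  by (simp add: G_one Gal_one)

lemma G_hom:
  assumes "g \<in> carrier G"
  shows "x \<in> carrier K \<Longrightarrow> g x \<in> carrier K"
    "x \<in> carrier K \<Longrightarrow> y \<in> carrier K \<Longrightarrow> g (x \<otimes> y) = g x \<otimes> g y"
    "x \<in> carrier K \<Longrightarrow> y \<in> carrier K \<Longrightarrow> g (x \<oplus> y) = g x \<oplus> g y"
    "g \<one> = \<one>" "x \<in> F \<Longrightarrow> g x = x" "g \<zero> = \<zero>"
  using Gal_hom[of g K F] Gal_zero_neg(1)[of g F] G_Gal assms by blast+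

lemma R_carrier_iff: "c \<in> carrier R \<longleftrightarrow> c \<in> carrier G \<rightarrow>\<^sub>E carrier K \<and> finite {g \<in> carrier G. c g \<noteq> \<zero>}"
  by (simp add: twisted_group_ring_def)

lemma R_apply: "c \<in> carrier R \<Longrightarrow> g \<in> carrier G \<Longrightarrow> c g \<in> carrier K"
  by (auto simp: R_carrier_iff)

lemma tmono_closed:
  assumes "a \<in> carrier K" shows "tmono a g \<in> carrier R"
proof -
  have "{h \<in> carrier G. tmono a g h \<noteq> \<zero>} \<subseteq> {g}" by (auto simp: tmono_def)
  then have "finite {h \<in> carrier G. tmono a g h \<noteq> \<zero>}" by (rule finite_subset) simp
  then show ?thesis using assms by (auto simp: R_carrier_iff tmono_def)
qed

lemma R_add_apply: "g \<in> carrier G \<Longrightarrow> (c \<oplus>\<^bsub>R\<^esub> d) g = c g \<oplus> d g"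
  by (simp add: twisted_group_ring_def)

lemma R_mult_apply: "k \<in> carrier G \<Longrightarrow> (c \<otimes>\<^bsub>R\<^esub> d) k = finsum K (\<lambda>(g, h). c g \<otimes> g (d h))
    {(g, h). g \<in> carrier G \<and> h \<in> carrier G \<and> c g \<noteq> \<zero> \<and> d h \<noteq> \<zero> \<and> g \<otimes>\<^bsub>G\<^esub> h = k}"
  by (simp add: twisted_group_ring_def)

lemma R_mult_ext: "c \<otimes>\<^bsub>R\<^esub> d \<in> extensional (carrier G)"
  by (simp add: twisted_group_ring_def)

lemma R_add_ext: "c \<oplus>\<^bsub>R\<^esub> d \<in> extensional (carrier G)"
  by (simp add: twisted_group_ring_def)

lemma tmono_ext: "tmono a g \<in> extensional (carrier G)"
  by (simp add: tmono_def)

lemma tmono_mult_left: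
  assumes a: "a \<in> carrier K" and g: "g \<in> carrier G" and d: "d \<in> carrier R" and k: "k \<in> carrier G"
  shows "(tmono a g \<otimes>\<^bsub>R\<^esub> d) k = a \<otimes> g (d (inv\<^bsub>G\<^esub> g \<otimes>\<^bsub>G\<^esub> k))"
proof -
  define l where "l = inv\<^bsub>G\<^esub> g \<otimes>\<^bsub>G\<^esub> k"
  have l: "l \<in> carrier G" and kl: "k = g \<otimes>\<^bsub>G\<^esub> l"
    using g k by (simp_all add: l_def G.m_assoc[symmetric])
  have dc: "d l \<in> carrier K" "g (d l) \<in> carrier K" using R_apply[OF d l] G_hom(1)[OF g] by auto
  \<comment> \<open>Only pairs of nonzero coefficients are summed over, so for a monomial factor the
    index set has one element or none; the empty case matches a vanishing right-hand side.\<close>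
  have S: "{(x, h). x \<in> carrier G \<and> h \<in> carrier G \<and> tmono a g x \<noteq> \<zero> \<and> d h \<noteq> \<zero> \<and> x \<otimes>\<^bsub>G\<^esub> h = k}
      = (if a \<noteq> \<zero> \<and> d l \<noteq> \<zero> then {(g, l)} else {})"
    unfolding kl using g l by (auto simp: tmono_def split: if_splits)
  show ?thesis
    unfolding R_mult_apply[OF k] S l_def[symmetric]
    using a dc g G_hom(6)[OF g] by (auto simp: finsum_empty tmono_def)
qed

lemma tmono_mult_right:
  assumes b: "b \<in> carrier K" and h: "h \<in> carrier G" and c: "c \<in> carrier R" and k: "k \<in> carrier G"
  shows "(c \<otimes>\<^bsub>R\<^esub> tmono b h) k = c (k \<otimes>\<^bsub>G\<^esub> inv\<^bsub>G\<^esub> h) \<otimes> (k \<otimes>\<^bsub>G\<^esub> inv\<^bsub>G\<^esub> h) b"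
proof -
  define l where "l = k \<otimes>\<^bsub>G\<^esub> inv\<^bsub>G\<^esub> h"
  have l: "l \<in> carrier G" and kl: "k = l \<otimes>\<^bsub>G\<^esub> h"
    using h k by (simp_all add: l_def G.m_assoc)
  have cc: "c l \<in> carrier K" "l b \<in> carrier K" using R_apply[OF c l] G_hom(1)[OF l b] by auto
  have S: "{(g, x). g \<in> carrier G \<and> x \<in> carrier G \<and> c g \<noteq> \<zero> \<and> tmono b h x \<noteq> \<zero> \<and> g \<otimes>\<^bsub>G\<^esub> x = k}
      = (if b \<noteq> \<zero> \<and> c l \<noteq> \<zero> then {(l, h)} else {})"
    unfolding kl using h l by (auto simp: tmono_def split: if_splits)
  show ?thesis
    unfolding R_mult_apply[OF k] S l_def[symmetric]
    using b cc h G_hom(6)[OF l] by (auto simp: finsum_empty tmono_def)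
qed

lemma tmono_mult:
  assumes a: "a \<in> carrier K" "b \<in> carrier K" and g: "g \<in> carrier G" "h \<in> carrier G"
  shows "tmono a g \<otimes>\<^bsub>R\<^esub> tmono b h = tmono (a \<otimes> g b) (g \<otimes>\<^bsub>G\<^esub> h)"
proof (rule extensionalityI[OF R_mult_ext tmono_ext])
  fix k assume k: "k \<in> carrier G"
  have "inv\<^bsub>G\<^esub> g \<otimes>\<^bsub>G\<^esub> k = h \<longleftrightarrow> k = g \<otimes>\<^bsub>G\<^esub> h"
    using g k by (metis G.inv_solve_left)
  then show "(tmono a g \<otimes>\<^bsub>R\<^esub> tmono b h) k = tmono (a \<otimes> g b) (g \<otimes>\<^bsub>G\<^esub> h) k"
    unfolding tmono_mult_left[OF a(1) g(1) tmono_closed[OF a(2)] k]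
    using a g k G_hom(1)[OF g(1) a(2)] G_hom(6)[OF g(1)] by (auto simp: tmono_def)
qed

lemma tmono_add:
  assumes "a \<in> carrier K" "b \<in> carrier K"
  shows "tmono a g \<oplus>\<^bsub>R\<^esub> tmono b g = tmono (a \<oplus> b) g"
  by (rule extensionalityI[OF R_add_ext tmono_ext]) (use assms in \<open>auto simp: R_add_apply tmono_def\<close>)

lemma R_one: "\<one>\<^bsub>R\<^esub> = tmono \<one> \<one>\<^bsub>G\<^esub>"
  by (simp add: twisted_group_ring_def tmono_def)

text \<open>Commuting with the scalars of \<open>K\<close> forces \<open>k\<close> to act trivially
  wherever the coefficient at \<open>k\<close> is nonzero; commuting with the single group element
  \<open>g\<close> makes the coefficient at the identity a fixed point.\<close>

theorem center_twisted_group_ring: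
  assumes g: "g \<in> carrier G" and fixed: "\<And>x. x \<in> carrier K \<Longrightarrow> g x = x \<Longrightarrow> x \<in> F"
  shows "ring_center R = tgr_scalar K G ` F"
proof (intro equalityI subsetI)
  fix c assume "c \<in> ring_center R"
  then have c: "c \<in> carrier R" and comm: "\<And>d. d \<in> carrier R \<Longrightarrow> c \<otimes>\<^bsub>R\<^esub> d = d \<otimes>\<^bsub>R\<^esub> c"
    by (auto simp: ring_center_def)
  have c0: "c k = \<zero>" if k: "k \<in> carrier G" "k \<noteq> \<one>\<^bsub>G\<^esub>" for k
  proof (rule ccontr)
    assume nz: "c k \<noteq> \<zero>"
    have "k x = x" if x: "x \<in> carrier K" for x
    proof -
      have "(c \<otimes>\<^bsub>R\<^esub> tmono x \<one>\<^bsub>G\<^esub>) k = (tmono x \<one>\<^bsub>G\<^esub> \<otimes>\<^bsub>R\<^esub> c) k" using comm[OF tmono_closed[OF x]] by simp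
      then have "c k \<otimes> k x = x \<otimes> c k"
        using tmono_mult_left[OF x G.one_closed c k(1)] tmono_mult_right[OF x G.one_closed c k(1)]
          k(1) R_apply[OF c k(1)] by simp
      then have "c k \<otimes> k x = c k \<otimes> x" using R_apply[OF c k(1)] x by (simp add: m_comm)
      then show ?thesis using nz R_apply[OF c k(1)] x G_hom(1)[OF k(1) x] by (simp add: m_lcancel)
    qed
    \<comment> \<open>Automorphisms are extensional, so one that acts trivially on \<open>K\<close>
      is equal to the identity as a function.\<close>
    then have "k = \<one>\<^bsub>G\<^esub>"
      by (intro Gal_eqI[of k K F]) (use k(1) G_Gal G.one_closed in auto)
    then show False using k(2) by simp
  qed
  let ?a = "c \<one>\<^bsub>G\<^esub>"
  have a: "?a \<in> carrier K" using R_apply[OF c G.one_closed] .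
  have "c = tmono ?a \<one>\<^bsub>G\<^esub>"
    by (rule extensionalityI[OF _ tmono_ext]) (use c c0 in \<open>auto simp: R_carrier_iff tmono_def PiE_iff\<close>)
  moreover have "?a \<in> F"
  proof (rule fixed[OF a])
    have "(c \<otimes>\<^bsub>R\<^esub> tmono \<one> g) g = (tmono \<one> g \<otimes>\<^bsub>R\<^esub> c) g" using comm[OF tmono_closed[OF one_closed]] by simp
    then show "g ?a = ?a"
      using tmono_mult_left[OF one_closed g c g] tmono_mult_right[OF one_closed g c g] g a
        G_hom(1)[OF g a] by simp
  qed
  ultimately show "c \<in> tgr_scalar K G ` F" unfolding tgr_scalar_tmono by blast
next
  fix z assume "z \<in> tgr_scalar K G ` F"
  then obtain a where a: "a \<in> F" "z = tmono a \<one>\<^bsub>G\<^esub>" unfolding tgr_scalar_tmono by auto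
  have ac: "a \<in> carrier K" using a(1) subfieldE(3)[OF F] by auto
  have "z \<otimes>\<^bsub>R\<^esub> d = d \<otimes>\<^bsub>R\<^esub> z" if d: "d \<in> carrier R" for d
  proof (rule extensionalityI[OF R_mult_ext R_mult_ext])
    fix k assume k: "k \<in> carrier G"
    show "(z \<otimes>\<^bsub>R\<^esub> d) k = (d \<otimes>\<^bsub>R\<^esub> z) k"
      unfolding a(2) tmono_mult_left[OF ac G.one_closed d k] tmono_mult_right[OF ac G.one_closed d k]
      using k R_apply[OF d k] G_hom(5)[OF k a(1)] ac by (simp add: m_comm)
  qed
  then show "z \<in> ring_center R" using tmono_closed[OF ac] a(2) by (auto simp: ring_center_def)
qed

end

section \<open>The quotient division ring as an instance of the abstract setting\<close>

locale automorphism_quotient_ring = automorphism_group_ring K G F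
  for K :: "('a, 'm) ring_scheme" (structure) and G :: "('a \<Rightarrow> 'a) monoid" and F +
  fixes D :: "('d, 'k) ring_scheme" and \<iota> :: "(('a \<Rightarrow> 'a) \<Rightarrow> 'a) \<Rightarrow> 'd"
  assumes quot: "division_ring_of_quotients (twisted_group_ring K G (\<lambda>g. g)) D \<iota>"
begin

definition emb :: "'a \<Rightarrow> 'd" where "emb a = \<iota> (tgr_scalar K G a)"
definition gr :: "('a \<Rightarrow> 'a) \<Rightarrow> 'd" where "gr g = \<iota> (tmono \<one> g)"

sublocale D: division_ring D
  using quot by (simp add: division_ring_of_quotients_def)

lemma iota:
  "c \<in> carrier R \<Longrightarrow> \<iota> c \<in> carrier D"
  "c \<in> carrier R \<Longrightarrow> d \<in> carrier R \<Longrightarrow> \<iota> (c \<otimes>\<^bsub>R\<^esub> d) = \<iota> c \<otimes>\<^bsub>D\<^esub> \<iota> d"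
  "c \<in> carrier R \<Longrightarrow> d \<in> carrier R \<Longrightarrow> \<iota> (c \<oplus>\<^bsub>R\<^esub> d) = \<iota> c \<oplus>\<^bsub>D\<^esub> \<iota> d"
  "\<iota> \<one>\<^bsub>R\<^esub> = \<one>\<^bsub>D\<^esub>"
  "inj_on \<iota> (carrier R)"
  using quot by (auto simp: division_ring_of_quotients_def ring_hom_def)

lemma emb_tmono: "emb a = \<iota> (tmono a \<one>\<^bsub>G\<^esub>)"
  by (simp add: emb_def tgr_scalar_tmono)

lemma gr_closed: "gr g \<in> carrier D"
  unfolding gr_def by (rule iota(1)[OF tmono_closed[OF one_closed]])

lemma emb_gr:
  assumes "a \<in> carrier K" "g \<in> carrier G" shows "emb a \<otimes>\<^bsub>D\<^esub> gr g = \<iota> (tmono a g)"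
  unfolding emb_tmono gr_def iota(2)[OF tmono_closed[OF assms(1)] tmono_closed[OF one_closed], symmetric]
  using assms by (simp add: tmono_mult)

lemma gr_emb:
  assumes "a \<in> carrier K" "g \<in> carrier G" shows "gr g \<otimes>\<^bsub>D\<^esub> emb a = \<iota> (tmono (g a) g)"
  unfolding emb_tmono gr_def iota(2)[OF tmono_closed[OF one_closed] tmono_closed[OF assms(1)], symmetric]
  using assms G_hom(1)[OF assms(2,1)] by (simp add: tmono_mult)

lemma gr_mult:
  assumes "g \<in> carrier G" "h \<in> carrier G" shows "gr (g \<otimes>\<^bsub>G\<^esub> h) = gr g \<otimes>\<^bsub>D\<^esub> gr h"
  unfolding gr_def iota(2)[OF tmono_closed[OF one_closed] tmono_closed[OF one_closed], symmetric]
  using assms by (simp add: tmono_mult G_hom(4))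

lemma gr_one: "gr \<one>\<^bsub>G\<^esub> = \<one>\<^bsub>D\<^esub>"
  unfolding gr_def R_one[symmetric] by (rule iota(4))

lemma emb_hom: "emb \<in> ring_hom K D"
proof (rule ring_hom_memI)
  show "emb x \<in> carrier D" if "x \<in> carrier K" for x
    unfolding emb_tmono by (rule iota(1)[OF tmono_closed[OF that]])
  show "emb (x \<oplus> y) = emb x \<oplus>\<^bsub>D\<^esub> emb y" if "x \<in> carrier K" "y \<in> carrier K" for x y
    unfolding emb_tmono tmono_add[OF that, symmetric]
    by (rule iota(3)[OF tmono_closed[OF that(1)] tmono_closed[OF that(2)]])
  show "emb (x \<otimes> y) = emb x \<otimes>\<^bsub>D\<^esub> emb y" if "x \<in> carrier K" "y \<in> carrier K" for x y
    unfolding emb_tmono iota(2)[OF tmono_closed[OF that(1)] tmono_closed[OF that(2)], symmetric]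
    using that by (simp add: tmono_mult)
  show "emb \<one> = \<one>\<^bsub>D\<^esub>" using gr_one by (simp add: emb_tmono gr_def)
qed

sublocale emb: ring_hom_ring K D emb
  by unfold_locales (rule emb_hom)

lemma emb_inj: "inj_on emb (carrier K)"
  by (rule emb.img_is_subfield(1)[OF carrier_is_subfield]) simp

lemma conj_emb:
  assumes "a \<in> carrier K" "g \<in> carrier G"
  shows "gr g \<otimes>\<^bsub>D\<^esub> emb a \<otimes>\<^bsub>D\<^esub> gr (inv\<^bsub>G\<^esub> g) = emb (g a)"
proof -
  have "gr g \<otimes>\<^bsub>D\<^esub> emb a = emb (g a) \<otimes>\<^bsub>D\<^esub> gr g"
    using gr_emb[OF assms] emb_gr[OF G_hom(1)[OF assms(2,1)] assms(2)] by simp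
  then have "gr g \<otimes>\<^bsub>D\<^esub> emb a \<otimes>\<^bsub>D\<^esub> gr (inv\<^bsub>G\<^esub> g) = emb (g a) \<otimes>\<^bsub>D\<^esub> (gr g \<otimes>\<^bsub>D\<^esub> gr (inv\<^bsub>G\<^esub> g))"
    using gr_closed emb.hom_closed[OF G_hom(1)[OF assms(2,1)]] by (simp add: D.m_assoc)
  also have "gr g \<otimes>\<^bsub>D\<^esub> gr (inv\<^bsub>G\<^esub> g) = \<one>\<^bsub>D\<^esub>" using assms(2) by (simp add: gr_mult[symmetric] gr_one)
  finally show ?thesis using emb.hom_closed[OF G_hom(1)[OF assms(2,1)]] by simp
qed

lemma restriction_in_R:
  assumes "finite A" "c \<in> A \<rightarrow> carrier K"
  shows "(\<lambda>h\<in>carrier G. if h \<in> A then c h else \<zero>) \<in> carrier R"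
proof -
  have "{g \<in> carrier G. (\<lambda>h\<in>carrier G. if h \<in> A then c h else \<zero>) g \<noteq> \<zero>} \<subseteq> A" by auto
  then show ?thesis using assms finite_subset by (auto simp: R_carrier_iff)
qed

text \<open>Identifies sums in \<open>D\<close> with images of coefficient functions. With
  injectivity of \<open>\<iota>\<close> it yields the independence of the \<open>gr g\<close>, and
  it places the image of \<open>R\<close> in their span.\<close>

lemma iota_sum:
  assumes "finite A" "A \<subseteq> carrier G" "c \<in> A \<rightarrow> carrier K"
  shows "(\<Oplus>\<^bsub>D\<^esub>g\<in>A. emb (c g) \<otimes>\<^bsub>D\<^esub> gr g) = \<iota> (\<lambda>h\<in>carrier G. if h \<in> A then c h else \<zero>)"
  using assms
proof (induction A)
  case empty
  have "(\<lambda>h\<in>carrier G. if h \<in> {} then c h else \<zero>) = tmono \<zero> \<one>\<^bsub>G\<^esub>" by (auto simp: tmono_def)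
  then show ?case using emb.hom_zero by (simp add: emb_tmono D.finsum_empty)
next
  case (insert g A)
  let ?r = "\<lambda>A. \<lambda>h\<in>carrier G. if h \<in> A then c h else \<zero>"
  have c: "c g \<in> carrier K" "g \<in> carrier G" "c \<in> A \<rightarrow> carrier K" using insert.prems by auto
  have IH: "(\<Oplus>\<^bsub>D\<^esub>g\<in>A. emb (c g) \<otimes>\<^bsub>D\<^esub> gr g) = \<iota> (?r A)"
    by (rule insert.IH) (use insert.prems in auto)
  have "(\<Oplus>\<^bsub>D\<^esub>g\<in>insert g A. emb (c g) \<otimes>\<^bsub>D\<^esub> gr g) = emb (c g) \<otimes>\<^bsub>D\<^esub> gr g \<oplus>\<^bsub>D\<^esub> (\<Oplus>\<^bsub>D\<^esub>g\<in>A. emb (c g) \<otimes>\<^bsub>D\<^esub> gr g)"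
    by (rule D.finsum_insert)
      (use insert.hyps c gr_closed emb.hom_closed in \<open>auto intro!: D.m_closed simp: Pi_iff\<close>)
  also have "\<dots> = \<iota> (tmono (c g) g) \<oplus>\<^bsub>D\<^esub> \<iota> (?r A)"
    unfolding emb_gr[OF c(1,2)] IH ..
  also have "\<dots> = \<iota> (tmono (c g) g \<oplus>\<^bsub>R\<^esub> ?r A)"
    by (rule iota(3)[symmetric, OF tmono_closed[OF c(1)] restriction_in_R[OF insert.hyps(1) c(3)]])
  also have "tmono (c g) g \<oplus>\<^bsub>R\<^esub> ?r A = ?r (insert g A)"
    by (rule extensionalityI[OF R_add_ext]) (use c insert.hyps in \<open>auto simp: R_add_apply tmono_def Pi_iff\<close>)
  finally show ?case .
qed

lemma iota_zero: "\<iota> \<zero>\<^bsub>R\<^esub> = \<zero>\<^bsub>D\<^esub>"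
proof -
  have "\<zero>\<^bsub>R\<^esub> = tmono \<zero> \<one>\<^bsub>G\<^esub>" by (simp add: twisted_group_ring_def tmono_def)
  then show ?thesis using emb.hom_zero by (simp add: emb_tmono)
qed

lemma iota_in_adspan:
  assumes "c \<in> carrier R" shows "\<iota> c \<in> D.adspan (D.product_set (emb ` carrier K) gr (carrier G))"
proof -
  let ?A = "{g \<in> carrier G. c g \<noteq> \<zero>}"
  let ?B = "D.product_set (emb ` carrier K) gr (carrier G)"
  have A: "finite ?A" "?A \<subseteq> carrier G" "c \<in> ?A \<rightarrow> carrier K" using assms by (auto simp: R_carrier_iff)
  have "c = (\<lambda>h\<in>carrier G. if h \<in> ?A then c h else \<zero>)"
    by (rule extensionalityI[of _ "carrier G"]) (use assms in \<open>auto simp: R_carrier_iff PiE_iff\<close>)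
  then have "\<iota> c = (\<Oplus>\<^bsub>D\<^esub>g\<in>?A. emb (c g) \<otimes>\<^bsub>D\<^esub> gr g)" using iota_sum[OF A] by simp
  also have "\<dots> \<in> D.adspan ?B"
  proof (rule D.finsum_in_add_subgroup[OF D.adspan_subgroup])
    show "?B \<subseteq> carrier D" by (rule D.product_set_closed) (use gr_closed in auto)
    show "(\<lambda>g. emb (c g) \<otimes>\<^bsub>D\<^esub> gr g) \<in> ?A \<rightarrow> D.adspan ?B"
      using A by (auto intro!: D.adspan_incl D.product_setI)
  qed
  finally show ?thesis .
qed

text \<open>Faithfulness and independence reduce to injectivity of \<open>\<iota>\<close>,
  conjugation to the multiplication of monomials, and fractions to the definition of the quotient
  ring.\<close>

sublocale tw: twisted_group_in_division_ring D G "emb ` carrier K" gr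
proof (intro twisted_group_in_division_ring.intro[OF D.division_ring_axioms G.comm_group_axioms]
    twisted_group_in_division_ring_axioms.intro)
  show "subfield (emb ` carrier K) D" by (rule emb.img_is_subfield(2)[OF carrier_is_subfield]) simp
  show "gr g \<in> carrier D" for g by (rule gr_closed)
  show "gr (g \<otimes>\<^bsub>G\<^esub> h) = gr g \<otimes>\<^bsub>D\<^esub> gr h" if "g \<in> carrier G" "h \<in> carrier G" for g h
    using that by (rule gr_mult)
  show "gr \<one>\<^bsub>G\<^esub> = \<one>\<^bsub>D\<^esub>" by (rule gr_one)
  show "gr g \<otimes>\<^bsub>D\<^esub> x \<otimes>\<^bsub>D\<^esub> gr (inv\<^bsub>G\<^esub> g) \<in> emb ` carrier K" if "g \<in> carrier G" "x \<in> emb ` carrier K" for g x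
    using that conj_emb G_hom(1) by auto
  show "\<exists>x\<in>emb ` carrier K. gr g \<otimes>\<^bsub>D\<^esub> x \<noteq> x \<otimes>\<^bsub>D\<^esub> gr g" if g: "g \<in> carrier G" "g \<noteq> \<one>\<^bsub>G\<^esub>" for g
  proof -
    obtain x where x: "x \<in> carrier K" "g x \<noteq> x"
      using Gal_eqI[of g K F "\<one>\<^bsub>G\<^esub>"] g G_Gal G.one_closed by (metis G_one_apply subsetD)
    have "gr g \<otimes>\<^bsub>D\<^esub> emb x \<noteq> emb x \<otimes>\<^bsub>D\<^esub> gr g"
    proof
      assume "gr g \<otimes>\<^bsub>D\<^esub> emb x = emb x \<otimes>\<^bsub>D\<^esub> gr g"
      then have "\<iota> (tmono (g x) g) = \<iota> (tmono x g)" using gr_emb[OF x(1) g(1)] emb_gr[OF x(1) g(1)] by simp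
      then have "tmono (g x) g = tmono x g"
        by (rule inj_onD[OF iota(5)]) (use tmono_closed x(1) G_hom(1)[OF g(1) x(1)] in auto)
      then have "tmono (g x) g g = tmono x g g" by simp
      then show False using x(2) g(1) by (simp add: tmono_def)
    qed
    then show ?thesis using x(1) by blast
  qed
  show "c g = \<zero>\<^bsub>D\<^esub>" if A: "finite A" "A \<subseteq> carrier G" "c \<in> A \<rightarrow> emb ` carrier K"
    "(\<Oplus>\<^bsub>D\<^esub>g\<in>A. c g \<otimes>\<^bsub>D\<^esub> gr g) = \<zero>\<^bsub>D\<^esub>" "g \<in> A" for A c g
  proof -
    \<comment> \<open>The given coefficients lie in the image of \<open>K\<close>; they are pulled
      back because \<open>iota_sum\<close> speaks of coefficients in \<open>K\<close>.\<close>
    define b where "b = (\<lambda>g. inv_into (carrier K) emb (c g))"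
    have b: "b g \<in> carrier K" "emb (b g) = c g" if "g \<in> A" for g
    proof -
      have "c g \<in> emb ` carrier K" using A(3) that by auto
      then show "b g \<in> carrier K" "emb (b g) = c g"
        unfolding b_def by (rule inv_into_into, rule f_inv_into_f)
    qed
    have "(\<Oplus>\<^bsub>D\<^esub>g\<in>A. emb (b g) \<otimes>\<^bsub>D\<^esub> gr g) = (\<Oplus>\<^bsub>D\<^esub>g\<in>A. c g \<otimes>\<^bsub>D\<^esub> gr g)"
    proof (rule D.finsum_cong')
      show "(\<lambda>g. c g \<otimes>\<^bsub>D\<^esub> gr g) \<in> A \<rightarrow> carrier D"
        using A(3) gr_closed by (fastforce simp: Pi_iff)
    qed (use b in auto)
    then have z: "\<iota> (\<lambda>h\<in>carrier G. if h \<in> A then b h else \<zero>) = \<iota> (tmono \<zero> \<one>\<^bsub>G\<^esub>)"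
      using iota_sum[OF A(1,2), of b] b A(4) emb.hom_zero by (simp add: emb_tmono Pi_iff)
    have "(\<lambda>h\<in>carrier G. if h \<in> A then b h else \<zero>) = tmono \<zero> \<one>\<^bsub>G\<^esub>"
      by (rule inj_onD[OF iota(5), OF z]) (use restriction_in_R[OF A(1), of b] b tmono_closed in auto)
    then have "(\<lambda>h\<in>carrier G. if h \<in> A then b h else \<zero>) g = tmono \<zero> \<one>\<^bsub>G\<^esub> g" by simp
    moreover have "g \<in> carrier G" using A by auto
    ultimately have "b g = \<zero>" using A(5) by (simp add: tmono_def)
    then show ?thesis using b(2)[OF A(5)] emb.hom_zero by simp
  qed
  show "\<exists>a\<in>D.adspan (D.product_set (emb ` carrier K) gr (carrier G)).
      \<exists>s\<in>D.adspan (D.product_set (emb ` carrier K) gr (carrier G)) - {\<zero>\<^bsub>D\<^esub>}. x = a \<otimes>\<^bsub>D\<^esub> inv\<^bsub>D\<^esub> s"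
    if x: "x \<in> carrier D" for x
  proof -
    obtain a s where as: "a \<in> carrier R" "s \<in> carrier R - {\<zero>\<^bsub>R\<^esub>}" "x = \<iota> a \<otimes>\<^bsub>D\<^esub> inv\<^bsub>D\<^esub> (\<iota> s)"
      using quot x unfolding division_ring_of_quotients_def by blast
    have zR: "\<zero>\<^bsub>R\<^esub> \<in> carrier R"
      using tmono_closed[OF zero_closed, of "\<one>\<^bsub>G\<^esub>"] by (simp add: twisted_group_ring_def tmono_def)
    have "\<iota> s \<noteq> \<zero>\<^bsub>D\<^esub>" using inj_onD[OF iota(5), of s "\<zero>\<^bsub>R\<^esub>"] zR as(2) iota_zero by auto
    then show ?thesis using as iota_in_adspan by blast
  qed
qed

end

text \<open>The dictionary between fixed points in \<open>K\<close> and commutation in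
  \<open>D\<close>, by which the facts about fields are carried over.\<close>

lemma (in automorphism_quotient_ring) gr_commutes_iff:
  assumes "a \<in> carrier K" "g \<in> carrier G"
  shows "gr g \<otimes>\<^bsub>D\<^esub> emb a = emb a \<otimes>\<^bsub>D\<^esub> gr g \<longleftrightarrow> g a = a"
proof -
  have ga: "g a \<in> carrier K" by (rule G_hom(1)[OF assms(2,1)])
  have "tw.act g (emb a) = emb (g a)" using conj_emb[OF assms] by (simp add: tw.act_def)
  moreover have "tw.act g (emb a) = emb a \<longleftrightarrow> gr g \<otimes>\<^bsub>D\<^esub> emb a = emb a \<otimes>\<^bsub>D\<^esub> gr g"
    by (rule tw.act_fixed_iff[OF assms(2)]) (use assms(1) in auto)
  moreover have "emb (g a) = emb a \<longleftrightarrow> g a = a" using inj_on_eq_iff[OF emb_inj ga assms(1)] .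
  ultimately show ?thesis by simp
qed

theorem mainTheorem1:
  fixes K :: "('a, 'm) ring_scheme" and F :: "'a set"
    and p n :: nat
    and \<sigma> :: "nat \<Rightarrow> 'a \<Rightarrow> 'a"
    and G :: "('a \<Rightarrow> 'a) monoid"
    and R :: "(('a \<Rightarrow> 'a) \<Rightarrow> 'a) ring"
  assumes "Factorial_Ring.prime p"
    and "field K" and "subfield F K"
    and "Zp_extension p K F"
    and "n \<ge> 1"
    and "\<forall>i\<in>{1..n}. \<sigma> i \<in> carrier (Gal K F)"
    and "fixed_field K {\<sigma> 1} = F"
    and "Z_linearly_independent (Gal K F) {1..n} \<sigma>"
    and "G = subgroup_generated (Gal K F) (\<sigma> ` {1..n})"
    and "R = twisted_group_ring K G (\<lambda>g. g)"
  shows "ring_center R = tgr_scalar K G ` F \<and>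
    (\<forall>(D :: ('d, 'k) ring_scheme) \<iota>.
       division_ring_of_quotients R D \<iota> \<longrightarrow>
       ring_center D = \<iota> ` tgr_scalar K G ` F \<and>
       locally_PI_algebra D (\<iota> ` tgr_scalar K G ` F) \<and>
       \<not> PI_algebra D (\<iota> ` tgr_scalar K G ` F) \<and>
       GK_dimension D (\<iota> ` tgr_scalar K G ` F) = ereal (real n))"
proof -
  interpret K: field K by fact
  obtain L where L: "\<forall>m\<ge>1. subfield (L m) K \<and> F \<subseteq> L m \<and> L m \<subseteq> L (Suc m)"
    "carrier K = (\<Union>m\<in>{1::nat..}. L m)"
    "\<forall>m\<ge>1. finite_galois_extension (K\<lparr>carrier := L m\<rparr>) F \<and> ring.dimension K (p ^ m) F (L m) \<and>
      Gal (K\<lparr>carrier := L m\<rparr>) F \<cong> integer_mod_group (p ^ m)"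
    using assms(4) unfolding Zp_extension_def by blast
  have p: "p ^ m > 0" for m using assms(1) prime_gt_0_nat by simp
  \<comment> \<open>The given tower is indexed from 1, the abstract one from 0; hence the shift in
    both the layers and the exponents.\<close>
  let ?M = "\<lambda>m. L (Suc m)" and ?q = "\<lambda>m. p ^ Suc m"
  have M: "subfield (?M m) K" "F \<subseteq> ?M m" "?M m \<subseteq> ?M (Suc m)" "ring.dimension K (?q m) F (?M m)"
    "Gal (K\<lparr>carrier := ?M m\<rparr>) F \<cong> integer_mod_group (?q m)" for m
    using L(1,3)[rule_format, of "Suc m"] by auto
  note level = cyclic_level[OF assms(2,3) M(1,2) p M(4,5)]
  have KM: "carrier K = (\<Union>m. ?M m)"
  proof -
    have "{1::nat..} = range Suc" by (auto simp: image_iff Suc_le_eq gr0_conv_Suc)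
    then show ?thesis unfolding L(2) by auto
  qed
  have Fc: "F \<subseteq> carrier K" by (rule subfieldE(3)[OF assms(3)])
  interpret A: group "Gal K F" by (rule Gal_group[OF K.ring_axioms Fc])
  \<comment> \<open>Two automorphisms commute on each layer, where they act through a cyclic group,
    and the layers exhaust \<open>K\<close>.\<close>
  interpret A: comm_group "Gal K F"
  proof (rule A.group_comm_groupI)
    fix \<tau> \<rho> assume t: "\<tau> \<in> carrier (Gal K F)" "\<rho> \<in> carrier (Gal K F)"
    show "\<tau> \<otimes>\<^bsub>Gal K F\<^esub> \<rho> = \<rho> \<otimes>\<^bsub>Gal K F\<^esub> \<tau>"
    proof (rule Gal_eqI[of _ K F])
      fix x assume x: "x \<in> carrier K"
      then obtain m where "x \<in> ?M m" using KM by auto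
      then have "\<tau> (\<rho> x) = \<rho> (\<tau> x)" by (rule level(2)[OF t])
      then show "(\<tau> \<otimes>\<^bsub>Gal K F\<^esub> \<rho>) x = (\<rho> \<otimes>\<^bsub>Gal K F\<^esub> \<tau>) x" using t x by (simp add: Gal_mult_apply)
    qed (use t in auto)
  qed
  interpret G: comm_group G
    unfolding assms(9) by (rule A.abelian_subgroup_generated) (rule A.comm_group_axioms)
  have GA: "carrier G \<subseteq> carrier (Gal K F)"
    unfolding assms(9) by (rule A.carrier_subgroup_generated_subset)
  have \<sigma>A: "\<sigma> i \<in> carrier (Gal K F)" if "i \<in> {1..n}" for i using assms(6) that by auto
  have \<sigma>G: "\<sigma> i \<in> carrier G" if "i \<in> {1..n}" for i
    using A.subgroup_generated_subset_carrier_subset[of "\<sigma> ` {1..n}"] \<sigma>A that unfolding assms(9) by blast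
  have one: "1 \<in> {1..n}" using assms(5) by simp
  have fixed: "x \<in> F" if "x \<in> carrier K" "\<sigma> 1 x = x" for x
    using assms(7) that by (auto simp: fixed_field_def)
  have agr: "automorphism_group_ring K G F"
    by (intro automorphism_group_ring.intro automorphism_group_ring_axioms.intro
        K.field_axioms G.comm_group_axioms assms(3) GA) (simp_all add: assms(9))
  interpret automorphism_group_ring K G F by (rule agr)
  have generate: "carrier G = range (\<lambda>k::nat \<Rightarrow> int. finprod G (\<lambda>i. \<sigma> i [^]\<^bsub>G\<^esub> k i) {1..n})"
    unfolding assms(9) by (rule A.carrier_subgroup_generated_finite) (use \<sigma>A in auto)
  \<comment> \<open>Independence is given in the Galois group but wanted in the generated subgroup,
    so products and powers are translated.\<close>
  have independent: "k i = 0"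
    if k: "finprod G (\<lambda>i. \<sigma> i [^]\<^bsub>G\<^esub> k i) {1..n} = \<one>\<^bsub>G\<^esub>" and i: "i \<in> {1..n}" for k :: "nat \<Rightarrow> int" and i
  proof -
    have "finprod G (\<lambda>i. \<sigma> i [^]\<^bsub>G\<^esub> k i) {1..n} = finprod (Gal K F) (\<lambda>i. \<sigma> i [^]\<^bsub>G\<^esub> k i) {1..n}"
      by (rule A.finprod_subgroup_generated[where S = "\<sigma> ` {1..n}", folded assms(9)])
        (use \<sigma>G in auto)
    also have "\<dots> = finprod (Gal K F) (\<lambda>i. \<sigma> i [^]\<^bsub>Gal K F\<^esub> k i) {1..n}"
      by (rule A.finprod_cong')
        (use \<sigma>A \<sigma>G A.int_pow_subgroup_generated[where S = "\<sigma> ` {1..n}", folded assms(9)] in auto)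
    finally have "finprod (Gal K F) (\<lambda>i. \<sigma> i [^]\<^bsub>Gal K F\<^esub> k i) {1..n} = \<one>\<^bsub>Gal K F\<^esub>"
      using k by (simp add: assms(9))
    then show ?thesis using assms(8) i unfolding Z_linearly_independent_def by blast
  qed
  have "ring_center R = tgr_scalar K G ` F"
    unfolding assms(10) by (rule center_twisted_group_ring[OF \<sigma>G[OF one] fixed])
  moreover have "ring_center D = \<iota> ` tgr_scalar K G ` F \<and>
       locally_PI_algebra D (\<iota> ` tgr_scalar K G ` F) \<and>
       \<not> PI_algebra D (\<iota> ` tgr_scalar K G ` F) \<and>
       GK_dimension D (\<iota> ` tgr_scalar K G ` F) = ereal (real n)"
    if quot: "division_ring_of_quotients R D \<iota>" for D :: "('d, 'k) ring_scheme" and \<iota>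
  proof -
    interpret Q: automorphism_quotient_ring K G F D \<iota>
      by (intro automorphism_quotient_ring.intro automorphism_quotient_ring_axioms.intro agr)
        (use quot in \<open>simp add: assms(10)\<close>)
    have embF: "\<iota> ` tgr_scalar K G ` F = Q.emb ` F" by (simp add: image_image Q.emb_def)
    have Mc: "?M m \<subseteq> carrier K" for m using KM by auto
    have nz: "\<one>\<^bsub>D\<^esub> \<noteq> \<zero>\<^bsub>D\<^esub>" by simp
    \<comment> \<open>The tower is carried into \<open>D\<close> along \<open>Q.emb\<close>.
      Conjugation by \<open>Q.gr g\<close> realises \<open>g\<close>, so stability of the layers and
      triviality of the \<open>p ^ Suc m\<close>-th powers come from
      \<open>cyclic_level\<close>.\<close>
    interpret T: twisted_tower D G "Q.emb ` carrier K" Q.gr "Q.emb ` F" "\<lambda>m. Q.emb ` ?M m" ?q n \<sigma>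
    proof (intro twisted_tower.intro[OF Q.tw.twisted_group_in_division_ring_axioms] twisted_tower_axioms.intro)
      show "subfield (Q.emb ` F) D" by (rule Q.emb.img_is_subfield(2)[OF assms(3) nz])
      show "subfield (Q.emb ` ?M m) D" for m by (rule Q.emb.img_is_subfield(2)[OF M(1) nz])
      show "Q.emb ` F \<subseteq> Q.emb ` ?M m" "Q.emb ` ?M m \<subseteq> Q.emb ` ?M (Suc m)" for m using M by (intro image_mono; simp)+
      show "Q.emb ` carrier K = (\<Union>m. Q.emb ` ?M m)" unfolding KM by (rule image_UN)
      show "Q.gr g \<otimes>\<^bsub>D\<^esub> x = x \<otimes>\<^bsub>D\<^esub> Q.gr g" if "g \<in> carrier G" "x \<in> Q.emb ` F" for g x
        using that Q.gr_commutes_iff G_hom(5)[OF that(1)] Fc by auto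
      show "Q.gr g \<otimes>\<^bsub>D\<^esub> x \<otimes>\<^bsub>D\<^esub> Q.gr (inv\<^bsub>G\<^esub> g) \<in> Q.emb ` ?M m" 
        if g: "g \<in> carrier G" and x: "x \<in> Q.emb ` ?M m" for g x m
      proof -
        obtain a where a: "a \<in> ?M m" "x = Q.emb a" using x by auto
        have "g a \<in> ?M m" using level(1)[OF _ a(1)] g GA by auto
        then show ?thesis using Q.conj_emb[of a g] a Mc g by auto
      qed
      show "\<exists>ls. set ls \<subseteq> carrier D \<and> Q.emb ` ?M m = Q.D.Span (Q.emb ` F) ls" for m
      proof -
        obtain es where es: "set es \<subseteq> carrier K" "K.Span F es = ?M m"
          using K.exists_base[OF assms(3) M(4)] by blast
        then show ?thesis using Q.emb.Span_hom[OF Fc es(1)] Q.emb.hom_closed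
          by (intro exI[of _ "map Q.emb es"]) auto
      qed
      show "?q m > 0" for m by (rule p)
      show "Q.gr (g [^]\<^bsub>G\<^esub> ?q m) \<otimes>\<^bsub>D\<^esub> x = x \<otimes>\<^bsub>D\<^esub> Q.gr (g [^]\<^bsub>G\<^esub> ?q m)"
        if g: "g \<in> carrier G" and x: "x \<in> Q.emb ` ?M m" for g x m
      proof -
        obtain a where a: "a \<in> ?M m" "x = Q.emb a" using x by auto
        have "(g [^]\<^bsub>Gal K F\<^esub> ?q m) a = a" using level(3)[OF _ a(1)] g GA by auto
        moreover have "g [^]\<^bsub>G\<^esub> ?q m = g [^]\<^bsub>Gal K F\<^esub> ?q m"
          unfolding assms(9) pow_subgroup_generated ..
        moreover have "a \<in> carrier K" using a(1) Mc by blast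
        ultimately show ?thesis
          unfolding a(2) using Q.gr_commutes_iff[OF _ G.nat_pow_closed[OF g]] by metis
      qed
      show "\<sigma> i \<in> carrier G" if "i \<in> {1..n}" for i using that by (rule \<sigma>G)
    qed (use generate independent in auto)
    \<comment> \<open>The condition on the fixed field, read in \<open>D\<close>: within the copy of
      \<open>K\<close>, commuting with the unit of \<open>\<sigma> 1\<close> alone already means
      lying in the copy of \<open>F\<close>.\<close>
    have "x \<in> Q.emb ` F" if "x \<in> Q.emb ` carrier K" "Q.gr (\<sigma> 1) \<otimes>\<^bsub>D\<^esub> x = x \<otimes>\<^bsub>D\<^esub> Q.gr (\<sigma> 1)" for x
      using that Q.gr_commutes_iff[OF _ \<sigma>G[OF one]] fixed by auto
    then show ?thesis
      unfolding embF
      using T.center_eq[OF \<sigma>G[OF one]] T.locally_PI T.GK_dimension_eq[OF assms(5)]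
        Q.tw.not_PI_algebra[OF \<sigma>G[OF one] T.s_powers_distinct[OF one] T.F_P] by blast
  qed
  ultimately show ?thesis by blast
qed

end
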